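(* Let $\boldsymbol{A}\in \mathbb{DQ}^{m\times n}$, $\boldsymbol{B}\in \mathbb{DQ}^{n\times p}$, and let $r_1=\mathrm{Arank}(\boldsymbol{A})$, $r_1+r_2=\mathrm{rank}(\boldsymbol{A})$. Then there exist a unitary matrix $\boldsymbol{U}\in \mathbb{DQ}^{m\times m}$ and nonsingular matrices $\boldsymbol{X}\in \mathbb{DQ}^{n\times n}$, $\boldsymbol{Y}\in \mathbb{DQ}^{p\times p}$ such that $$\boldsymbol{A}=\boldsymbol{U}D_{\boldsymbol{A}}\boldsymbol{X}^{-1},\qquad \boldsymbol{B}=\boldsymbol{X}\boldsymbol{D}_{\boldsymbol{B}}\boldsymbol{Y},$$ with $$D_{\boldsymbol{A}}=\begin{pmatrix} I_{r_1}&0&0\\ 0&I_{r_2}\epsilon&0\\ 0&0&0\end{pmatrix}\in\mathbb{D}^{m\times n},\qquad \boldsymbol{D}_{\boldsymbol{B}}=\begin{pmatrix}\Sigma_{\boldsymbol{B}}^{1}&0\\ 0&\begin{pmatrix}\hat\Sigma_{\boldsymbol{B}}\epsilon&0\\0&0\end{pmatrix}\boldsymbol{G}^{-1}\\ 0&\begin{pmatrix}\boldsymbol{\Sigma}_{\boldsymbol{B}}^{2}\\ \boldsymbol{\Sigma}_{\boldsymbol{B}}^{3}\end{pmatrix}\end{pmatrix}\in\mathbb{DQ}^{n\times p},$$ where, for some nonnegative integers $r_{11},r_{12}$ with $r_{11}+r_{12}\le \min\{r_1,p\}$, the block rows of $\boldsymbol{D}_{\boldsymbol{B}}$ have sizes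 $r_{11},\ r_1-r_{11},\ n-r_1$ and its block columns have sizes $r_{11},\ p-r_{11}$; $\boldsymbol{G}\in\mathbb{DQ}^{(p-r_{11})\times(p-r_{11})}$ is nonsingular and $\boldsymbol{Y}=\begin{pmatrix}I_{r_{11}}&0\\0&\boldsymbol{G}\end{pmatrix}\boldsymbol{W}^*$ for some unitary $\boldsymbol{W}\in\mathbb{DQ}^{p\times p}$; $\Sigma_{\boldsymbol{B}}^{1}=\mathrm{diag}(d_1,\dots,d_{r_{11}})$ with appreciable dual numbers $d_1\ge\cdots\ge d_{r_{11}}>0$; $\hat\Sigma_{\boldsymbol{B}}=\mathrm{diag}(\mu_{r_{11}+1},\dots,\mu_{r_{11}+r_{12}})$ is real with $\mu_{r_{11}+1}\ge\cdots\ge\mu_{r_{11}+r_{12}}>0$; and $$\boldsymbol{\Sigma}_{\boldsymbol{B}}^{2}=(\Sigma_1,\ \boldsymbol{N}_1\epsilon,\ 0)\in\mathbb{DQ}^{r_2\times(p-r_{11})},\qquad \boldsymbol{\Sigma}_{\boldsymbol{B}}^{3}=(\Sigma_2,\ \boldsymbol{N}_2\epsilon,\ 0)\in\mathbb{DQ}^{(n-r_1-r_2)\times(p-r_{11})},$$ conformally partitioned, where $\begin{pmatrix}\boldsymbol{N}_1\\ \boldsymbol{N}_2\end{pmatrix}$ has orthonormal columns and, for some nonnegative integers $k,r,\hat r_1,q,t$ with $\hat r_1\le r$, $$\Sigma_1=\begin{pmatrix} I&0&0&0\\ 0&S_1&0&0\\ 0&0&\Xi\epsilon&0\\ 0&0&0&0\end{pmatrix},\qquad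 \Sigma_2=\begin{pmatrix}\Sigma\epsilon&0&0&0&0\\ 0&0&0&0&0\\ 0&0&S_2&0&0\\ 0&0&0&I&0\\ 0&0&0&0&I\end{pmatrix};$$ the block rows of $\Sigma_1$ have sizes $r,\ q,\ t,\ r_2-r-q-t$ and its block columns have sizes $r,\ q,\ t,\ k-r-q-t$; the block rows of $\Sigma_2$ have sizes $\hat r_1,\ n-r_1-r_2+r-k-\hat r_1,\ q,\ t,\ k-r-q-t$ and its block columns have sizes $\hat r_1,\ r-\hat r_1,\ q,\ t,\ k-r-q-t$. Here $\Sigma=\mathrm{diag}(\sigma_1,\dots,\sigma_{\hat r_1})$ and $\Xi=\mathrm{diag}(\xi_1,\dots,\xi_t)$ are real with $\sigma_1\ge\cdots\ge\sigma_{\hat r_1}>0$, $\xi_1\ge\cdots\ge\xi_t>0$, and $S_1=\mathrm{diag}(c_1,\dots,c_q)$, $S_2=\mathrm{diag}(s_1,\dots,s_q)$ have appreciable dual number entries with $0<c_1\le\cdots\le c_q<1$, $1>s_1\ge\cdots\ge s_q>0$, and $c_i^2+s_i^2=1$ for $i=1,\dots,q$.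
   Context: Dual numbers: $\mathbb{D}=\{a+b\epsilon: a,b\in\mathbb{R}\}$ with $\epsilon\neq0$, $\epsilon^2=0$; $a+b\epsilon$ is appreciable if $a\ne0$ and infinitesimal otherwise. $\mathbb{D}$ is totally ordered lexicographically: $a+b\epsilon>a'+b'\epsilon$ iff $a>a'$, or $a=a'$ and $b>b'$. $\mathbb{Q}$ denotes the real (Hamilton) quaternions, and $\mathbb{DQ}=\{\mathbf{q}_{st}+\mathbf{q}_{in}\epsilon:\mathbf{q}_{st},\mathbf{q}_{in}\in\mathbb{Q}\}$ the dual quaternions, where $\epsilon$ commutes with quaternions; conjugation is $\mathbf{q}_{st}^*+\mathbf{q}_{in}^*\epsilon$. For a matrix $\boldsymbol{A}$ over $\mathbb{DQ}$, $\boldsymbol{A}^*$ is its conjugate transpose. A square $\boldsymbol{U}$ is unitary if $\boldsymbol{U}^*\boldsymbol{U}=\boldsymbol{U}\boldsymbol{U}^*=I$; a square matrix is nonsingular if it has a two-sided inverse. A matrix $\boldsymbol{N}$ has orthonormal columns if $\boldsymbol{N}^*\boldsymbol{N}=I$. Rank: every $\boldsymbol{A}\in\mathbb{DQ}^{m\times n}$ has a singular value decomposition (known) $\boldsymbol{U}^*\boldsymbol{A}\boldsymbol{V}=\begin{pmatrix}\mathrm{diag}(\mu_1,\dots,\mu_t)&0\\0&0\end{pmatrix}$ with $\boldsymbol{U},\boldsymbol{V}$ unitary, $\mu_1\ge\cdots\ge\mu_r$ positive appreciable dual numbers and $\mu_{r+1}\ge\cdots\ge\mu_t$ positive infinitesimal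 dual numbers; the $\mu_i$ are unique. Then $\mathrm{rank}(\boldsymbol{A})=t$ and $\mathrm{Arank}(\boldsymbol{A})=r$ (the appreciable rank). $I$ and $0$ denote identity and zero blocks of suitable size; blocks with zero rows or columns are allowed (empty). *)

theory Defs
  imports Complex_Main "Jordan_Normal_Form.Matrix"
begin

section \<open>Quaternions\<close>

datatype quat = Quat (q_re: real) (q_i: real) (q_j: real) (q_k: real)

lemma quat_eq_iff:
  "x = y \<longleftrightarrow> q_re x = q_re y \<and> q_i x = q_i y \<and> q_j x = q_j y \<and> q_k x = q_k y"
  by (auto intro: quat.expand)

instantiation quat :: real_algebra_1
begin

definition "0 = Quat 0 0 0 0"
definition "1 = Quat 1 0 0 0"
definition "x + y = Quat (q_re x + q_re y) (q_i x + q_i y) (q_j x + q_j y) (q_k x + q_k y)"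
definition "- x = Quat (- q_re x) (- q_i x) (- q_j x) (- q_k x)"
definition "x - y = Quat (q_re x - q_re y) (q_i x - q_i y) (q_j x - q_j y) (q_k x - q_k y)"
definition "x * y = Quat
  (q_re x * q_re y - q_i x * q_i y - q_j x * q_j y - q_k x * q_k y)
  (q_re x * q_i y + q_i x * q_re y + q_j x * q_k y - q_k x * q_j y)
  (q_re x * q_j y - q_i x * q_k y + q_j x * q_re y + q_k x * q_i y)
  (q_re x * q_k y + q_i x * q_j y - q_j x * q_i y + q_k x * q_re y)"
definition "a *\<^sub>R x = Quat (a * q_re x) (a * q_i x) (a * q_j x) (a * q_k x)"

instance
  by standard
    (simp_all add: quat_eq_iff zero_quat_def one_quat_def plus_quat_def uminus_quat_def
      minus_quat_def times_quat_def scaleR_quat_def algebra_simps)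

end

instantiation quat :: conjugate
begin

definition "conjugate x = Quat (q_re x) (- q_i x) (- q_j x) (- q_k x)"

instance
  by standard (auto simp: quat_eq_iff conjugate_quat_def)

end


section \<open>Dual numbers\<close>

text \<open>\<open>DN a b\<close> is \<open>a + b\<epsilon>\<close> with coefficients in an arbitrary ring, so that
  \<open>real dual_num\<close> is the ring of dual numbers and \<open>quat dual_num\<close> that of dual quaternions.\<close>

datatype 'a dual_num = DN (std_part: 'a) (inf_part: 'a)

type_synonym dquat = "quat dual_num"

lemma dual_num_eq_iff: "x = y \<longleftrightarrow> std_part x = std_part y \<and> inf_part x = inf_part y"
  by (auto intro: dual_num.expand)

instantiation dual_num :: (ring_1) ring_1
begin

definition "0 = DN 0 0"
definition "1 = DN 1 0"
definition "x + y = DN (std_part x + std_part y) (inf_part x + inf_part y)"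
definition "- x = DN (- std_part x) (- inf_part x)"
definition "x - y = DN (std_part x - std_part y) (inf_part x - inf_part y)"
definition "x * y =
  DN (std_part x * std_part y) (std_part x * inf_part y + inf_part x * std_part y)"

instance
  by standard
    (simp_all add: dual_num_eq_iff zero_dual_num_def one_dual_num_def plus_dual_num_def
      uminus_dual_num_def minus_dual_num_def times_dual_num_def algebra_simps)

end

instance dual_num :: (comm_ring_1) comm_ring_1
  by standard (simp_all add: dual_num_eq_iff times_dual_num_def one_dual_num_def
      plus_dual_num_def algebra_simps)

instantiation dual_num :: (real_algebra_1) real_algebra_1
begin

definition "a *\<^sub>R x = DN (a *\<^sub>R std_part x) (a *\<^sub>R inf_part x)"

instance
  by standard
    (simp_all add: dual_num_eq_iff plus_dual_num_def times_dual_num_def scaleR_dual_num_def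
      algebra_simps)

end

instantiation dual_num :: (linorder) linorder
begin

definition "x < y \<longleftrightarrow> std_part x < std_part y \<or> std_part x = std_part y \<and> inf_part x < inf_part y"
definition "x \<le> (y :: 'a dual_num) \<longleftrightarrow> x < y \<or> x = y"

instance
  by standard (auto simp: less_dual_num_def less_eq_dual_num_def dual_num_eq_iff)

end

instantiation dual_num :: (conjugate) conjugate
begin

definition "conjugate x = DN (conjugate (std_part x)) (conjugate (inf_part x))"

instance
  by standard (auto simp: dual_num_eq_iff conjugate_dual_num_def)

end

definition eps :: "'a::zero_neq_one dual_num" where
  "eps = DN 0 1"

lemma eps_squared: "eps * eps = (0 :: 'a::ring_1 dual_num)"
  by (simp add: eps_def times_dual_num_def zero_dual_num_def)

lemma eps_commutes: "eps * x = x * (eps :: 'a::ring_1 dual_num)"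
  by (simp add: eps_def times_dual_num_def)

lemma dual_num_expand:
  "DN a b = DN a 0 + DN b 0 * (eps :: 'a::ring_1 dual_num)"
  by (simp add: eps_def times_dual_num_def plus_dual_num_def)

definition appreciable :: "'a::zero dual_num \<Rightarrow> bool" where
  "appreciable x \<longleftrightarrow> std_part x \<noteq> 0"

text \<open>The inclusion of the dual numbers into the dual quaternions; reals are included into
  both by \<open>of_real\<close>.\<close>

definition dq_of_dual :: "real dual_num \<Rightarrow> dquat" where
  "dq_of_dual = map_dual_num of_real"


section \<open>Matrices\<close>

definition append_cols :: "'a::zero mat \<Rightarrow> 'a mat \<Rightarrow> 'a mat" (infixr \<open>@\<^sub>c\<close> 66) where
  "A @\<^sub>c B = four_block_mat A B (0\<^sub>m 0 (dim_col A)) (0\<^sub>m 0 (dim_col B))"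

definition conj_transpose :: "'a::conjugate mat \<Rightarrow> 'a mat" where
  "conj_transpose A = map_mat conjugate (transpose_mat A)"

definition unitary_mat :: "dquat mat \<Rightarrow> bool" where
  "unitary_mat U \<longleftrightarrow>
     square_mat U \<and> inverts_mat (conj_transpose U) U \<and> inverts_mat U (conj_transpose U)"

definition orthonormal_cols :: "dquat mat \<Rightarrow> bool" where
  "orthonormal_cols N \<longleftrightarrow> conj_transpose N * N = 1\<^sub>m (dim_col N)"

definition mat_inv :: "'a::ring_1 mat \<Rightarrow> 'a mat" where
  "mat_inv A = (THE B. inverts_mat A B \<and> inverts_mat B A)"

lemma mat_inv_eqI:
  fixes A :: "'a::ring_1 mat"
  assumes A: "A \<in> carrier_mat n n" and AB: "inverts_mat A B" and BA: "inverts_mat B A"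
  shows "mat_inv A = B"
  unfolding mat_inv_def
proof (rule the_equality)
  have carr: "C \<in> carrier_mat n n" if "inverts_mat A C" "inverts_mat C A" for C
    using that A unfolding inverts_mat_def
    by (metis carrier_matD carrier_matI index_mult_mat(2,3) index_one_mat(2,3))
  fix C assume C: "inverts_mat A C \<and> inverts_mat C A"
  have Bc: "B \<in> carrier_mat n n" and Cc: "C \<in> carrier_mat n n"
    using carr AB BA C by blast+
  have "C = C * (A * B)"
    using AB A Cc by (simp add: inverts_mat_def right_mult_one_mat[OF Cc])
  also have "\<dots> = (C * A) * B"
    by (rule assoc_mult_mat[OF Cc A Bc, symmetric])
  also have "\<dots> = B"
    using C Bc Cc by (simp add: inverts_mat_def)
  finally show "C = B" .
qed (use AB BA in blast)


section \<open>Singular values and rank\<close>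

definition is_singular_values :: "dquat mat \<Rightarrow> real dual_num list \<Rightarrow> bool" where
  "is_singular_values A \<mu>s \<longleftrightarrow>
     (let m = dim_row A; n = dim_col A; t = length \<mu>s in
       t \<le> min m n \<and> sorted_wrt (\<ge>) \<mu>s \<and> (\<forall>\<mu>\<in>set \<mu>s. \<mu> > 0) \<and>
       (\<exists>U V. U \<in> carrier_mat m m \<and> unitary_mat U \<and> V \<in> carrier_mat n n \<and> unitary_mat V \<and>
         conj_transpose U * A * V =
           four_block_mat (mat_diag t (\<lambda>i. dq_of_dual (\<mu>s ! i))) (0\<^sub>m t (n - t))
             (0\<^sub>m (m - t) t) (0\<^sub>m (m - t) (n - t))))"

text \<open>Every matrix has exactly one list of singular values, so the choice operator
  picks that list. In the lexicographic order every positive appreciable number exceeds every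
  infinitesimal one, so the appreciable singular values come first.\<close>

definition singular_values :: "dquat mat \<Rightarrow> real dual_num list" where
  "singular_values A = (SOME \<mu>s. is_singular_values A \<mu>s)"

definition dq_rank :: "dquat mat \<Rightarrow> nat" where
  "dq_rank A = length (singular_values A)"

definition dq_Arank :: "dquat mat \<Rightarrow> nat" where
  "dq_Arank A = length (filter appreciable (singular_values A))"


section \<open>The block matrices of the decomposition\<close>

text \<open>All diagonal sequences are indexed from 0. The differences on \<open>nat\<close> below are genuine
  only under the size constraints, which therefore accompany these matrices wherever they are
  used.\<close>

definition D_A :: "nat \<Rightarrow> nat \<Rightarrow> nat \<Rightarrow> nat \<Rightarrow> dquat mat" where
  "D_A m n r\<^sub>1 r\<^sub>2 = (let m\<^sub>3 = m - r\<^sub>1 - r\<^sub>2; n\<^sub>3 = n - r\<^sub>1 - r\<^sub>2 in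
     (1\<^sub>m r\<^sub>1      @\<^sub>c 0\<^sub>m r\<^sub>1 r\<^sub>2            @\<^sub>c 0\<^sub>m r\<^sub>1 n\<^sub>3) @\<^sub>r
     (0\<^sub>m r\<^sub>2 r\<^sub>1   @\<^sub>c (eps \<cdot>\<^sub>m 1\<^sub>m r\<^sub>2)     @\<^sub>c 0\<^sub>m r\<^sub>2 n\<^sub>3) @\<^sub>r
     (0\<^sub>m m\<^sub>3 r\<^sub>1   @\<^sub>c 0\<^sub>m m\<^sub>3 r\<^sub>2            @\<^sub>c 0\<^sub>m m\<^sub>3 n\<^sub>3))"

definition D_B ::
  "nat \<Rightarrow> nat \<Rightarrow> nat \<Rightarrow> nat \<Rightarrow> nat \<Rightarrow> (nat \<Rightarrow> real dual_num) \<Rightarrow> (nat \<Rightarrow> real) \<Rightarrow>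
   dquat mat \<Rightarrow> dquat mat \<Rightarrow> dquat mat \<Rightarrow> dquat mat" where
  "D_B n p r\<^sub>1 r\<^sub>1\<^sub>1 r\<^sub>1\<^sub>2 d \<mu> G \<Sigma>B2 \<Sigma>B3 =
    (let a = r\<^sub>1 - r\<^sub>1\<^sub>1; b = p - r\<^sub>1\<^sub>1;
         \<Sigma>B1 = mat_diag r\<^sub>1\<^sub>1 (\<lambda>i. dq_of_dual (d i));
         \<Sigma>hat = mat_diag r\<^sub>1\<^sub>2 (\<lambda>i. of_real (\<mu> i));
         M = four_block_mat (eps \<cdot>\<^sub>m \<Sigma>hat) (0\<^sub>m r\<^sub>1\<^sub>2 (b - r\<^sub>1\<^sub>2))
               (0\<^sub>m (a - r\<^sub>1\<^sub>2) r\<^sub>1\<^sub>2) (0\<^sub>m (a - r\<^sub>1\<^sub>2) (b - r\<^sub>1\<^sub>2))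
     in
       (\<Sigma>B1                 @\<^sub>c 0\<^sub>m r\<^sub>1\<^sub>1 b) @\<^sub>r
       (0\<^sub>m a r\<^sub>1\<^sub>1           @\<^sub>c (M * mat_inv G)) @\<^sub>r
       (0\<^sub>m (n - r\<^sub>1) r\<^sub>1\<^sub>1    @\<^sub>c (\<Sigma>B2 @\<^sub>r \<Sigma>B3)))"

definition Sigma1 ::
  "nat \<Rightarrow> nat \<Rightarrow> nat \<Rightarrow> nat \<Rightarrow> nat \<Rightarrow> (nat \<Rightarrow> real dual_num) \<Rightarrow> (nat \<Rightarrow> real) \<Rightarrow> dquat mat" where
  "Sigma1 r\<^sub>2 k r q t c \<xi> =
    (let e = k - r - q - t; f = r\<^sub>2 - r - q - t;
         S\<^sub>1 = mat_diag q (\<lambda>i. dq_of_dual (c i));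
         \<Xi> = mat_diag t (\<lambda>i. of_real (\<xi> i))
     in
       (1\<^sub>m r     @\<^sub>c 0\<^sub>m r q  @\<^sub>c 0\<^sub>m r t         @\<^sub>c 0\<^sub>m r e) @\<^sub>r
       (0\<^sub>m q r   @\<^sub>c S\<^sub>1      @\<^sub>c 0\<^sub>m q t         @\<^sub>c 0\<^sub>m q e) @\<^sub>r
       (0\<^sub>m t r   @\<^sub>c 0\<^sub>m t q  @\<^sub>c (eps \<cdot>\<^sub>m \<Xi>)     @\<^sub>c 0\<^sub>m t e) @\<^sub>r
       (0\<^sub>m f r   @\<^sub>c 0\<^sub>m f q  @\<^sub>c 0\<^sub>m f t         @\<^sub>c 0\<^sub>m f e))"

text \<open>\<open>n'\<close> is the total number of rows of \<open>\<Sigma>\<^sub>2\<close>, i.e. \<open>n - r\<^sub>1 - r\<^sub>2\<close>.\<close>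

definition Sigma2 ::
  "nat \<Rightarrow> nat \<Rightarrow> nat \<Rightarrow> nat \<Rightarrow> nat \<Rightarrow> nat \<Rightarrow> (nat \<Rightarrow> real) \<Rightarrow> (nat \<Rightarrow> real dual_num) \<Rightarrow> dquat mat" where
  "Sigma2 n' k r rhat q t \<sigma> s =
    (let e = k - r - q - t; g = n' + r - k - rhat; h = r - rhat;
         \<Sigma> = mat_diag rhat (\<lambda>i. of_real (\<sigma> i));
         S\<^sub>2 = mat_diag q (\<lambda>i. dq_of_dual (s i))
     in
       ((eps \<cdot>\<^sub>m \<Sigma>)   @\<^sub>c 0\<^sub>m rhat h @\<^sub>c 0\<^sub>m rhat q @\<^sub>c 0\<^sub>m rhat t @\<^sub>c 0\<^sub>m rhat e) @\<^sub>r
       (0\<^sub>m g rhat    @\<^sub>c 0\<^sub>m g h    @\<^sub>c 0\<^sub>m g q    @\<^sub>c 0\<^sub>m g t    @\<^sub>c 0\<^sub>m g e) @\<^sub>r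
       (0\<^sub>m q rhat    @\<^sub>c 0\<^sub>m q h    @\<^sub>c S\<^sub>2        @\<^sub>c 0\<^sub>m q t    @\<^sub>c 0\<^sub>m q e) @\<^sub>r
       (0\<^sub>m t rhat    @\<^sub>c 0\<^sub>m t h    @\<^sub>c 0\<^sub>m t q    @\<^sub>c 1\<^sub>m t      @\<^sub>c 0\<^sub>m t e) @\<^sub>r
       (0\<^sub>m e rhat    @\<^sub>c 0\<^sub>m e h    @\<^sub>c 0\<^sub>m e q    @\<^sub>c 0\<^sub>m e t    @\<^sub>c 1\<^sub>m e))"

definition decreasing_upto :: "nat \<Rightarrow> (nat \<Rightarrow> 'a::order) \<Rightarrow> bool" where
  "decreasing_upto n f \<longleftrightarrow> (\<forall>i j. i \<le> j \<and> j < n \<longrightarrow> f j \<le> f i)"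

definition increasing_upto :: "nat \<Rightarrow> (nat \<Rightarrow> 'a::order) \<Rightarrow> bool" where
  "increasing_upto n f \<longleftrightarrow> (\<forall>i j. i \<le> j \<and> j < n \<longrightarrow> f i \<le> f j)"

end

theory Submission
  imports Defs "Jordan_Normal_Form.Spectral_Radius" "HOL-Combinatorics.List_Permutation"
begin

text \<open>
  Write \<open>A = U\<^sub>0 D\<^sub>A R\<close> with \<open>U\<^sub>0\<close> unitary and \<open>R\<close> invertible: this is the singular value decomposition
  of \<open>A\<close> after the columns have been rescaled so that appreciable singular values become \<open>1\<close> and
  infinitesimal ones become \<open>eps\<close> (\<open>rank_factorization\<close>). Every other admissible choice
  is \<open>X = R\<^sup>-\<^sup>1 Z\<close>, where \<open>Z\<close> satisfies \<open>D\<^sub>A Z = P D\<^sub>A\<close> for some unitary \<open>P\<close>; then \<open>U = U\<^sub>0 P\<close>.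
  The theorem thus asks for a normal form of \<open>R B\<close> under such row operations \<open>Z\<close> and under the
  column operations \<open>Y\<close>.

  Divide the rows of \<open>R B\<close> according to the blocks \<open>I\<close>, \<open>I\<epsilon>\<close> and \<open>0\<close> of \<open>D\<^sub>A\<close>. The following
  row operations are available (they are the lemmas named \<open>absorbs\<close>): unitary operations in the first and in the
  second block; invertible operations in the third; adding any multiple of an earlier block
  to a later one; and, on the last two blocks, every \<open>I + T\<epsilon>\<close>. The decisive one is adding
  multiples of the first block to the second. It multiplies \<open>D\<^sub>A\<close> on the right by a matrix that is not
  unitary, but its effect on \<open>D\<^sub>A\<close> is only infinitesimal, and an infinitesimal rotation \<open>I + S\<epsilon>\<close> from the left
  has the same effect because \<open>eps * eps = 0\<close> (\<open>absorbs_shear\<close>).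

  These operations suffice. A singular value decomposition of the first block
  of rows of \<open>R B\<close> yields \<open>W\<close>, the \<open>d\<^sub>i\<close> and the \<open>\<mu>\<^sub>i\<close>. The columns below the appreciable \<open>d\<^sub>i\<close> are
  cleared by row operations. In the other columns, the last two blocks are reduced modulo \<open>eps\<close> by
  rank factorizations to two identity blocks
  (\<open>normal_form_std\<close>). The infinitesimal error in the columns of the identity blocks
  disappears under some \<open>I + T\<epsilon>\<close>; in the remaining columns it is \<open>K\<epsilon>\<close> for a quaternion matrix
  \<open>K\<close>, and column operations turn \<open>K\<close> into \<open>(N, 0)\<close> with orthonormal columns \<open>N\<close>
  (\<open>normal_form\<close>). The result is the required form with \<open>rhat = q = t = 0\<close>.

  The singular value decomposition itself is constructed from the spectral theorem for Hermitian dual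
  quaternion matrices. A quaternion Hermitian matrix has an eigenvector because it acts as a complex matrix
  of twice the size; splitting off eigenvectors diagonalizes the standard part, first-order perturbation
  theory then provides eigenvectors over the dual quaternions
  (\<open>hermitian_eigenvector_diagonal_std\<close>), and splitting these off gives \<open>hermitian_diagonalization\<close>.
  Applied to \<open>A\<^sup>* A\<close> this produces singular triples, which are split off in turn (\<open>svd_unsorted\<close>).
\<close>

section \<open>Dual quaternions and their matrices\<close>

lemmas dnq_defs = zero_dual_num_def one_dual_num_def plus_dual_num_def uminus_dual_num_def
  minus_dual_num_def times_dual_num_def conjugate_dual_num_def

lemma dual_parts [simp]:
  "std_part (0 :: 'a::ring_1 dual_num) = 0" "inf_part (0 :: 'a::ring_1 dual_num) = 0"
  "std_part (1 :: 'a::ring_1 dual_num) = 1" "inf_part (1 :: 'a::ring_1 dual_num) = 0"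
  "std_part (x + y) = std_part x + std_part y" "inf_part (x + y) = inf_part x + inf_part y"
  "std_part (x - y) = std_part x - std_part y" "inf_part (x - y) = inf_part x - inf_part y"
  "std_part (- x) = - std_part x" "inf_part (- x) = - inf_part x"
  "std_part (x * y) = std_part x * std_part y"
  "inf_part (x * y) = std_part x * inf_part y + inf_part x * std_part y"
  "std_part (eps :: 'a::ring_1 dual_num) = 0" "inf_part (eps :: 'a::ring_1 dual_num) = 1"
  for x y :: "'a::ring_1 dual_num"
  by (simp_all add: dnq_defs eps_def)

lemma dual_parts_conjugate [simp]:
  "std_part (conjugate z) = conjugate (std_part z)"
  "inf_part (conjugate z) = conjugate (inf_part z)"
  by (simp_all add: conjugate_dual_num_def)

lemma quat_parts [simp]:
  "q_re 0 = 0" "q_i 0 = 0" "q_j 0 = 0" "q_k 0 = 0"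
  "q_re 1 = 1" "q_i 1 = 0" "q_j 1 = 0" "q_k 1 = 0"
  "q_re (x + y) = q_re x + q_re y" "q_i (x + y) = q_i x + q_i y"
  "q_j (x + y) = q_j x + q_j y" "q_k (x + y) = q_k x + q_k y"
  "q_re (x - y) = q_re x - q_re y" "q_i (x - y) = q_i x - q_i y"
  "q_j (x - y) = q_j x - q_j y" "q_k (x - y) = q_k x - q_k y"
  "q_re (- x) = - q_re x" "q_i (- x) = - q_i x" "q_j (- x) = - q_j x" "q_k (- x) = - q_k x"
  "q_re (conjugate x) = q_re x" "q_i (conjugate x) = - q_i x"
  "q_j (conjugate x) = - q_j x" "q_k (conjugate x) = - q_k x"
  "q_re (a *\<^sub>R x) = a * q_re x" "q_i (a *\<^sub>R x) = a * q_i x"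
  "q_j (a *\<^sub>R x) = a * q_j x" "q_k (a *\<^sub>R x) = a * q_k x"
  by (simp_all add: zero_quat_def one_quat_def plus_quat_def minus_quat_def uminus_quat_def
      conjugate_quat_def scaleR_quat_def)

lemma quat_parts_mult:
  "q_re (x * y) = q_re x * q_re y - q_i x * q_i y - q_j x * q_j y - q_k x * q_k y"
  "q_i (x * y) = q_re x * q_i y + q_i x * q_re y + q_j x * q_k y - q_k x * q_j y"
  "q_j (x * y) = q_re x * q_j y - q_i x * q_k y + q_j x * q_re y + q_k x * q_i y"
  "q_k (x * y) = q_re x * q_k y + q_i x * q_j y - q_j x * q_i y + q_k x * q_re y"
  by (simp_all add: times_quat_def)

lemma quat_parts_of_real [simp]:
  "q_re (of_real a) = a" "q_i (of_real a) = 0" "q_j (of_real a) = 0" "q_k (of_real a) = 0"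
  by (simp_all add: of_real_def)

lemma dual_parts_of_real [simp]:
  "std_part (of_real a) = of_real a" "inf_part (of_real a :: dquat) = 0"
  by (simp_all add: of_real_def scaleR_dual_num_def)

lemma of_real_quat_commutes: "of_real a * (x :: quat) = x * of_real a"
  by (simp add: quat_eq_iff quat_parts_mult)

lemma conjugate_quat_simps [simp]:
  "conjugate (0::quat) = 0" "conjugate (1::quat) = 1" "conjugate (of_real a :: quat) = of_real a"
  "conjugate (x + y) = conjugate x + conjugate y" "conjugate (x - y) = conjugate x - conjugate y"
  "conjugate (- x) = - conjugate x" "conjugate (x * y) = conjugate y * conjugate x"
  for x y :: quat
  by (simp_all add: quat_eq_iff quat_parts_mult)

lemma conjugate_dquat_simps [simp]:
  "conjugate (0::dquat) = 0" "conjugate (1::dquat) = 1"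
  "conjugate (x + y) = conjugate x + conjugate y" "conjugate (x - y) = conjugate x - conjugate y"
  "conjugate (- x) = - conjugate x" "conjugate (x * y) = conjugate y * conjugate x"
  for x y :: dquat
  by (simp_all add: dual_num_eq_iff add.commute)

lemma conjugate_sum_dquat: "conjugate (sum f S) = (\<Sum>i\<in>S. conjugate (f i :: dquat))"
  by (induction S rule: infinite_finite_induct) auto

lemma dual_parts_sum:
  "std_part (sum f S) = (\<Sum>i\<in>S. std_part (f i))" "inf_part (sum f S) = (\<Sum>i\<in>S. inf_part (f i))"
  for f :: "_ \<Rightarrow> 'a::ring_1 dual_num"
  by (induction S rule: infinite_finite_induct) auto

text \<open>The dual numbers are the center of the dual quaternions. Singular values, and eigenvalues of
  Hermitian matrices, live there, which is why they may be moved freely through matrix products.\<close>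

lemma dq_of_dual_parts [simp]:
  "std_part (dq_of_dual z) = of_real (std_part z)" "inf_part (dq_of_dual z) = of_real (inf_part z)"
  by (cases z; simp add: dq_of_dual_def)+

lemma dq_of_dual_simps [simp]:
  "dq_of_dual 0 = 0" "dq_of_dual 1 = 1" "dq_of_dual eps = eps"
  "dq_of_dual (y + z) = dq_of_dual y + dq_of_dual z"
  "dq_of_dual (- z) = - dq_of_dual z"
  "dq_of_dual (y * z) = dq_of_dual y * dq_of_dual z"
  "conjugate (dq_of_dual z) = dq_of_dual z"
  by (simp_all add: dual_num_eq_iff)

lemma dq_of_dual_commutes: "dq_of_dual z * x = x * dq_of_dual z"
  by (simp add: dual_num_eq_iff of_real_quat_commutes add.commute)

lemma dual_inverse_ex:
  fixes z :: "real dual_num"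
  assumes "std_part z \<noteq> 0"
  obtains y where "y * z = 1"
proof
  show "DN (1 / std_part z) (- inf_part z / (std_part z)\<^sup>2) * z = 1"
    using assms by (simp add: dual_num_eq_iff power2_eq_square)
qed

lemma dual_sqrt_ex:
  fixes z :: "real dual_num"
  assumes "std_part z > 0"
  obtains y where "y * y = z" "std_part y > 0"
proof
  show "DN (sqrt (std_part z)) (inf_part z / (2 * sqrt (std_part z))) *
      DN (sqrt (std_part z)) (inf_part z / (2 * sqrt (std_part z))) = z"
    using assms by (simp add: dual_num_eq_iff)
qed (use assms in auto)

lemma conjugate_mult_self_quat:
  "conjugate x * x = of_real ((q_re x)\<^sup>2 + (q_i x)\<^sup>2 + (q_j x)\<^sup>2 + (q_k x)\<^sup>2)"
  "x * conjugate x = of_real ((q_re x)\<^sup>2 + (q_i x)\<^sup>2 + (q_j x)\<^sup>2 + (q_k x)\<^sup>2)"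
  by (simp_all add: quat_eq_iff quat_parts_mult power2_eq_square)

lemma quat_norm_pos: "x \<noteq> 0 \<Longrightarrow> (q_re x)\<^sup>2 + (q_i x)\<^sup>2 + (q_j x)\<^sup>2 + (q_k x)\<^sup>2 > 0" for x :: quat
  by (auto simp: quat_eq_iff add_nonneg_pos add_pos_nonneg)

lemma quat_inverse_ex:
  assumes "(x::quat) \<noteq> 0"
  obtains y where "y * x = 1" "x * y = 1"
proof
  let ?N = "(q_re x)\<^sup>2 + (q_i x)\<^sup>2 + (q_j x)\<^sup>2 + (q_k x)\<^sup>2"
  have N: "?N \<noteq> 0"
    using quat_norm_pos[OF assms] by simp
  show "(of_real (1 / ?N) * conjugate x) * x = 1"
    using N by (simp only: mult.assoc conjugate_mult_self_quat flip: of_real_mult) simp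
  have "x * (of_real (1 / ?N) * conjugate x) = of_real (1 / ?N) * (x * conjugate x)"
    using of_real_quat_commutes[of "1 / ?N" x] by (simp only: mult.assoc[symmetric])
  then show "x * (of_real (1 / ?N) * conjugate x) = 1"
    using N by (simp only: conjugate_mult_self_quat flip: of_real_mult) simp
qed

lemma dquat_inverse_ex:
  assumes "std_part (x::dquat) \<noteq> 0"
  obtains y where "y * x = 1" "x * y = 1"
proof -
  obtain a where a: "a * std_part x = 1" "std_part x * a = 1"
    using quat_inverse_ex[OF assms] by blast
  let ?y = "DN a (- (a * inf_part x * a))"
  have "?y * x = 1"
    using a by (simp add: dual_num_eq_iff mult.assoc)
  moreover have "x * ?y = 1"
    using a by (simp add: dual_num_eq_iff flip: mult.assoc)
  ultimately show ?thesis
    using that by blast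
qed

text \<open>Congruence modulo \<open>eps\<close> is expressed below by an equation between multiples of \<open>eps\<close>: in this
  form it is preserved by matrix products without any further notion of standard part of a
  matrix.\<close>

lemma eps_mult_eq_iff: "eps * x = eps * y \<longleftrightarrow> std_part x = std_part (y :: dquat)"
  by (simp add: dual_num_eq_iff)


subsection \<open>Matrix algebra with dimension side conditions\<close>

text \<open>The associativity and distributivity laws in terms of dimensions only, so that the simplifier
  needs no instantiation of the sizes.\<close>

lemma mult_assoc_dim:
  "dim_col A = dim_row B \<Longrightarrow> dim_col B = dim_row C \<Longrightarrow> A * B * C = A * (B * (C :: dquat mat))"
  by (rule assoc_mult_mat) auto

lemma mult_one_dim [simp]:
  "dim_col A = n \<Longrightarrow> A * 1\<^sub>m n = (A :: dquat mat)" "dim_row A = n \<Longrightarrow> 1\<^sub>m n * A = A"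
  by auto

lemma mult_zero_dim [simp]:
  "dim_col A = k \<Longrightarrow> A * 0\<^sub>m k n = 0\<^sub>m (dim_row A) n"
  "dim_row A = k \<Longrightarrow> 0\<^sub>m n k * A = 0\<^sub>m n (dim_col A)"
  for A :: "dquat mat"
  by (auto intro: right_mult_zero_mat left_mult_zero_mat)

lemma add_zero_dim [simp]:
  "dim_row A = m \<Longrightarrow> dim_col A = n \<Longrightarrow> A + 0\<^sub>m m n = A"
  "dim_row A = m \<Longrightarrow> dim_col A = n \<Longrightarrow> 0\<^sub>m m n + A = A"
  for A :: "dquat mat"
  by (rule eq_matI; simp)+

lemma mult_add_dim:
  "dim_col A = dim_row B \<Longrightarrow> dim_row B = dim_row C \<Longrightarrow> dim_col B = dim_col C \<Longrightarrow>
    A * (B + C) = A * B + A * C"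
  "dim_row A = dim_row B \<Longrightarrow> dim_col A = dim_col B \<Longrightarrow> dim_col B = dim_row C \<Longrightarrow>
    (A + B) * C = A * C + B * C"
  for A B C :: "dquat mat"
  by (rule mult_add_distrib_mat[of _ "dim_row A" "dim_row B" _ "dim_col B"], auto)
    (rule add_mult_distrib_mat[of _ "dim_row A" "dim_col A" _ _ "dim_col C"], auto)

lemma mult_minus_dim:
  "dim_col A = dim_row B \<Longrightarrow> dim_row B = dim_row C \<Longrightarrow> dim_col B = dim_col C \<Longrightarrow>
    A * (B - C) = A * B - A * C"
  "dim_row A = dim_row B \<Longrightarrow> dim_col A = dim_col B \<Longrightarrow> dim_col B = dim_row C \<Longrightarrow>
    (A - B) * C = A * C - B * C"
  for A B C :: "dquat mat"
  by (rule mult_minus_distrib_mat[of _ "dim_row A" "dim_row B" _ "dim_col B"], auto)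
    (rule minus_mult_distrib_mat[of _ "dim_row A" "dim_col A" _ _ "dim_col C"], auto)

lemma mat_mult_index:
  "i < dim_row A \<Longrightarrow> j < dim_col B \<Longrightarrow> dim_col A = dim_row B \<Longrightarrow>
    (A * B) $$ (i,j) = (\<Sum>l<dim_row B. A $$ (i,l) * B $$ (l,j))"
  by (simp add: scalar_prod_def atLeast0LessThan)

text \<open>Entries of products stay folded, to be expanded only on demand and then into sums.\<close>

declare index_mult_mat(1) [simp del]

lemma smult_mult_left: "dim_col A = dim_row B \<Longrightarrow> (z \<cdot>\<^sub>m A) * B = z \<cdot>\<^sub>m (A * (B :: dquat mat))"
  by (rule eq_matI) (auto simp: mat_mult_index sum_distrib_left mult.assoc)

lemma smult_mult_right:
  "dim_col A = dim_row B \<Longrightarrow> A * (dq_of_dual z \<cdot>\<^sub>m B) = dq_of_dual z \<cdot>\<^sub>m (A * B)"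
  by (rule eq_matI)
    (auto simp: mat_mult_index sum_distrib_left dq_of_dual_commutes mult.assoc)

lemma smult_mult_right_eps: "dim_col A = dim_row B \<Longrightarrow> A * (eps \<cdot>\<^sub>m B) = eps \<cdot>\<^sub>m (A * (B :: dquat mat))"
  using smult_mult_right[of A B eps] by simp

lemma smult_smult: "y \<cdot>\<^sub>m (z \<cdot>\<^sub>m A) = (y * z) \<cdot>\<^sub>m (A :: dquat mat)"
  by (rule eq_matI) (auto simp: mult.assoc)

lemma smult_one_zero [simp]: "1 \<cdot>\<^sub>m A = A" "0 \<cdot>\<^sub>m A = 0\<^sub>m (dim_row A) (dim_col A)" for A :: "dquat mat"
  by (rule eq_matI; auto)+

lemma mat_cong_eps:
  assumes "eps \<cdot>\<^sub>m A = eps \<cdot>\<^sub>m (B :: dquat mat)"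
  obtains Y where "A = B + eps \<cdot>\<^sub>m Y" "dim_row Y = dim_row A" "dim_col Y = dim_col A"
proof
  have dims: "dim_row A = dim_row B" "dim_col A = dim_col B"
    using arg_cong[OF assms, of dim_row] arg_cong[OF assms, of dim_col] by auto
  let ?Y = "mat (dim_row A) (dim_col A) (\<lambda>(i,j). DN (inf_part (A $$ (i,j) - B $$ (i,j))) 0)"
  show "A = B + eps \<cdot>\<^sub>m ?Y"
  proof (rule eq_matI)
    fix i j assume ij: "i < dim_row (B + eps \<cdot>\<^sub>m ?Y)" "j < dim_col (B + eps \<cdot>\<^sub>m ?Y)"
    have "eps * A $$ (i,j) = eps * B $$ (i,j)"
      using arg_cong[OF assms, of "\<lambda>M. M $$ (i,j)"] ij dims by simp
    then show "A $$ (i,j) = (B + eps \<cdot>\<^sub>m ?Y) $$ (i,j)"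
      using ij dims by (simp add: dual_num_eq_iff)
  qed (use dims in auto)
qed auto

abbreviation adjoint :: "dquat mat \<Rightarrow> dquat mat" (\<open>_\<^sup>\<dagger>\<close> [1000] 1000) where
  "A\<^sup>\<dagger> \<equiv> conj_transpose A"

lemma adjoint_dim [simp]: "dim_row A\<^sup>\<dagger> = dim_col A" "dim_col A\<^sup>\<dagger> = dim_row A"
  by (simp_all add: conj_transpose_def)

lemma adjoint_carrier [simp]: "A \<in> carrier_mat m n \<Longrightarrow> A\<^sup>\<dagger> \<in> carrier_mat n m"
  by (metis adjoint_dim carrier_matD carrier_matI)

lemma adjoint_index [simp]:
  "i < dim_col A \<Longrightarrow> j < dim_row A \<Longrightarrow> A\<^sup>\<dagger> $$ (i,j) = conjugate (A $$ (j,i))"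
  by (simp add: conj_transpose_def)

lemma adjoint_mult: "dim_col A = dim_row B \<Longrightarrow> (A * B)\<^sup>\<dagger> = B\<^sup>\<dagger> * A\<^sup>\<dagger>"
  by (rule eq_matI)
    (auto simp: mat_mult_index conjugate_sum_dquat)

lemma adjoint_simps [simp]:
  "A\<^sup>\<dagger>\<^sup>\<dagger> = A" "(1\<^sub>m n)\<^sup>\<dagger> = 1\<^sub>m n" "(0\<^sub>m m n)\<^sup>\<dagger> = 0\<^sub>m n m"
  by (rule eq_matI; auto)+

lemma adjoint_minus: "dim_row A = dim_row B \<Longrightarrow> dim_col A = dim_col B \<Longrightarrow> (A - B)\<^sup>\<dagger> = A\<^sup>\<dagger> - B\<^sup>\<dagger>"
  by (rule eq_matI) auto

lemma adjoint_add: "dim_row A = dim_row B \<Longrightarrow> dim_col A = dim_col B \<Longrightarrow> (A + B)\<^sup>\<dagger> = A\<^sup>\<dagger> + B\<^sup>\<dagger>"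
  by (rule eq_matI) auto

lemma adjoint_smult: "(dq_of_dual z \<cdot>\<^sub>m A)\<^sup>\<dagger> = dq_of_dual z \<cdot>\<^sub>m A\<^sup>\<dagger>"
  by (rule eq_matI) (auto simp: dq_of_dual_commutes)

lemma adjoint_smult_eps: "(eps \<cdot>\<^sub>m A)\<^sup>\<dagger> = eps \<cdot>\<^sub>m A\<^sup>\<dagger>"
  using adjoint_smult[of eps A] by simp

lemma adjoint_four_block:
  assumes "A \<in> carrier_mat m1 n1" "B \<in> carrier_mat m1 n2" "C \<in> carrier_mat m2 n1" "D \<in> carrier_mat m2 n2"
  shows "(four_block_mat A B C D)\<^sup>\<dagger> = four_block_mat A\<^sup>\<dagger> C\<^sup>\<dagger> B\<^sup>\<dagger> D\<^sup>\<dagger>"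
  using assms by (intro eq_matI) auto

lemma unitary_mat_iff:
  "U \<in> carrier_mat n n \<Longrightarrow> unitary_mat U \<longleftrightarrow> U\<^sup>\<dagger> * U = 1\<^sub>m n \<and> U * U\<^sup>\<dagger> = 1\<^sub>m n"
  by (auto simp: unitary_mat_def inverts_mat_def)

abbreviation unitary_of :: "nat \<Rightarrow> dquat mat \<Rightarrow> bool" where
  "unitary_of n U \<equiv> U \<in> carrier_mat n n \<and> unitary_mat U"

lemma unitary_ofD:
  assumes "unitary_of n U"
  shows "dim_row U = n" "dim_col U = n" "U\<^sup>\<dagger> * U = 1\<^sub>m n" "U * U\<^sup>\<dagger> = 1\<^sub>m n"
  using assms unitary_mat_iff[of U n] by auto

lemma unitary_cancel:
  assumes "unitary_of n U" "dim_row A = n"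
  shows "U\<^sup>\<dagger> * (U * A) = A" "U * (U\<^sup>\<dagger> * A) = A"
  using unitary_ofD[OF assms(1)] assms(2) by (simp_all flip: mult_assoc_dim)

lemma unitary_one: "unitary_of n (1\<^sub>m n)"
  by (simp add: unitary_mat_iff[of _ n])

lemma unitary_adjoint: "unitary_of n U \<Longrightarrow> unitary_of n U\<^sup>\<dagger>"
  using unitary_mat_iff[of U n] unitary_mat_iff[of "U\<^sup>\<dagger>" n] by auto

lemma unitary_mult:
  assumes U: "unitary_of n U" and V: "unitary_of n V"
  shows "unitary_of n (U * V)"
proof -
  note [simp] = unitary_ofD[OF U] unitary_ofD[OF V]
  have "U * V \<in> carrier_mat n n"
    using U V by auto
  then show ?thesis
    by (simp add: unitary_mat_iff[of _ n] adjoint_mult mult_assoc_dim unitary_cancel[OF U] unitary_cancel[OF V])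
qed

definition bdiag :: "dquat mat \<Rightarrow> dquat mat \<Rightarrow> dquat mat" where
  "bdiag A B = four_block_mat A (0\<^sub>m (dim_row A) (dim_col B)) (0\<^sub>m (dim_row B) (dim_col A)) B"

lemma bdiag_dim [simp]:
  "dim_row (bdiag A B) = dim_row A + dim_row B" "dim_col (bdiag A B) = dim_col A + dim_col B"
  by (simp_all add: bdiag_def)

lemma bdiag_carrier [simp]:
  "A \<in> carrier_mat m n \<Longrightarrow> B \<in> carrier_mat m' n' \<Longrightarrow> bdiag A B \<in> carrier_mat (m + m') (n + n')"
  by (simp add: bdiag_def)

lemma bdiag_mult:
  assumes "dim_col A = dim_row A'" "dim_col B = dim_row B'"
  shows "bdiag A B * bdiag A' B' = bdiag (A * A') (B * B')"
proof -
  obtain m n where A: "A \<in> carrier_mat m n" by blast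
  obtain m' n' where B: "B \<in> carrier_mat m' n'" by blast
  obtain k where A': "A' \<in> carrier_mat n k"
    using assms(1) A by (metis carrier_matD(2) carrier_matI)
  obtain k' where B': "B' \<in> carrier_mat n' k'"
    using assms(2) B by (metis carrier_matD(2) carrier_matI)
  show ?thesis
    unfolding bdiag_def using A B A' B' by (simp add: mult_four_block_mat[OF A _ _ B A' _ _ B'])
qed

lemma bdiag_adjoint: "(bdiag A B)\<^sup>\<dagger> = bdiag A\<^sup>\<dagger> B\<^sup>\<dagger>"
  unfolding bdiag_def
  by (subst adjoint_four_block[of _ "dim_row A" "dim_col A" _ "dim_col B" _ "dim_row B"]) simp_all

lemma bdiag_smult: "z \<cdot>\<^sub>m bdiag A B = bdiag (z \<cdot>\<^sub>m A) (z \<cdot>\<^sub>m B)"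
  unfolding bdiag_def
  by (subst smult_four_block_mat[of _ "dim_row A" "dim_col A" _ "dim_col B" _ "dim_row B"]) simp_all

lemma bdiag_one: "bdiag (1\<^sub>m m) (1\<^sub>m n) = 1\<^sub>m (m + n)"
  by (simp add: bdiag_def)

lemma unitary_bdiag:
  assumes U: "unitary_of m U" and V: "unitary_of n V"
  shows "unitary_of (m + n) (bdiag U V)"
proof -
  note [simp] = unitary_ofD[OF U] unitary_ofD[OF V]
  have "bdiag U V \<in> carrier_mat (m + n) (m + n)"
    by (intro carrier_matI) simp_all
  then show ?thesis
    by (simp add: unitary_mat_iff[of _ "m + n"] bdiag_adjoint bdiag_mult bdiag_one)
qed


section \<open>Completing a unit vector to a unitary matrix\<close>

definition unit_col :: "nat \<Rightarrow> nat \<Rightarrow> dquat mat" where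
  "unit_col n j = mat n 1 (\<lambda>(i,_). if i = j then 1 else 0)"

abbreviation e0 :: "nat \<Rightarrow> dquat mat" where
  "e0 n \<equiv> unit_col n 0"

lemma unit_col_dim [simp]:
  "dim_row (unit_col n j) = n" "dim_col (unit_col n j) = Suc 0" "unit_col n j \<in> carrier_mat n 1"
  by (simp_all add: unit_col_def)

lemma unit_col_index [simp]: "i < n \<Longrightarrow> unit_col n j $$ (i,0) = (if i = j then 1 else 0)"
  by (simp add: unit_col_def)

lemma mult_unit_col_index:
  "dim_col A = n \<Longrightarrow> j < n \<Longrightarrow> i < dim_row A \<Longrightarrow> (A * unit_col n j) $$ (i,0) = A $$ (i,j)"
  by (simp add: mat_mult_index if_distrib cong: if_cong)

lemma unit_col_unit: "j < n \<Longrightarrow> (unit_col n j)\<^sup>\<dagger> * unit_col n j = 1\<^sub>m 1"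
  by (rule eq_matI) (simp_all add: mult_unit_col_index)

text \<open>A reflection that is not necessarily an involution: with \<open>w = x - y\<close>, the matrix
  \<open>I - w (w\<^sup>* x)\<^sup>-\<^sup>1 w\<^sup>*\<close> sends \<open>x\<close> to \<open>y\<close>, and it is unitary because
  \<open>w\<^sup>* w = w\<^sup>* x + x\<^sup>* w\<close> whenever \<open>x\<close> and \<open>y\<close> are unit vectors. In contrast to a
  Householder reflection this requires no adjustment of the phase of \<open>y\<^sup>* x\<close>, which
  would be awkward for infinitesimal values.\<close>

lemma reflection_unitary:
  assumes x: "x \<in> carrier_mat n 1" "x\<^sup>\<dagger> * x = 1\<^sub>m 1"
    and y: "y \<in> carrier_mat n 1" "y\<^sup>\<dagger> * y = 1\<^sub>m 1"
    and b: "b \<in> carrier_mat 1 1" "b * ((x - y)\<^sup>\<dagger> * x) = 1\<^sub>m 1" "((x - y)\<^sup>\<dagger> * x) * b = 1\<^sub>m 1"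
  shows "\<exists>U. unitary_of n U \<and> U * x = y"
proof -
  define w where "w = x - y"
  define c where "c = w\<^sup>\<dagger> * x"
  define U where "U = 1\<^sub>m n - w * (b * w\<^sup>\<dagger>)"
  have dims [simp]: "dim_row x = n" "dim_col x = Suc 0" "dim_row y = n" "dim_col y = Suc 0"
    "dim_row b = Suc 0" "dim_col b = Suc 0"
    using x y b by auto
  have wdim [simp]: "dim_row w = n" "dim_col w = Suc 0" "dim_row c = Suc 0" "dim_col c = Suc 0"
    "dim_row U = n" "dim_col U = n"
    by (simp_all add: w_def c_def U_def)
  have bc: "b * c = 1\<^sub>m 1" "c * b = 1\<^sub>m 1"
    using b by (simp_all add: c_def w_def)
  have bc': "c\<^sup>\<dagger> * b\<^sup>\<dagger> = 1\<^sub>m 1" "b\<^sup>\<dagger> * c\<^sup>\<dagger> = 1\<^sub>m 1"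
    using arg_cong[OF bc(1), of adjoint] arg_cong[OF bc(2), of adjoint] by (simp_all add: adjoint_mult)
  have c: "c = 1\<^sub>m 1 - y\<^sup>\<dagger> * x" "c\<^sup>\<dagger> = 1\<^sub>m 1 - x\<^sup>\<dagger> * y"
    using x(2) by (simp_all add: c_def w_def adjoint_mult adjoint_minus mult_minus_dim)
  have "w\<^sup>\<dagger> * w = (1\<^sub>m 1 - y\<^sup>\<dagger> * x) + (1\<^sub>m 1 - x\<^sup>\<dagger> * y)"
    using x(2) y(2) unfolding w_def
    by (simp add: adjoint_minus mult_minus_dim) (rule eq_matI; auto)
  then have ww: "w\<^sup>\<dagger> * w = c + c\<^sup>\<dagger>"
    by (simp only: c[symmetric])
  have Uadj: "U\<^sup>\<dagger> = 1\<^sub>m n - w * (b\<^sup>\<dagger> * w\<^sup>\<dagger>)"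
    by (simp add: U_def adjoint_minus adjoint_mult mult_assoc_dim)
  have key: "(1\<^sub>m n - w * (f * w\<^sup>\<dagger>)) * (1\<^sub>m n - w * (g * w\<^sup>\<dagger>)) = 1\<^sub>m n"
    if fg: "dim_row f = Suc 0" "dim_col f = Suc 0" "dim_row g = Suc 0" "dim_col g = Suc 0"
      "f * (w\<^sup>\<dagger> * w) * g = f + g" for f g
  proof -
    have "w * (f * w\<^sup>\<dagger>) * (w * (g * w\<^sup>\<dagger>)) = w * ((f * (w\<^sup>\<dagger> * w) * g) * w\<^sup>\<dagger>)"
      using fg(1-4) by (simp add: mult_assoc_dim)
    also have "\<dots> = w * (f * w\<^sup>\<dagger>) + w * (g * w\<^sup>\<dagger>)"
      using fg by (simp add: mult_add_dim)
    finally show ?thesis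
      using fg(1-4) by (simp add: mult_minus_dim) (rule eq_matI; auto)
  qed
  have "b\<^sup>\<dagger> * (w\<^sup>\<dagger> * w) * b = b\<^sup>\<dagger> + b"
    by (simp add: ww mult_add_dim mult_assoc_dim bc bc')
  moreover have "b * (w\<^sup>\<dagger> * w) * b\<^sup>\<dagger> = b + b\<^sup>\<dagger>"
    by (simp add: ww mult_add_dim mult_assoc_dim bc bc')
      (rule eq_matI; simp add: add.commute)
  ultimately have "U\<^sup>\<dagger> * U = 1\<^sub>m n" "U * U\<^sup>\<dagger> = 1\<^sub>m n"
    using key[of "b\<^sup>\<dagger>" b] key[of b "b\<^sup>\<dagger>"] unfolding Uadj by (simp_all add: U_def)
  moreover have "U * x = x - w"
    using bc(1) by (simp add: U_def mult_minus_dim mult_assoc_dim flip: c_def)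
  moreover have "x - w = y"
    unfolding w_def by (rule eq_matI) auto
  moreover have "U \<in> carrier_mat n n"
    by (intro carrier_matI) (simp_all add: U_def)
  ultimately show ?thesis
    using unitary_mat_iff[of U n] by (intro exI[of _ U]) simp
qed

text \<open>The reflection exists unless the first entry of the vector has standard part \<open>1\<close>, in which
  case the opposite vector is completed instead.\<close>

lemma unitary_completion:
  assumes v: "v \<in> carrier_mat n 1" "v\<^sup>\<dagger> * v = 1\<^sub>m 1" and n: "n > 0"
  shows "\<exists>U. unitary_of n U \<and> U * e0 n = v"
proof -
  have main: "\<exists>U. unitary_of n U \<and> U * e0 n = y"
    if y: "y \<in> carrier_mat n 1" "y\<^sup>\<dagger> * y = 1\<^sub>m 1" "std_part (y $$ (0,0)) \<noteq> 1" for y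
  proof -
    have dy [simp]: "dim_row y = n" "dim_col y = Suc 0"
      using y by auto
    let ?g = "1 - conjugate (y $$ (0,0))"
    have "std_part ?g \<noteq> 0"
      using y(3) by (auto simp: quat_eq_iff)
    then obtain h where h: "h * ?g = 1" "?g * h = 1"
      using dquat_inverse_ex by blast
    have c: "(e0 n - y)\<^sup>\<dagger> * e0 n = mat 1 1 (\<lambda>_. ?g)"
      using n by (intro eq_matI) (auto simp: adjoint_minus mult_unit_col_index)
    have "mat 1 1 (\<lambda>_. a) * mat 1 1 (\<lambda>_. a') = 1\<^sub>m 1" if "a * a' = 1" for a a' :: dquat
      using that by (intro eq_matI) (simp_all add: mat_mult_index)
    with h show ?thesis
      by (intro reflection_unitary[OF unit_col_dim(3) unit_col_unit[OF n] y(1,2), of "mat 1 1 (\<lambda>_. h)"])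
        (simp_all only: c mat_carrier)
  qed
  show ?thesis
  proof (cases "std_part (v $$ (0,0)) = 1")
    case False
    then show ?thesis
      using main v by blast
  next
    case True
    have dv [simp]: "dim_row v = n" "dim_col v = Suc 0"
      using v by auto
    define z :: "real dual_num" where "z = -1"
    have z: "dq_of_dual z * dq_of_dual z = 1"
      by (simp add: z_def)
    have neg: "(dq_of_dual z \<cdot>\<^sub>m A)\<^sup>\<dagger> * (dq_of_dual z \<cdot>\<^sub>m A) = A\<^sup>\<dagger> * A" for A
      by (simp add: adjoint_smult smult_mult_left smult_mult_right smult_smult z)
    have neg': "(dq_of_dual z \<cdot>\<^sub>m A) * (dq_of_dual z \<cdot>\<^sub>m A)\<^sup>\<dagger> = A * A\<^sup>\<dagger>" for A
      by (simp add: adjoint_smult smult_mult_left smult_mult_right smult_smult z)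
    let ?v = "dq_of_dual z \<cdot>\<^sub>m v"
    have "std_part (?v $$ (0,0)) \<noteq> 1"
      using True n by (simp add: z_def quat_eq_iff)
    moreover have "?v \<in> carrier_mat n 1" "?v\<^sup>\<dagger> * ?v = 1\<^sub>m 1"
      using v by (simp_all add: neg)
    ultimately obtain U where U: "unitary_of n U" "U * e0 n = ?v"
      using main by blast
    note [simp] = unitary_ofD[OF U(1)]
    have "unitary_of n (dq_of_dual z \<cdot>\<^sub>m U)"
      using U(1) by (simp add: unitary_mat_iff[of _ n] neg neg')
    moreover have "(dq_of_dual z \<cdot>\<^sub>m U) * e0 n = v"
      by (simp only: smult_mult_left[of U "e0 n"] unitary_ofD[OF U(1)] unit_col_dim U(2)) 
        (simp add: smult_smult z)
    ultimately show ?thesis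
      by blast
  qed
qed


section \<open>Eigenvectors of Hermitian quaternion matrices\<close>

text \<open>A quaternion is written as \<open>u + j w\<close> with complex \<open>u\<close> and \<open>w\<close>. Left multiplication by a
  quaternion is then complex linear in \<open>(u, w)\<close> for the action of complex numbers from the
  right, so a quaternion matrix acts as a complex matrix of twice the size, which has an
  eigenvector.\<close>

definition quat_u :: "quat \<Rightarrow> complex" where "quat_u x = Complex (q_re x) (q_i x)"
definition quat_w :: "quat \<Rightarrow> complex" where "quat_w x = Complex (q_j x) (- q_k x)"

lemma quat_eq_complex_iff: "x = y \<longleftrightarrow> quat_u x = quat_u y \<and> quat_w x = quat_w y"
  by (auto simp: quat_u_def quat_w_def quat_eq_iff)

lemma quat_uw_mult:
  "quat_u (x * y) = quat_u x * quat_u y - cnj (quat_w x) * quat_w y"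
  "quat_w (x * y) = quat_w x * quat_u y + cnj (quat_u x) * quat_w y"
  by (simp_all add: quat_u_def quat_w_def quat_parts_mult complex_eq_iff algebra_simps)

lemma quat_uw_sum:
  "quat_u (sum f S) = (\<Sum>i\<in>S. quat_u (f i))" "quat_w (sum f S) = (\<Sum>i\<in>S. quat_w (f i))"
proof -
  have add: "quat_u (x + y) = quat_u x + quat_u y" "quat_w (x + y) = quat_w x + quat_w y"
    "quat_u 0 = 0" "quat_w 0 = 0" for x y
    by (simp_all add: quat_u_def quat_w_def complex_eq_iff)
  show "quat_u (sum f S) = (\<Sum>i\<in>S. quat_u (f i))" "quat_w (sum f S) = (\<Sum>i\<in>S. quat_w (f i))"
    by (induction S rule: infinite_finite_induct) (auto simp: add)
qed

lemma sum_double_split: "(\<Sum>l<2 * n. f l) = (\<Sum>l<n. f l) + (\<Sum>l<n. f (n + l))"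
  for f :: "nat \<Rightarrow> 'a::comm_monoid_add" and n :: nat
proof -
  have "(\<Sum>l\<in>{n..<n + n}. f l) = (\<Sum>l<n. f (n + l))"
    using sum.shift_bounds_nat_ivl[of f 0 n n] by (simp add: atLeast0LessThan add.commute)
  then show ?thesis
    using sum.atLeastLessThan_concat[of 0 n "n + n" f] by (simp add: atLeast0LessThan mult_2)
qed

lemma quat_right_eigenvector_ex:
  fixes H :: "nat \<Rightarrow> nat \<Rightarrow> quat"
  assumes "n > 0"
  shows "\<exists>x z. (\<exists>i<n. x i \<noteq> 0) \<and>
    (\<forall>i<n. (\<Sum>l<n. H i l * x l) = x i * Quat (Re z) (Im z) 0 0)"
proof -
  define M where "M = mat (2 * n) (2 * n) (\<lambda>(i,j).
    if i < n then if j < n then quat_u (H i j) else - cnj (quat_w (H i (j - n)))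
    else if j < n then quat_w (H (i - n) j) else cnj (quat_u (H (i - n) (j - n))))"
  have M: "M \<in> carrier_mat (2 * n) (2 * n)"
    by (simp add: M_def)
  obtain z where "eigenvalue M z"
    using spectrum_non_empty[OF M] assms by (auto simp: spectrum_def)
  then obtain v where v: "dim_vec v = 2 * n" "v \<noteq> 0\<^sub>v (2 * n)" "M *\<^sub>v v = z \<cdot>\<^sub>v v"
    using M by (auto simp: eigenvalue_def eigenvector_def dest: carrier_vecD)
  define x where "x l = Quat (Re (v $ l)) (Im (v $ l)) (Re (v $ (n + l))) (- Im (v $ (n + l)))" for l
  have x: "quat_u (x l) = v $ l" "quat_w (x l) = v $ (n + l)" for l
    by (simp_all add: x_def quat_u_def quat_w_def)
  have z: "quat_u (Quat (Re z) (Im z) 0 0) = z" "quat_w (Quat (Re z) (Im z) 0 0) = 0"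
    by (simp_all add: quat_u_def quat_w_def complex_eq_iff)
  have Mv: "(\<Sum>l<2 * n. M $$ (i,l) * v $ l) = z * v $ i" if "i < 2 * n" for i
    using arg_cong[OF v(3), of "\<lambda>w. w $ i"] that v(1) M
    by (simp add: scalar_prod_def atLeast0LessThan)
  have "(\<Sum>l<n. H i l * x l) = x i * Quat (Re z) (Im z) 0 0" if i: "i < n" for i
  proof -
    have "(\<Sum>l<n. quat_u (H i l) * v $ l) + (\<Sum>l<n. - cnj (quat_w (H i l)) * v $ (n + l)) = z * v $ i"
      "(\<Sum>l<n. quat_w (H i l) * v $ l) + (\<Sum>l<n. cnj (quat_u (H i l)) * v $ (n + l)) = z * v $ (n + i)"
      using Mv[of i] Mv[of "n + i"] i by (simp_all add: sum_double_split M_def)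
    then show ?thesis
      by (simp add: quat_eq_complex_iff quat_uw_sum quat_uw_mult x z sum.distrib sum_subtractf
          sum_negf mult.commute)
  qed
  moreover have "\<exists>i<n. x i \<noteq> 0"
  proof (rule ccontr)
    assume *: "\<not> ?thesis"
    have "v $ l = 0" if "l < 2 * n" for l
    proof (cases "l < n")
      case True
      then show ?thesis
        using * x(1)[of l] by (auto simp: quat_u_def complex_eq_iff)
    next
      case False
      then show ?thesis
        using * x(2)[of "l - n"] that by (auto simp: quat_w_def complex_eq_iff)
    qed
    then show False
      using v by (auto simp: vec_eq_iff)
  qed
  ultimately show ?thesis
    by blast
qed

lemma sum_norm_quat:
  "(\<Sum>i<n. conjugate (x i) * x i) =
    of_real (\<Sum>i<n. (q_re (x i))\<^sup>2 + (q_i (x i))\<^sup>2 + (q_j (x i))\<^sup>2 + (q_k (x i))\<^sup>2)"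
  for x :: "nat \<Rightarrow> quat"
  by (simp add: conjugate_mult_self_quat)

lemma sum_norm_quat_pos:
  fixes x :: "nat \<Rightarrow> quat"
  assumes "i < n" "x i \<noteq> 0"
  shows "(\<Sum>i<n. (q_re (x i))\<^sup>2 + (q_i (x i))\<^sup>2 + (q_j (x i))\<^sup>2 + (q_k (x i))\<^sup>2) > 0"
  by (rule sum_pos2[of _ i]) (use assms quat_norm_pos in auto)

text \<open>For a Hermitian matrix \<open>x\<^sup>* H x = (x\<^sup>* x) z\<close> is self-conjugate, and \<open>x\<^sup>* x\<close> is a positive real
  number, hence the right eigenvalue \<open>z\<close> is real.\<close>

lemma quat_hermitian_eigenvector_ex:
  fixes H :: "nat \<Rightarrow> nat \<Rightarrow> quat"
  assumes n: "n > 0" and herm: "\<And>i j. i < n \<Longrightarrow> j < n \<Longrightarrow> H j i = conjugate (H i j)"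
  shows "\<exists>x a. (\<exists>i<n. x i \<noteq> 0) \<and> (\<forall>i<n. (\<Sum>l<n. H i l * x l) = of_real a * x i)"
proof -
  obtain x z where nz: "\<exists>i<n. x i \<noteq> 0"
    and eig: "\<And>i. i < n \<Longrightarrow> (\<Sum>l<n. H i l * x l) = x i * Quat (Re z) (Im z) 0 0"
    using quat_right_eigenvector_ex[OF n, of H] by blast
  let ?Z = "Quat (Re z) (Im z) 0 0"
  define N where "N = (\<Sum>i<n. (q_re (x i))\<^sup>2 + (q_i (x i))\<^sup>2 + (q_j (x i))\<^sup>2 + (q_k (x i))\<^sup>2)"
  have N: "(\<Sum>i<n. conjugate (x i) * x i) = of_real N" "N > 0"
    using nz sum_norm_quat_pos by (auto simp: N_def sum_norm_quat)
  have conj_sum: "conjugate (sum f S) = (\<Sum>i\<in>S. conjugate (f i))" for f :: "nat \<Rightarrow> quat" and S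
    by (induction S rule: infinite_finite_induct) auto
  define Q where "Q = (\<Sum>i<n. conjugate (x i) * (\<Sum>l<n. H i l * x l))"
  have Q: "Q = of_real N * ?Z"
    by (simp add: Q_def eig N(1)[symmetric] sum_distrib_right mult.assoc)
  have "conjugate Q = (\<Sum>i<n. \<Sum>l<n. conjugate (x l) * (conjugate (H i l) * x i))"
    by (simp add: Q_def conj_sum sum_distrib_right mult.assoc)
  also have "\<dots> = (\<Sum>i<n. \<Sum>l<n. conjugate (x l) * (H l i * x i))"
    by (intro sum.cong refl) (metis herm lessThan_iff)
  also have "\<dots> = Q"
    by (subst sum.swap) (simp add: Q_def sum_distrib_left)
  finally have "q_i Q = 0"
    by (auto simp: quat_eq_iff)
  then have "Im z = 0"
    using N(2) by (simp add: Q quat_parts_mult)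
  then have Z: "?Z = of_real (Re z)"
    by (simp add: quat_eq_iff)
  have "(\<Sum>l<n. H i l * x l) = of_real (Re z) * x i" if "i < n" for i
    using eig[OF that] Z by (simp add: of_real_quat_commutes)
  with nz show ?thesis
    by blast
qed


section \<open>The spectral theorem for Hermitian dual quaternion matrices\<close>

lemma hermitian_index:
  "H \<in> carrier_mat n n \<Longrightarrow> H\<^sup>\<dagger> = H \<Longrightarrow> i < n \<Longrightarrow> j < n \<Longrightarrow> H $$ (j,i) = conjugate (H $$ (i,j))"
  by (metis adjoint_index carrier_matD)

lemma split_first_row_col:
  assumes M: "M \<in> carrier_mat (Suc m) (Suc n)"
    and col: "dq_of_dual z \<cdot>\<^sub>m (M * e0 (Suc n)) = dq_of_dual z \<cdot>\<^sub>m (dq_of_dual \<mu> \<cdot>\<^sub>m e0 (Suc m))"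
    and row: "dq_of_dual z \<cdot>\<^sub>m (M\<^sup>\<dagger> * e0 (Suc m)) = dq_of_dual z \<cdot>\<^sub>m (dq_of_dual \<mu> \<cdot>\<^sub>m e0 (Suc n))"
  shows "dq_of_dual z \<cdot>\<^sub>m M = dq_of_dual z \<cdot>\<^sub>m
    bdiag (mat 1 1 (\<lambda>_. dq_of_dual \<mu>)) (mat m n (\<lambda>(i,j). M $$ (Suc i, Suc j)))"
proof -
  have [simp]: "dim_row M = Suc m" "dim_col M = Suc n"
    using M by auto
  have c: "dq_of_dual z * M $$ (i,0) = dq_of_dual z * (if i = 0 then dq_of_dual \<mu> else 0)"
    if "i < Suc m" for i
    using arg_cong[OF col, of "\<lambda>A. A $$ (i,0)"] that
    by (simp add: mult_unit_col_index if_distrib cong: if_cong)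
  have r: "dq_of_dual z * M $$ (0,j) = dq_of_dual z * (if j = 0 then dq_of_dual \<mu> else 0)"
    if "j < Suc n" for j
  proof -
    have "dq_of_dual z * conjugate (M $$ (0,j)) = dq_of_dual z * (if j = 0 then dq_of_dual \<mu> else 0)"
      using arg_cong[OF row, of "\<lambda>A. A $$ (j,0)"] that
      by (simp add: mult_unit_col_index if_distrib cong: if_cong)
    from arg_cong[OF this, of conjugate] show ?thesis
      using dq_of_dual_commutes[of z "M $$ (0,j)"] dq_of_dual_commutes[of z "dq_of_dual \<mu>"]
      by (simp split: if_splits)
  qed
  show ?thesis
  proof (rule eq_matI)
    fix i j
    assume "i < dim_row (dq_of_dual z \<cdot>\<^sub>m bdiag (mat 1 1 (\<lambda>_. dq_of_dual \<mu>)) (mat m n (\<lambda>(i,j). M $$ (Suc i, Suc j))))"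
      "j < dim_col (dq_of_dual z \<cdot>\<^sub>m bdiag (mat 1 1 (\<lambda>_. dq_of_dual \<mu>)) (mat m n (\<lambda>(i,j). M $$ (Suc i, Suc j))))"
    then have ij: "i < Suc m" "j < Suc n"
      by simp_all
    show "(dq_of_dual z \<cdot>\<^sub>m M) $$ (i,j) = (dq_of_dual z \<cdot>\<^sub>m
      bdiag (mat 1 1 (\<lambda>_. dq_of_dual \<mu>)) (mat m n (\<lambda>(i,j). M $$ (Suc i, Suc j)))) $$ (i,j)"
      using ij c[OF ij(1)] r[OF ij(2)]
      by (cases i; cases j) (simp_all add: bdiag_def)
  qed simp_all
qed

text \<open>Splitting off eigenvectors one at a time. The scalar \<open>z\<close> allows the same induction to be
  used twice: for \<open>z = 1\<close> it diagonalizes, and for \<open>z = eps\<close> it diagonalizes the standard part.\<close>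

lemma diagonalization_from_eigenvectors:
  assumes ev: "\<And>n H. n > 0 \<Longrightarrow> H \<in> carrier_mat n n \<Longrightarrow> H\<^sup>\<dagger> = H \<Longrightarrow>
      \<exists>v \<nu>. v \<in> carrier_mat n 1 \<and> v\<^sup>\<dagger> * v = 1\<^sub>m 1 \<and>
        dq_of_dual z \<cdot>\<^sub>m (H * v) = dq_of_dual z \<cdot>\<^sub>m (dq_of_dual \<nu> \<cdot>\<^sub>m v)"
    and H: "H \<in> carrier_mat n n" "H\<^sup>\<dagger> = H"
  shows "\<exists>U \<nu>. unitary_of n U \<and>
    dq_of_dual z \<cdot>\<^sub>m (U\<^sup>\<dagger> * (H * U)) = dq_of_dual z \<cdot>\<^sub>m mat_diag n (\<lambda>i. dq_of_dual (\<nu> i))"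
  using H
proof (induction n arbitrary: H)
  case 0
  have "dq_of_dual z \<cdot>\<^sub>m ((1\<^sub>m 0)\<^sup>\<dagger> * (H * 1\<^sub>m 0)) = dq_of_dual z \<cdot>\<^sub>m mat_diag 0 (\<lambda>i. dq_of_dual 0)"
    using 0 by (intro eq_matI) (simp_all add: mat_diag_def)
  then show ?case
    by (intro exI[of _ "1\<^sub>m 0"] exI[of _ "\<lambda>_. 0"] conjI[OF unitary_one])
next
  case (Suc n)
  obtain v \<nu> where v: "v \<in> carrier_mat (Suc n) 1" "v\<^sup>\<dagger> * v = 1\<^sub>m 1"
    and eig: "dq_of_dual z \<cdot>\<^sub>m (H * v) = dq_of_dual z \<cdot>\<^sub>m (dq_of_dual \<nu> \<cdot>\<^sub>m v)"
    using ev[OF _ Suc.prems] by blast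
  obtain U where U: "unitary_of (Suc n) U" and Uv: "U * e0 (Suc n) = v"
    using unitary_completion[OF v] by blast
  note [simp] = unitary_ofD[OF U]
  have [simp]: "dim_row H = Suc n" "dim_col H = Suc n" "dim_row v = Suc n" "dim_col v = Suc 0"
    using Suc.prems v by auto
  define M where "M = U\<^sup>\<dagger> * (H * U)"
  have M: "M \<in> carrier_mat (Suc n) (Suc n)"
    by (intro carrier_matI) (simp_all add: M_def)
  then have [simp]: "dim_row M = Suc n" "dim_col M = Suc n"
    by auto
  have Mh: "M\<^sup>\<dagger> = M"
    by (simp add: M_def adjoint_mult mult_assoc_dim Suc.prems)
  have "dq_of_dual z \<cdot>\<^sub>m (M * e0 (Suc n)) = U\<^sup>\<dagger> * (dq_of_dual z \<cdot>\<^sub>m (H * v))"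
    by (simp add: M_def mult_assoc_dim Uv smult_mult_right)
  also have "\<dots> = dq_of_dual z \<cdot>\<^sub>m (dq_of_dual \<nu> \<cdot>\<^sub>m (U\<^sup>\<dagger> * v))"
    by (simp add: eig smult_mult_right)
  also have "U\<^sup>\<dagger> * v = e0 (Suc n)"
    using unitary_cancel(1)[OF U, of "e0 (Suc n)"] by (simp add: Uv)
  finally have Me: "dq_of_dual z \<cdot>\<^sub>m (M * e0 (Suc n)) = dq_of_dual z \<cdot>\<^sub>m (dq_of_dual \<nu> \<cdot>\<^sub>m e0 (Suc n))" .
  define M' where "M' = mat n n (\<lambda>(i,j). M $$ (Suc i, Suc j))"
  have zM: "dq_of_dual z \<cdot>\<^sub>m M = dq_of_dual z \<cdot>\<^sub>m bdiag (mat 1 1 (\<lambda>_. dq_of_dual \<nu>)) M'"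
    unfolding M'_def by (rule split_first_row_col) (use M Me Mh in simp_all)
  have "M'\<^sup>\<dagger> = M'"
    by (rule eq_matI) (simp_all add: M'_def hermitian_index[OF M Mh, symmetric])
  then obtain U' \<nu>' where U': "unitary_of n U'"
    and IH: "dq_of_dual z \<cdot>\<^sub>m (U'\<^sup>\<dagger> * (M' * U')) = dq_of_dual z \<cdot>\<^sub>m mat_diag n (\<lambda>i. dq_of_dual (\<nu>' i))"
    using Suc.IH[of M'] by (auto simp: M'_def)
  note [simp] = unitary_ofD[OF U']
  have [simp]: "dim_row M' = n" "dim_col M' = n"
    by (simp_all add: M'_def)
  define F where "F = bdiag (1\<^sub>m 1) U'"
  have F: "unitary_of (Suc n) F"
    using unitary_bdiag[OF unitary_one[of 1] U'] by (simp add: F_def)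
  note [simp] = unitary_ofD[OF F]
  let ?N = "\<lambda>i. case i of 0 \<Rightarrow> \<nu> | Suc j \<Rightarrow> \<nu>' j"
  have "dq_of_dual z \<cdot>\<^sub>m ((U * F)\<^sup>\<dagger> * (H * (U * F))) = F\<^sup>\<dagger> * ((dq_of_dual z \<cdot>\<^sub>m M) * F)"
    by (simp add: M_def adjoint_mult mult_assoc_dim smult_mult_left smult_mult_right)
  also have "\<dots> = dq_of_dual z \<cdot>\<^sub>m (F\<^sup>\<dagger> * (bdiag (mat 1 1 (\<lambda>_. dq_of_dual \<nu>)) M' * F))"
    unfolding zM by (simp add: smult_mult_left smult_mult_right)
  also have "\<dots> = bdiag (dq_of_dual z \<cdot>\<^sub>m mat 1 1 (\<lambda>_. dq_of_dual \<nu>)) (dq_of_dual z \<cdot>\<^sub>m (U'\<^sup>\<dagger> * (M' * U')))"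
    by (simp add: F_def bdiag_adjoint bdiag_mult bdiag_smult)
  also have "\<dots> = dq_of_dual z \<cdot>\<^sub>m mat_diag (Suc n) (\<lambda>i. dq_of_dual (?N i))"
    unfolding IH
    by (rule eq_matI) (auto simp: bdiag_def mat_diag_def split: nat.splits)
  finally show ?case
    using unitary_mult[OF U F] by blast
qed

lemma of_real_quat_left_commute: "x * (of_real a * y) = of_real a * (x * y)" for x y :: quat
  using of_real_quat_commutes[of a x] by (simp flip: mult.assoc)

lemma scaled_unit:
  fixes x :: "nat \<Rightarrow> quat"
  assumes "\<exists>i<n. x i \<noteq> 0"
  obtains c where "(\<Sum>i<n. conjugate (of_real c * x i) * (of_real c * x i)) = 1"
proof
  let ?N = "\<Sum>i<n. (q_re (x i))\<^sup>2 + (q_i (x i))\<^sup>2 + (q_j (x i))\<^sup>2 + (q_k (x i))\<^sup>2"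
  let ?c = "1 / sqrt ?N"
  have N: "?N > 0"
    using assms sum_norm_quat_pos by blast
  have "conjugate (of_real c * y) * (of_real c * y) = of_real (c * c) * (conjugate y * y)"
    for c and y :: quat
    by (simp add: quat_eq_iff quat_parts_mult algebra_simps del: of_real_mult)
  then have "(\<Sum>i<n. conjugate (of_real ?c * x i) * (of_real ?c * x i)) =
      of_real (?c * ?c) * (\<Sum>i<n. conjugate (x i) * x i)"
    by (simp only: sum_distrib_left)
  also have "\<dots> = of_real (?c * ?c * ?N)"
    by (simp only: sum_norm_quat of_real_mult)
  also have "?c * ?c * ?N = 1"
    using N by simp
  finally show "(\<Sum>i<n. conjugate (of_real ?c * x i) * (of_real ?c * x i)) = 1"
    by simp
qed

lemma hermitian_std_diagonalization:
  assumes H: "H \<in> carrier_mat n n" "H\<^sup>\<dagger> = H"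
  shows "\<exists>U \<nu>. unitary_of n U \<and>
    eps \<cdot>\<^sub>m (U\<^sup>\<dagger> * (H * U)) = eps \<cdot>\<^sub>m mat_diag n (\<lambda>i. dq_of_dual (\<nu> i))"
proof -
  have ev: "\<exists>v \<nu>. v \<in> carrier_mat n 1 \<and> v\<^sup>\<dagger> * v = 1\<^sub>m 1 \<and>
      dq_of_dual eps \<cdot>\<^sub>m (H * v) = dq_of_dual eps \<cdot>\<^sub>m (dq_of_dual \<nu> \<cdot>\<^sub>m v)"
    if n: "n > 0" and H: "H \<in> carrier_mat n n" "H\<^sup>\<dagger> = H" for n H
  proof -
    have [simp]: "dim_row H = n" "dim_col H = n"
      using H by auto
    have "std_part (H $$ (j,i)) = conjugate (std_part (H $$ (i,j)))" if "i < n" "j < n" for i j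
      using hermitian_index[OF H that] by simp
    then obtain x a where x: "\<exists>i<n. x i \<noteq> 0"
      and eig: "\<forall>i<n. (\<Sum>l<n. std_part (H $$ (i,l)) * x l) = of_real a * x i"
      using quat_hermitian_eigenvector_ex[OF n, of "\<lambda>i j. std_part (H $$ (i,j))"] by blast
    obtain c where c: "(\<Sum>i<n. conjugate (of_real c * x i) * (of_real c * x i)) = 1"
      using scaled_unit[OF x] by blast
    define v where "v = mat n 1 (\<lambda>(i,j). DN (of_real c * x i) 0)"
    have v: "v \<in> carrier_mat n 1"
      by (simp add: v_def)
    have "v\<^sup>\<dagger> * v = 1\<^sub>m 1"
      using c by (intro eq_matI) (simp_all add: v_def mat_mult_index dual_num_eq_iff dual_parts_sum)
    moreover have "eps \<cdot>\<^sub>m (H * v) = eps \<cdot>\<^sub>m (dq_of_dual (DN a 0) \<cdot>\<^sub>m v)"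
    proof (rule eq_matI)
      fix i j
      assume "i < dim_row (eps \<cdot>\<^sub>m (dq_of_dual (DN a 0) \<cdot>\<^sub>m v))" "j < dim_col (eps \<cdot>\<^sub>m (dq_of_dual (DN a 0) \<cdot>\<^sub>m v))"
      then have i: "i < n" and j: "j = 0"
        by (simp_all add: v_def)
      have "(\<Sum>l<n. std_part (H $$ (i,l)) * (of_real c * x l)) = of_real c * (\<Sum>l<n. std_part (H $$ (i,l)) * x l)"
        unfolding sum_distrib_left
        by (simp add: of_real_quat_left_commute)
      also have "\<dots> = of_real a * (of_real c * x i)"
        using eig i of_real_quat_left_commute[of "of_real c" a "x i"] by simp
      finally have "(\<Sum>l<n. std_part (H $$ (i,l)) * (of_real c * x l)) = of_real a * (of_real c * x i)" .
      then show "(eps \<cdot>\<^sub>m (H * v)) $$ (i,j) = (eps \<cdot>\<^sub>m (dq_of_dual (DN a 0) \<cdot>\<^sub>m v)) $$ (i,j)"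
        using i by (simp add: j v_def mat_mult_index eps_mult_eq_iff dual_parts_sum)
    qed (simp_all add: v_def)
    ultimately show ?thesis
      using v by (intro exI[of _ v] exI[of _ "DN a 0"]) simp
  qed
  have "\<exists>U \<nu>. unitary_of n U \<and> dq_of_dual eps \<cdot>\<^sub>m (U\<^sup>\<dagger> * (H * U)) =
      dq_of_dual eps \<cdot>\<^sub>m mat_diag n (\<lambda>i. dq_of_dual (\<nu> i))"
    by (rule diagonalization_from_eigenvectors[OF _ H]) (rule ev)
  then show ?thesis
    by simp
qed

text \<open>First-order perturbation theory. Let the standard part of \<open>H\<close> be \<open>diag a\<close> and its
  infinitesimal part \<open>T\<close>. Then \<open>x + y\<epsilon>\<close> is an eigenvector for \<open>a\<^sub>0 + \<tau>\<epsilon>\<close> if \<open>x\<close> lives on the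
  block of indices with \<open>a\<^sub>i = a\<^sub>0\<close>, is an eigenvector for \<open>\<tau>\<close> of the compression of \<open>T\<close> to this block,
  and \<open>y\<close> solves \<open>(a\<^sub>0 - a\<^sub>i) y\<^sub>i = (T x)\<^sub>i\<close> off the block. Such an \<open>x\<close> is the
  restriction to one block of any eigenvector of the matrix that \<open>T\<close> becomes when
  its entries between different blocks are deleted.\<close>

lemma hermitian_eigenvector_diagonal_std:
  assumes n: "n > 0" and H: "H \<in> carrier_mat n n" "H\<^sup>\<dagger> = H"
    and std: "\<And>i j. i < n \<Longrightarrow> j < n \<Longrightarrow> std_part (H $$ (i,j)) = (if i = j then of_real (a i) else 0)"
  shows "\<exists>v \<nu>. v \<in> carrier_mat n 1 \<and> v\<^sup>\<dagger> * v = 1\<^sub>m 1 \<and> H * v = dq_of_dual \<nu> \<cdot>\<^sub>m v"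
proof -
  have [simp]: "dim_row H = n" "dim_col H = n"
    using H by auto
  define T where "T i j = inf_part (H $$ (i,j))" for i j
  define T' where "T' i j = (if a i = a j then T i j else 0)" for i j
  have "T' j i = conjugate (T' i j)" if "i < n" "j < n" for i j
    using hermitian_index[OF H that] by (simp add: T'_def T_def)
  then obtain x \<tau> where x: "\<exists>i<n. x i \<noteq> 0"
    and eig: "\<And>i. i < n \<Longrightarrow> (\<Sum>l<n. T' i l * x l) = of_real \<tau> * x i"
    using quat_hermitian_eigenvector_ex[OF n, of T'] by blast
  obtain i0 where i0: "i0 < n" "x i0 \<noteq> 0"
    using x by blast
  define x1 where "x1 i = (if a i = a i0 then x i else 0)" for i
  have "\<exists>i<n. x1 i \<noteq> 0"
    using i0 by (auto simp: x1_def)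
  then obtain c where c: "(\<Sum>i<n. conjugate (of_real c * x1 i) * (of_real c * x1 i)) = 1"
    using scaled_unit by blast
  define x2 where "x2 i = of_real c * x1 i" for i
  define y where "y i = (if a i = a i0 then 0 else of_real (1 / (a i0 - a i)) * (\<Sum>l<n. T i l * x2 l))" for i
  have x2: "x2 i = 0" if "a i \<noteq> a i0" for i
    using that by (simp add: x2_def x1_def)
  have block: "(\<Sum>l<n. T i l * x2 l) = of_real \<tau> * x2 i" if "i < n" "a i = a i0" for i
  proof -
    have "(\<Sum>l<n. T i l * x2 l) = (\<Sum>l<n. of_real c * (T' i l * x l))"
      using that(2)
      by (intro sum.cong refl)
        (auto simp: x2_def x1_def T'_def of_real_quat_left_commute)
    also have "\<dots> = of_real c * (of_real \<tau> * x i)"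
      using eig[OF that(1)] by (simp flip: sum_distrib_left)
    also have "\<dots> = of_real \<tau> * (of_real c * x i)"
      by (simp add: mult.commute flip: mult.assoc of_real_mult)
    finally show ?thesis
      using that(2) by (simp add: x2_def x1_def)
  qed
  have inf: "of_real (a i) * y i + (\<Sum>l<n. T i l * x2 l) = of_real (a i0) * y i + of_real \<tau> * x2 i"
    if "i < n" for i
  proof (cases "a i = a i0")
    case True
    then show ?thesis
      using block[OF that] by simp
  next
    case False
    then have "a i0 * (1 / (a i0 - a i)) - a i * (1 / (a i0 - a i)) = 1"
      by (simp flip: diff_divide_distrib)
    then have "of_real (a i0) * y i - of_real (a i) * y i = (\<Sum>l<n. T i l * x2 l)"
      using False
      by (simp add: y_def flip: left_diff_distrib of_real_diff mult.assoc of_real_mult)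
    then show ?thesis
      using x2[OF False] by (simp add: algebra_simps)
  qed
  define v where "v = mat n 1 (\<lambda>(i,j). DN (x2 i) (y i))"
  have v: "v \<in> carrier_mat n 1"
    by (simp add: v_def)
  have orth: "conjugate (x2 i) * y i = 0" "conjugate (y i) * x2 i = 0" for i
    using x2[of i] by (auto simp: y_def)
  have "v\<^sup>\<dagger> * v = 1\<^sub>m 1"
    using c by (intro eq_matI)
      (simp_all add: v_def mat_mult_index dual_num_eq_iff dual_parts_sum orth flip: x2_def)
  moreover have "H * v = dq_of_dual (DN (a i0) \<tau>) \<cdot>\<^sub>m v"
  proof (rule eq_matI)
    fix i j
    assume "i < dim_row (dq_of_dual (DN (a i0) \<tau>) \<cdot>\<^sub>m v)" "j < dim_col (dq_of_dual (DN (a i0) \<tau>) \<cdot>\<^sub>m v)"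
    then have i: "i < n" and j: "j = 0"
      by (simp_all add: v_def)
    have S: "(\<Sum>l<n. std_part (H $$ (i,l)) * f l) = of_real (a i) * f i" for f
    proof -
      have "(\<Sum>l<n. std_part (H $$ (i,l)) * f l) = (\<Sum>l<n. if l = i then of_real (a i) * f l else 0)"
        using i by (intro sum.cong refl) (auto simp: std)
      then show ?thesis
        using i by simp
    qed
    have "of_real (a i) * x2 i = of_real (a i0) * x2 i"
      using x2[of i] by (cases "a i = a i0") simp_all
    then show "(H * v) $$ (i,j) = (dq_of_dual (DN (a i0) \<tau>) \<cdot>\<^sub>m v) $$ (i,j)"
      using i inf[OF i]
      by (simp add: j v_def mat_mult_index dual_num_eq_iff dual_parts_sum S sum.distrib flip: T_def)
  qed (simp_all add: v_def)
  ultimately show ?thesis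
    using v by blast
qed

theorem hermitian_diagonalization:
  assumes H: "H \<in> carrier_mat n n" "H\<^sup>\<dagger> = H"
  shows "\<exists>U \<nu>. unitary_of n U \<and> U\<^sup>\<dagger> * (H * U) = mat_diag n (\<lambda>i. dq_of_dual (\<nu> i))"
proof -
  have ev: "\<exists>v \<nu>. v \<in> carrier_mat n 1 \<and> v\<^sup>\<dagger> * v = 1\<^sub>m 1 \<and>
      dq_of_dual 1 \<cdot>\<^sub>m (H * v) = dq_of_dual 1 \<cdot>\<^sub>m (dq_of_dual \<nu> \<cdot>\<^sub>m v)"
    if n: "n > 0" and H: "H \<in> carrier_mat n n" "H\<^sup>\<dagger> = H" for n H
  proof -
    obtain U a where U: "unitary_of n U"
      and diag: "eps \<cdot>\<^sub>m (U\<^sup>\<dagger> * (H * U)) = eps \<cdot>\<^sub>m mat_diag n (\<lambda>i. dq_of_dual (a i))"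
      using hermitian_std_diagonalization[OF H] by blast
    note [simp] = unitary_ofD[OF U]
    have [simp]: "dim_row H = n" "dim_col H = n"
      using H by auto
    define M where "M = U\<^sup>\<dagger> * (H * U)"
    have M: "M \<in> carrier_mat n n" "M\<^sup>\<dagger> = M"
      using H(2) by (auto simp: M_def adjoint_mult mult_assoc_dim intro!: carrier_matI)
    have "std_part (M $$ (i,j)) = (if i = j then of_real (std_part (a i)) else 0)"
      if "i < n" "j < n" for i j
      using arg_cong[OF diag, of "\<lambda>A. A $$ (i,j)"] that M(1)
      by (auto simp: mat_diag_def eps_mult_eq_iff simp flip: M_def split: if_splits)
    then obtain v \<nu> where v: "v \<in> carrier_mat n 1" "v\<^sup>\<dagger> * v = 1\<^sub>m 1" "M * v = dq_of_dual \<nu> \<cdot>\<^sub>m v"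
      using hermitian_eigenvector_diagonal_std[OF n M, of "\<lambda>i. std_part (a i)"] by blast
    have [simp]: "dim_row v = n" "dim_col v = Suc 0"
      using v by auto
    have "(U * v)\<^sup>\<dagger> * (U * v) = 1\<^sub>m 1"
      using v(2) by (simp add: adjoint_mult mult_assoc_dim unitary_cancel[OF U])
    moreover have "H * (U * v) = U * (M * v)"
      by (simp add: M_def mult_assoc_dim unitary_cancel[OF U])
    moreover have "U * v \<in> carrier_mat n 1"
      by (intro carrier_matI) simp_all
    ultimately show ?thesis
      using v(3) by (intro exI[of _ "U * v"] exI[of _ \<nu>]) (simp add: smult_mult_right)
  qed
  have "\<exists>U \<nu>. unitary_of n U \<and> dq_of_dual 1 \<cdot>\<^sub>m (U\<^sup>\<dagger> * (H * U)) =
      dq_of_dual 1 \<cdot>\<^sub>m mat_diag n (\<lambda>i. dq_of_dual (\<nu> i))"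
    by (rule diagonalization_from_eigenvectors[OF _ H]) (rule ev)
  then show ?thesis
    by simp
qed


section \<open>The singular value decomposition\<close>

text \<open>Let \<open>v\<close> be a unit eigenvector of \<open>A\<^sup>* A\<close> for an eigenvalue \<open>\<nu>\<close> with positive standard part. Then
  \<open>\<mu> = sqrt \<nu>\<close> is invertible and \<open>u = A v / \<mu>\<close> completes the triple. If the columns \<open>v\<^sub>j\<close> of \<open>U\<close>
  diagonalize \<open>A\<^sup>* A\<close>, then the standard part of the eigenvalue \<open>\<nu>\<^sub>j\<close> is the squared norm of the
  standard part of \<open>A v\<^sub>j\<close>; for some \<open>j\<close> it does not vanish, since \<open>A U\<close> has a nonzero standard
  part.\<close>

lemma singular_triple_appreciable:
  assumes A: "A \<in> carrier_mat m n" and nz: "eps \<cdot>\<^sub>m A \<noteq> 0\<^sub>m m n"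
  shows "\<exists>u v \<mu>. u \<in> carrier_mat m 1 \<and> u\<^sup>\<dagger> * u = 1\<^sub>m 1 \<and> v \<in> carrier_mat n 1 \<and> v\<^sup>\<dagger> * v = 1\<^sub>m 1 \<and>
    A * v = dq_of_dual \<mu> \<cdot>\<^sub>m u \<and> A\<^sup>\<dagger> * u = dq_of_dual \<mu> \<cdot>\<^sub>m v \<and> std_part \<mu> > 0"
proof -
  have [simp]: "dim_row A = m" "dim_col A = n"
    using A by auto
  have "A\<^sup>\<dagger> * A \<in> carrier_mat n n" "(A\<^sup>\<dagger> * A)\<^sup>\<dagger> = A\<^sup>\<dagger> * A"
    by (intro carrier_matI) (simp_all add: adjoint_mult)
  then obtain U \<nu> where U: "unitary_of n U"
    and diag: "U\<^sup>\<dagger> * ((A\<^sup>\<dagger> * A) * U) = mat_diag n (\<lambda>i. dq_of_dual (\<nu> i))"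
    using hermitian_diagonalization by blast
  note [simp] = unitary_ofD[OF U]
  define W where "W = A * U"
  have [simp]: "dim_row W = m" "dim_col W = n"
    by (simp_all add: W_def)
  have WW: "W\<^sup>\<dagger> * W = mat_diag n (\<lambda>i. dq_of_dual (\<nu> i))"
    unfolding diag[symmetric] by (simp add: W_def adjoint_mult mult_assoc_dim)
  have "\<exists>i j. i < m \<and> j < n \<and> std_part (W $$ (i,j)) \<noteq> 0"
  proof (rule ccontr)
    assume *: "\<not> ?thesis"
    have "eps \<cdot>\<^sub>m W = 0\<^sub>m m n"
      using * by (intro eq_matI) (simp_all add: dual_num_eq_iff)
    then have "(eps \<cdot>\<^sub>m W) * U\<^sup>\<dagger> = 0\<^sub>m m n"
      by simp
    moreover have "(eps \<cdot>\<^sub>m W) * U\<^sup>\<dagger> = eps \<cdot>\<^sub>m A"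
      by (simp add: W_def smult_mult_left mult_assoc_dim)
    ultimately show False
      using nz by simp
  qed
  then obtain i j where ij: "i < m" "j < n" "std_part (W $$ (i,j)) \<noteq> 0"
    by blast
  have "(W\<^sup>\<dagger> * W) $$ (j,j) = dq_of_dual (\<nu> j)"
    unfolding WW using ij by (simp add: mat_diag_def)
  from arg_cong[OF this, of std_part]
  have "(\<Sum>l<m. conjugate (std_part (W $$ (l,j))) * std_part (W $$ (l,j))) = of_real (std_part (\<nu> j))"
    using ij by (simp add: mat_mult_index dual_parts_sum)
  then have "std_part (\<nu> j) > 0"
    using sum_norm_quat_pos[of i m "\<lambda>l. std_part (W $$ (l,j))", OF ij(1,3)]
    by (simp only: sum_norm_quat of_real_eq_iff)
  then obtain \<mu> where \<mu>: "\<mu> * \<mu> = \<nu> j" "std_part \<mu> > 0"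
    using dual_sqrt_ex by blast
  then obtain y where y: "y * \<mu> = 1"
    using dual_inverse_ex[of \<mu>] by auto
  define v where "v = U * unit_col n j"
  have [simp]: "dim_row v = n" "dim_col v = Suc 0"
    by (simp_all add: v_def)
  have vv: "v\<^sup>\<dagger> * v = 1\<^sub>m 1"
    using ij by (simp add: v_def adjoint_mult mult_assoc_dim unitary_cancel[OF U] unit_col_unit)
  have AAv: "A\<^sup>\<dagger> * (A * v) = dq_of_dual (\<nu> j) \<cdot>\<^sub>m v"
  proof -
    have "mat_diag n (\<lambda>i. dq_of_dual (\<nu> i)) * unit_col n j = dq_of_dual (\<nu> j) \<cdot>\<^sub>m unit_col n j"
      using ij by (intro eq_matI) (simp_all add: mult_unit_col_index mat_diag_def)
    then have "U * ((U\<^sup>\<dagger> * ((A\<^sup>\<dagger> * A) * U)) * unit_col n j) = dq_of_dual (\<nu> j) \<cdot>\<^sub>m v"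
      by (simp add: diag v_def smult_mult_right)
    then show ?thesis
      by (simp add: v_def mult_assoc_dim unitary_cancel[OF U])
  qed
  define u where "u = dq_of_dual y \<cdot>\<^sub>m (A * v)"
  have "u\<^sup>\<dagger> * u = dq_of_dual (y * y * \<nu> j) \<cdot>\<^sub>m (v\<^sup>\<dagger> * v)"
    by (simp add: u_def adjoint_smult adjoint_mult smult_mult_left smult_mult_right smult_smult
        mult_assoc_dim AAv mult.assoc)
  also have "y * y * \<nu> j = 1"
    using y \<mu>(1) by (metis mult.assoc mult.commute mult_1_left)
  finally have uu: "u\<^sup>\<dagger> * u = 1\<^sub>m 1"
    using vv by simp
  have "dq_of_dual \<mu> \<cdot>\<^sub>m u = dq_of_dual (\<mu> * y) \<cdot>\<^sub>m (A * v)"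
    by (simp add: u_def smult_smult)
  then have Av: "A * v = dq_of_dual \<mu> \<cdot>\<^sub>m u"
    using y by (simp only: mult.commute[of \<mu>] dq_of_dual_simps smult_one_zero)
  have "A\<^sup>\<dagger> * u = dq_of_dual (y * \<nu> j) \<cdot>\<^sub>m v"
    by (simp add: u_def smult_mult_right AAv smult_smult)
  also have "y * \<nu> j = \<mu>"
    using y \<mu>(1) by (metis mult.assoc mult_1_left)
  finally have Au: "A\<^sup>\<dagger> * u = dq_of_dual \<mu> \<cdot>\<^sub>m v" .
  have "u \<in> carrier_mat m 1" "v \<in> carrier_mat n 1"
    by (intro carrier_matI; simp add: u_def)+
  then show ?thesis
    using uu vv Av Au \<mu>(2) by blast
qed

text \<open>If the standard part of \<open>A\<close> vanishes, then \<open>A = Y\<epsilon>\<close>, and a singular triple of \<open>Y\<close> with an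
  appreciable singular value gives one of \<open>A\<close> with an infinitesimal singular value.\<close>

lemma singular_triple:
  assumes A: "A \<in> carrier_mat m n" and nz: "A \<noteq> 0\<^sub>m m n"
  shows "\<exists>u v \<mu>. u \<in> carrier_mat m 1 \<and> u\<^sup>\<dagger> * u = 1\<^sub>m 1 \<and> v \<in> carrier_mat n 1 \<and> v\<^sup>\<dagger> * v = 1\<^sub>m 1 \<and>
    A * v = dq_of_dual \<mu> \<cdot>\<^sub>m u \<and> A\<^sup>\<dagger> * u = dq_of_dual \<mu> \<cdot>\<^sub>m v \<and> \<mu> > 0"
proof (cases "eps \<cdot>\<^sub>m A = 0\<^sub>m m n")
  case False
  then obtain u v \<mu> where "u \<in> carrier_mat m 1" "u\<^sup>\<dagger> * u = 1\<^sub>m 1" "v \<in> carrier_mat n 1" "v\<^sup>\<dagger> * v = 1\<^sub>m 1"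
    "A * v = dq_of_dual \<mu> \<cdot>\<^sub>m u" "A\<^sup>\<dagger> * u = dq_of_dual \<mu> \<cdot>\<^sub>m v" "std_part \<mu> > 0"
    using singular_triple_appreciable[OF A] by blast
  moreover from this have "\<mu> > 0"
    by (simp add: less_dual_num_def)
  ultimately show ?thesis
    by blast
next
  case True
  have [simp]: "dim_row A = m" "dim_col A = n"
    using A by auto
  have "eps \<cdot>\<^sub>m A = eps \<cdot>\<^sub>m 0\<^sub>m m n"
    using True by simp
  then obtain Y where "A = 0\<^sub>m m n + eps \<cdot>\<^sub>m Y" and [simp]: "dim_row Y = m" "dim_col Y = n"
    using mat_cong_eps by (metis \<open>dim_row A = m\<close> \<open>dim_col A = n\<close>)
  then have AY: "A = eps \<cdot>\<^sub>m Y"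
    by simp
  have Y: "Y \<in> carrier_mat m n"
    by (intro carrier_matI) simp_all
  obtain u v \<mu> where uv: "u \<in> carrier_mat m 1" "u\<^sup>\<dagger> * u = 1\<^sub>m 1" "v \<in> carrier_mat n 1" "v\<^sup>\<dagger> * v = 1\<^sub>m 1"
    and *: "Y * v = dq_of_dual \<mu> \<cdot>\<^sub>m u" "Y\<^sup>\<dagger> * u = dq_of_dual \<mu> \<cdot>\<^sub>m v" "std_part \<mu> > 0"
    using singular_triple_appreciable[OF Y] nz AY by blast
  have [simp]: "dim_row u = m" "dim_row v = n"
    using uv by auto
  have "A * v = dq_of_dual (eps * \<mu>) \<cdot>\<^sub>m u" "A\<^sup>\<dagger> * u = dq_of_dual (eps * \<mu>) \<cdot>\<^sub>m v"
    by (simp_all add: AY adjoint_smult_eps smult_mult_left * smult_smult)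
  moreover have "eps * \<mu> > 0"
    using *(3) by (simp add: less_dual_num_def)
  ultimately show ?thesis
    using uv by blast
qed

definition rect_diag :: "nat \<Rightarrow> nat \<Rightarrow> real dual_num list \<Rightarrow> dquat mat" where
  "rect_diag m n \<mu>s = mat m n (\<lambda>(i,j). if i = j \<and> i < length \<mu>s then dq_of_dual (\<mu>s ! i) else 0)"

lemma rect_diag_dim [simp]: "dim_row (rect_diag m n \<mu>s) = m" "dim_col (rect_diag m n \<mu>s) = n"
  by (simp_all add: rect_diag_def)

lemma rect_diag_Cons:
  "rect_diag (Suc m) (Suc n) (\<mu> # \<mu>s) = bdiag (mat 1 1 (\<lambda>_. dq_of_dual \<mu>)) (rect_diag m n \<mu>s)"
proof (rule eq_matI)
  fix i j
  assume "i < dim_row (bdiag (mat 1 1 (\<lambda>_. dq_of_dual \<mu>)) (rect_diag m n \<mu>s))"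
    "j < dim_col (bdiag (mat 1 1 (\<lambda>_. dq_of_dual \<mu>)) (rect_diag m n \<mu>s))"
  then have "i < Suc m" "j < Suc n"
    by simp_all
  then show "rect_diag (Suc m) (Suc n) (\<mu> # \<mu>s) $$ (i,j) =
      bdiag (mat 1 1 (\<lambda>_. dq_of_dual \<mu>)) (rect_diag m n \<mu>s) $$ (i,j)"
    by (cases i; cases j) (simp_all add: rect_diag_def bdiag_def)
qed simp_all

text \<open>When \<open>u\<close> and \<open>v\<close> of a singular triple are completed to unitary matrices, the two equations of
  the triple say that the first column and the first row of \<open>U\<^sup>* A V\<close> vanish off the diagonal, so
  that the induction continues with the remaining block. It ends when the block is zero.\<close>

lemma svd_unsorted:
  "A \<in> carrier_mat m n \<Longrightarrow> \<exists>\<mu>s U V. length \<mu>s \<le> min m n \<and> (\<forall>\<mu>\<in>set \<mu>s. \<mu> > 0) \<and>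
    unitary_of m U \<and> unitary_of n V \<and> U\<^sup>\<dagger> * (A * V) = rect_diag m n \<mu>s"
proof (induction m arbitrary: n A)
  case 0
  then have [simp]: "dim_row A = 0" "dim_col A = n"
    by auto
  have "(1\<^sub>m 0)\<^sup>\<dagger> * (A * 1\<^sub>m n) = rect_diag 0 n []"
    by (rule eq_matI) simp_all
  then show ?case
    by (intro exI[of _ "[]"] exI[of _ "1\<^sub>m 0"] exI[of _ "1\<^sub>m n"]) (simp add: unitary_one)
next
  case (Suc m)
  note A = Suc.prems
  have [simp]: "dim_row A = Suc m" "dim_col A = n"
    using A by auto
  show ?case
  proof (cases "A = 0\<^sub>m (Suc m) n")
    case True
    have "(1\<^sub>m (Suc m))\<^sup>\<dagger> * (A * 1\<^sub>m n) = rect_diag (Suc m) n []"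
      by (rule eq_matI) (simp_all add: True rect_diag_def)
    then show ?thesis
      by (intro exI[of _ "[]"] exI[of _ "1\<^sub>m (Suc m)"] exI[of _ "1\<^sub>m n"]) (simp add: unitary_one)
  next
    case False
    have "n \<noteq> 0"
    proof
      assume "n = 0"
      then have "A = 0\<^sub>m (Suc m) n"
        by (intro eq_matI) simp_all
      then show False
        using False by simp
    qed
    then obtain k where n: "n = Suc k"
      using not0_implies_Suc by blast
    obtain u v \<mu> where u: "u \<in> carrier_mat (Suc m) 1" "u\<^sup>\<dagger> * u = 1\<^sub>m 1"
      and v: "v \<in> carrier_mat n 1" "v\<^sup>\<dagger> * v = 1\<^sub>m 1"
      and Av: "A * v = dq_of_dual \<mu> \<cdot>\<^sub>m u" and Au: "A\<^sup>\<dagger> * u = dq_of_dual \<mu> \<cdot>\<^sub>m v" and pos: "\<mu> > 0"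
      using singular_triple[OF A False] by blast
    obtain U where U: "unitary_of (Suc m) U" "U * e0 (Suc m) = u"
      using unitary_completion[OF u] by blast
    obtain V where V: "unitary_of n V" "V * e0 n = v"
      using unitary_completion[OF v] n by blast
    note [simp] = unitary_ofD[OF U(1)] unitary_ofD[OF V(1)]
    have [simp]: "dim_row u = Suc m" "dim_row v = n"
      using u v by auto
    have Uu: "U\<^sup>\<dagger> * u = e0 (Suc m)" and Vv: "V\<^sup>\<dagger> * v = e0 n"
      using unitary_cancel(1)[OF U(1), of "e0 (Suc m)"] unitary_cancel(1)[OF V(1), of "e0 n"]
      by (simp_all add: U(2) V(2))
    define M where "M = U\<^sup>\<dagger> * (A * V)"
    have M: "M \<in> carrier_mat (Suc m) (Suc k)"
      by (intro carrier_matI) (simp_all add: M_def n)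
    then have [simp]: "dim_row M = Suc m" "dim_col M = n"
      by (auto simp: n)
    define M' where "M' = mat m k (\<lambda>(i,j). M $$ (Suc i, Suc j))"
    have [simp]: "dim_row M' = m" "dim_col M' = k"
      by (simp_all add: M'_def)
    have "M * e0 n = dq_of_dual \<mu> \<cdot>\<^sub>m e0 (Suc m)"
      by (simp add: M_def mult_assoc_dim V(2) Av smult_mult_right Uu)
    moreover have "M\<^sup>\<dagger> * e0 (Suc m) = dq_of_dual \<mu> \<cdot>\<^sub>m e0 n"
      by (simp add: M_def adjoint_mult mult_assoc_dim U(2) Au smult_mult_right Vv)
    ultimately have Mb: "M = bdiag (mat 1 1 (\<lambda>_. dq_of_dual \<mu>)) M'"
      using split_first_row_col[OF M, of 1 \<mu>] by (simp add: n M'_def)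
    have "M' \<in> carrier_mat m k"
      by (simp add: M'_def)
    from Suc.IH[OF this] obtain \<mu>s U' V' where len: "length \<mu>s \<le> min m k"
      and pos': "\<forall>\<mu>\<in>set \<mu>s. \<mu> > 0" and U': "unitary_of m U'" and V': "unitary_of k V'"
      and IH: "U'\<^sup>\<dagger> * (M' * V') = rect_diag m k \<mu>s"
      by blast
    note [simp] = unitary_ofD[OF U'] unitary_ofD[OF V']
    define E where "E = bdiag (1\<^sub>m 1) U'"
    define F where "F = bdiag (1\<^sub>m 1) V'"
    have E: "unitary_of (Suc m) E" and F: "unitary_of n F"
      using unitary_bdiag[OF unitary_one[of 1] U'] unitary_bdiag[OF unitary_one[of 1] V']
      by (simp_all add: E_def F_def n)
    note [simp] = unitary_ofD[OF E] unitary_ofD[OF F]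
    have "(U * E)\<^sup>\<dagger> * (A * (V * F)) = E\<^sup>\<dagger> * (M * F)"
      by (simp add: M_def adjoint_mult mult_assoc_dim)
    also have "\<dots> = bdiag (mat 1 1 (\<lambda>_. dq_of_dual \<mu>)) (U'\<^sup>\<dagger> * (M' * V'))"
      by (simp add: Mb E_def F_def bdiag_adjoint bdiag_mult)
    also have "\<dots> = rect_diag (Suc m) n (\<mu> # \<mu>s)"
      by (simp add: IH n rect_diag_Cons)
    finally have "(U * E)\<^sup>\<dagger> * (A * (V * F)) = rect_diag (Suc m) n (\<mu> # \<mu>s)" .
    moreover have "length (\<mu> # \<mu>s) \<le> min (Suc m) n" "\<forall>\<mu>\<in>set (\<mu> # \<mu>s). \<mu> > 0"
      using len pos pos' n by simp_all
    ultimately show ?thesis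
      using unitary_mult[OF U(1) E] unitary_mult[OF V(1) F] by blast
  qed
qed


subsection \<open>Sorting the singular values\<close>

definition perm_mat :: "nat \<Rightarrow> (nat \<Rightarrow> nat) \<Rightarrow> dquat mat" where
  "perm_mat n f = mat n n (\<lambda>(i,j). if i = f j then 1 else 0)"

lemma perm_mat_dim [simp]: "dim_row (perm_mat n f) = n" "dim_col (perm_mat n f) = n"
  by (simp_all add: perm_mat_def)

lemma permutes_lessThan_less: "f permutes {..<n} \<Longrightarrow> i < n \<Longrightarrow> f i < (n::nat)"
  using permutes_in_image[of f "{..<n}" i] by simp

lemma mult_perm_mat_index:
  assumes "f permutes {..<n}" "dim_col A = n" "i < dim_row A" "j < n"
  shows "(A * perm_mat n f) $$ (i,j) = A $$ (i, f j)"
  using assms permutes_lessThan_less[OF assms(1,4)]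
  by (simp add: mat_mult_index perm_mat_def if_distrib cong: if_cong)

lemma adjoint_perm_mat_mult_index:
  assumes "f permutes {..<n}" "dim_row A = n" "i < n" "j < dim_col A"
  shows "((perm_mat n f)\<^sup>\<dagger> * A) $$ (i,j) = A $$ (f i, j)"
proof -
  have "((perm_mat n f)\<^sup>\<dagger> * A) $$ (i,j) = (\<Sum>l<n. conjugate (perm_mat n f $$ (l,i)) * A $$ (l,j))"
    using assms by (simp add: mat_mult_index)
  also have "\<dots> = (\<Sum>l<n. if l = f i then A $$ (l,j) else 0)"
    using assms(3) by (intro sum.cong refl) (simp add: perm_mat_def)
  finally show ?thesis
    using permutes_lessThan_less[OF assms(1,3)] by simp
qed

lemma perm_mat_adjoint:
  assumes "f permutes {..<n}"
  shows "(perm_mat n f)\<^sup>\<dagger> = perm_mat n (inv_into UNIV f)"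
proof (rule eq_matI)
  fix i j assume "i < dim_row (perm_mat n (inv_into UNIV f))" "j < dim_col (perm_mat n (inv_into UNIV f))"
  moreover have "j = f i \<longleftrightarrow> i = inv_into UNIV f j"
    using permutes_inv_eq[OF assms, of j i] by auto
  ultimately show "(perm_mat n f)\<^sup>\<dagger> $$ (i,j) = perm_mat n (inv_into UNIV f) $$ (i,j)"
    by (simp add: perm_mat_def)
qed simp_all

lemma unitary_perm_mat:
  assumes "f permutes {..<n}"
  shows "unitary_of n (perm_mat n f)"
proof -
  have *: "(perm_mat n g)\<^sup>\<dagger> * perm_mat n g = 1\<^sub>m n" if "g permutes {..<n}" for g
  proof (rule eq_matI)
    fix i j assume ij: "i < dim_row (1\<^sub>m n :: dquat mat)" "j < dim_col (1\<^sub>m n :: dquat mat)"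
    then show "((perm_mat n g)\<^sup>\<dagger> * perm_mat n g) $$ (i,j) = 1\<^sub>m n $$ (i,j)"
      using that permutes_lessThan_less[OF that, of i] permutes_lessThan_less[OF that, of j] inj_eq[OF permutes_inj[OF that], of i j]
      by (simp add: adjoint_perm_mat_mult_index) (simp add: perm_mat_def)
  qed simp_all
  have "perm_mat n f * (perm_mat n f)\<^sup>\<dagger> = 1\<^sub>m n"
    using *[OF permutes_inv[OF assms]] by (simp flip: perm_mat_adjoint[OF assms])
  moreover have "perm_mat n f \<in> carrier_mat n n"
    by (simp add: perm_mat_def)
  ultimately show ?thesis
    using *[OF assms] unitary_mat_iff by blast
qed

lemma rect_diag_permute:
  assumes mset: "mset \<mu>s' = mset \<mu>s" and len: "length \<mu>s \<le> min m n"
  shows "\<exists>P Q. unitary_of m P \<and> unitary_of n Q \<and>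
    P\<^sup>\<dagger> * (rect_diag m n \<mu>s * Q) = rect_diag m n \<mu>s'"
proof -
  obtain f where f: "f permutes {..<length \<mu>s}" "permute_list f \<mu>s = \<mu>s'"
    using mset_eq_permutation[OF mset] by blast
  have fm: "f permutes {..<m}" and fn: "f permutes {..<n}"
    using permutes_subset[OF f(1)] len by auto
  have lt: "f i < length \<mu>s \<longleftrightarrow> i < length \<mu>s" for i
    using permutes_in_image[OF f(1), of i] by simp
  have nth: "\<mu>s' ! i = \<mu>s ! f i" if "i < length \<mu>s" for i
    using permute_list_nth[OF f(1) that] f(2) by simp
  have len': "length \<mu>s' = length \<mu>s"
    using mset by (metis size_mset)
  have "(perm_mat m f)\<^sup>\<dagger> * (rect_diag m n \<mu>s * perm_mat n f) = rect_diag m n \<mu>s'"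
  proof (rule eq_matI)
    fix i j assume "i < dim_row (rect_diag m n \<mu>s')" "j < dim_col (rect_diag m n \<mu>s')"
    then have ij: "i < m" "j < n"
      by simp_all
    then show "((perm_mat m f)\<^sup>\<dagger> * (rect_diag m n \<mu>s * perm_mat n f)) $$ (i,j) = rect_diag m n \<mu>s' $$ (i,j)"
      using permutes_lessThan_less[OF fm, of i] permutes_lessThan_less[OF fn, of j]
        inj_eq[OF permutes_inj[OF fm], of i j]
      by (simp add: adjoint_perm_mat_mult_index[OF fm] mult_perm_mat_index[OF fn])
        (simp add: rect_diag_def lt nth len')
  qed simp_all
  then show ?thesis
    using unitary_perm_mat[OF fm] unitary_perm_mat[OF fn] by blast
qed

lemma rect_diag_four_block:
  assumes "length \<mu>s \<le> min m n"
  shows "four_block_mat (mat_diag (length \<mu>s) (\<lambda>i. dq_of_dual (\<mu>s ! i))) (0\<^sub>m (length \<mu>s) (n - length \<mu>s))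
    (0\<^sub>m (m - length \<mu>s) (length \<mu>s)) (0\<^sub>m (m - length \<mu>s) (n - length \<mu>s)) = rect_diag m n \<mu>s"
  using assms by (intro eq_matI) (auto simp: rect_diag_def mat_diag_def)

lemma is_singular_values_iff:
  assumes A: "A \<in> carrier_mat m n"
  shows "is_singular_values A \<mu>s \<longleftrightarrow> length \<mu>s \<le> min m n \<and> sorted_wrt (\<ge>) \<mu>s \<and> (\<forall>\<mu>\<in>set \<mu>s. \<mu> > 0) \<and>
    (\<exists>U V. unitary_of m U \<and> unitary_of n V \<and> U\<^sup>\<dagger> * (A * V) = rect_diag m n \<mu>s)"
proof (cases "length \<mu>s \<le> min m n")
  case True
  have [simp]: "dim_row A = m" "dim_col A = n"
    using A by auto
  have "(U \<in> carrier_mat m m \<and> unitary_mat U \<and> V \<in> carrier_mat n n \<and> unitary_mat V \<and> U\<^sup>\<dagger> * A * V = R) \<longleftrightarrow>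
      (unitary_of m U \<and> unitary_of n V \<and> U\<^sup>\<dagger> * (A * V) = R)" for U V R
    by (cases "unitary_of m U \<and> unitary_of n V") (auto simp: mult_assoc_dim)
  then show ?thesis
    using True unfolding is_singular_values_def Let_def by (simp add: rect_diag_four_block[OF True])
next
  case False
  then show ?thesis
    using A by (auto simp: is_singular_values_def Let_def)
qed

theorem svd_exists:
  assumes A: "A \<in> carrier_mat m n"
  shows "\<exists>\<mu>s. is_singular_values A \<mu>s"
proof -
  have [simp]: "dim_row A = m" "dim_col A = n"
    using A by auto
  obtain \<mu>s U V where len: "length \<mu>s \<le> min m n" and pos: "\<forall>\<mu>\<in>set \<mu>s. \<mu> > 0"
    and U: "unitary_of m U" and V: "unitary_of n V" and d: "U\<^sup>\<dagger> * (A * V) = rect_diag m n \<mu>s"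
    using svd_unsorted[OF A] by blast
  define \<mu>s' where "\<mu>s' = rev (sort \<mu>s)"
  have "mset \<mu>s' = mset \<mu>s"
    by (simp add: \<mu>s'_def)
  from rect_diag_permute[OF this len] obtain P Q where P: "unitary_of m P" and Q: "unitary_of n Q"
    and d': "P\<^sup>\<dagger> * (rect_diag m n \<mu>s * Q) = rect_diag m n \<mu>s'"
    by blast
  note [simp] = unitary_ofD[OF U] unitary_ofD[OF V] unitary_ofD[OF P] unitary_ofD[OF Q]
  have "(U * P)\<^sup>\<dagger> * (A * (V * Q)) = rect_diag m n \<mu>s'"
    by (simp add: adjoint_mult mult_assoc_dim flip: d' d)
  moreover have "sorted_wrt (\<ge>) \<mu>s'"
    by (simp add: \<mu>s'_def sorted_wrt_rev)
  moreover have "length \<mu>s' \<le> min m n" "\<forall>\<mu>\<in>set \<mu>s'. \<mu> > 0"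
    using len pos by (simp_all add: \<mu>s'_def)
  ultimately have "is_singular_values A \<mu>s'"
    unfolding is_singular_values_iff[OF A] using unitary_mult[OF U P] unitary_mult[OF V Q] by blast
  then show ?thesis
    by blast
qed

lemma filter_prefix_nth:
  "sorted_wrt (\<lambda>x y. P y \<longrightarrow> P x) xs \<Longrightarrow> i < length xs \<Longrightarrow> P (xs ! i) \<longleftrightarrow> i < length (filter P xs)"
proof (induction xs arbitrary: i)
  case (Cons x xs)
  show ?case
  proof (cases "P x")
    case True
    then show ?thesis
      using Cons by (cases i) auto
  next
    case False
    then have "\<forall>y\<in>set xs. \<not> P y"
      using Cons.prems by auto
    then show ?thesis
      using False Cons.prems by (cases i) auto
  qed
qed simp

text \<open>A positive appreciable number exceeds every infinitesimal one in the lexicographic order, so a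
  sorted list has its appreciable entries in front.\<close>

lemma appreciable_prefix:
  fixes \<mu>s :: "real dual_num list"
  assumes "sorted_wrt (\<ge>) \<mu>s" "\<forall>\<mu>\<in>set \<mu>s. \<mu> > 0" "i < length \<mu>s"
  shows "appreciable (\<mu>s ! i) \<longleftrightarrow> i < length (filter appreciable \<mu>s)"
proof (rule filter_prefix_nth)
  show "sorted_wrt (\<lambda>x y. appreciable y \<longrightarrow> appreciable x) \<mu>s"
    using assms(1)
  proof (rule sorted_wrt_mono_rel[rotated])
    fix x y assume "x \<in> set \<mu>s" "y \<in> set \<mu>s" "x \<ge> y"
    moreover have "y > 0"
      using assms(2) \<open>y \<in> set \<mu>s\<close> by blast
    ultimately show "appreciable y \<longrightarrow> appreciable x"
      by (auto simp: appreciable_def less_eq_dual_num_def less_dual_num_def)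
  qed
qed fact


section \<open>Block row and column operations\<close>

lemma append_rows_dim [simp]:
  "dim_row (A @\<^sub>r B) = dim_row A + dim_row B" "dim_col (A @\<^sub>r B) = dim_col A"
  by (simp_all add: append_rows_def)

lemma append_cols_dim [simp]:
  "dim_row (A @\<^sub>c B) = dim_row A" "dim_col (A @\<^sub>c B) = dim_col A + dim_col B"
  by (simp_all add: append_cols_def)

lemma append_rows_index:
  "i < dim_row A + dim_row B \<Longrightarrow> j < dim_col A \<Longrightarrow>
    (A @\<^sub>r B) $$ (i,j) = (if i < dim_row A then A $$ (i,j) else B $$ (i - dim_row A, j))"
  by (simp add: append_rows_def)

lemma append_cols_index:
  "i < dim_row A \<Longrightarrow> j < dim_col A + dim_col B \<Longrightarrow>
    (A @\<^sub>c B) $$ (i,j) = (if j < dim_col A then A $$ (i,j) else B $$ (i, j - dim_col A))"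
  by (simp add: append_cols_def)

lemma split_rows:
  assumes "M \<in> carrier_mat (a + b) n"
  obtains M1 M2 where "M1 \<in> carrier_mat a n" "M2 \<in> carrier_mat b n" "M = M1 @\<^sub>r M2"
proof
  show "M = mat a n (\<lambda>(i,j). M $$ (i,j)) @\<^sub>r mat b n (\<lambda>(i,j). M $$ (a + i,j))"
    using assms by (intro eq_matI) (simp_all add: append_rows_index)
qed simp_all

lemma split_cols:
  assumes "M \<in> carrier_mat m (a + b)"
  obtains M1 M2 where "M1 \<in> carrier_mat m a" "M2 \<in> carrier_mat m b" "M = M1 @\<^sub>c M2"
proof
  show "M = mat m a (\<lambda>(i,j). M $$ (i,j)) @\<^sub>c mat m b (\<lambda>(i,j). M $$ (i,a + j))"
    using assms by (intro eq_matI) (simp_all add: append_cols_index)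
qed simp_all

lemma append_rows_mult:
  assumes "dim_col A = dim_col B" "dim_col B = dim_row C"
  shows "(A @\<^sub>r B) * C = (A * C) @\<^sub>r (B * (C :: dquat mat))"
proof (rule eq_matI)
  fix i j assume "i < dim_row (A * C @\<^sub>r B * C)" "j < dim_col (A * C @\<^sub>r B * C)"
  then show "((A @\<^sub>r B) * C) $$ (i,j) = (A * C @\<^sub>r B * C) $$ (i,j)"
    using assms by (simp add: append_rows_index mat_mult_index)
qed simp_all

lemma mult_append_cols:
  assumes "dim_col M = dim_row A" "dim_row A = dim_row B"
  shows "M * (A @\<^sub>c B) = (M * A) @\<^sub>c (M * (B :: dquat mat))"
proof (rule eq_matI)
  fix i j assume "i < dim_row (M * A @\<^sub>c M * B)" "j < dim_col (M * A @\<^sub>c M * B)"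
  then show "(M * (A @\<^sub>c B)) $$ (i,j) = (M * A @\<^sub>c M * B) $$ (i,j)"
    using assms by (simp add: append_cols_index mat_mult_index)
qed simp_all

lemma append_cols_add:
  "dim_row A = dim_row B \<Longrightarrow> dim_row C = dim_row A \<Longrightarrow> dim_row D = dim_row A \<Longrightarrow>
    dim_col A = dim_col C \<Longrightarrow> dim_col B = dim_col D \<Longrightarrow>
    (A @\<^sub>c B) + (C @\<^sub>c D) = (A + C) @\<^sub>c (B + (D :: dquat mat))"
  by (rule eq_matI) (simp_all add: append_cols_index)

lemma append_cols_smult:
  "dim_row A = dim_row B \<Longrightarrow> z \<cdot>\<^sub>m (A @\<^sub>c B) = (z \<cdot>\<^sub>m A) @\<^sub>c (z \<cdot>\<^sub>m (B :: dquat mat))"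
  by (rule eq_matI) (simp_all add: append_cols_index)

lemma append_rows_smult:
  "dim_col A = dim_col B \<Longrightarrow> z \<cdot>\<^sub>m (A @\<^sub>r B) = (z \<cdot>\<^sub>m A) @\<^sub>r (z \<cdot>\<^sub>m (B :: dquat mat))"
  by (rule eq_matI) (simp_all add: append_rows_index)

lemma append_rows_cols:
  "dim_row A = dim_row B \<Longrightarrow> dim_row C = dim_row D \<Longrightarrow> dim_col A = dim_col C \<Longrightarrow> dim_col B = dim_col D \<Longrightarrow>
    (A @\<^sub>r C) @\<^sub>c (B @\<^sub>r D) = (A @\<^sub>c B) @\<^sub>r (C @\<^sub>c (D :: dquat mat))"
  by (rule eq_matI) (simp_all add: append_rows_index append_cols_index)

lemma bdiag_mult_append_rows:
  assumes "dim_col P = dim_row A" "dim_col Q = dim_row B" "dim_col A = dim_col B"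
  shows "bdiag P Q * (A @\<^sub>r B) = (P * A) @\<^sub>r (Q * B)"
proof -
  obtain a b where P: "P \<in> carrier_mat a b" by blast
  obtain c d where Q: "Q \<in> carrier_mat c d" by blast
  obtain n where A: "A \<in> carrier_mat b n"
    using assms(1) P by (metis carrier_matD(2) carrier_matI)
  have B: "B \<in> carrier_mat d n"
    using assms Q A by (metis carrier_matD(2) carrier_matI)
  show ?thesis
    unfolding bdiag_def append_rows_def using P Q A B
    by (simp add: mult_four_block_mat[OF P _ _ Q A zero_carrier_mat[of b 0] B zero_carrier_mat[of d 0]])
qed

lemma append_cols_mult_bdiag:
  assumes "dim_col A = dim_row X" "dim_col B = dim_row Y" "dim_row A = dim_row B"
  shows "(A @\<^sub>c B) * bdiag X Y = (A * X) @\<^sub>c (B * Y)"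
proof -
  obtain a b where X: "X \<in> carrier_mat a b" by blast
  obtain c d where Y: "Y \<in> carrier_mat c d" by blast
  obtain m where A: "A \<in> carrier_mat m a"
    using assms(1) X by (metis carrier_matD(1) carrier_matI)
  have B: "B \<in> carrier_mat m c"
    using assms Y A by (metis carrier_matD(1) carrier_matI)
  show ?thesis
    unfolding bdiag_def append_cols_def using X Y A B
    by (simp add: mult_four_block_mat[OF A B zero_carrier_mat[of 0 a] zero_carrier_mat[of 0 c] X _ _ Y])
qed

text \<open>Adding \<open>K\<close> times the upper block of rows to the lower one.\<close>

definition shear :: "dquat mat \<Rightarrow> dquat mat" where
  "shear K = four_block_mat (1\<^sub>m (dim_col K)) (0\<^sub>m (dim_col K) (dim_row K)) K (1\<^sub>m (dim_row K))"

lemma shear_dim [simp]: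
  "dim_row (shear K) = dim_col K + dim_row K" "dim_col (shear K) = dim_col K + dim_row K"
  by (simp_all add: shear_def)

lemma shear_mult_append_rows:
  assumes "dim_col K = dim_row A" "dim_row K = dim_row B" "dim_col A = dim_col B"
  shows "shear K * (A @\<^sub>r B) = A @\<^sub>r (K * A + B)"
proof -
  obtain c r where K: "K \<in> carrier_mat r c" by blast
  obtain n where A: "A \<in> carrier_mat c n"
    using assms(1) K by (metis carrier_matD(2) carrier_matI)
  have B: "B \<in> carrier_mat r n"
    using assms K A by (metis carrier_matD carrier_matI)
  show ?thesis
    unfolding shear_def append_rows_def using K A B
    by (simp add: mult_four_block_mat[OF one_carrier_mat zero_carrier_mat K one_carrier_mat A zero_carrier_mat[of c 0] B zero_carrier_mat[of r 0]])
qed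

lemma shear_mult:
  assumes "dim_row K = dim_row L" "dim_col K = dim_col L"
  shows "shear K * shear L = shear (K + L)"
proof -
  obtain c r where K: "K \<in> carrier_mat r c" by blast
  have L: "L \<in> carrier_mat r c"
    using assms K by (metis carrier_matD carrier_matI)
  show ?thesis
    unfolding shear_def using K L by (simp add: mult_four_block_mat[OF one_carrier_mat zero_carrier_mat K one_carrier_mat one_carrier_mat zero_carrier_mat[of c r] L one_carrier_mat])
qed

lemma shear_zero: "shear (0\<^sub>m r c) = 1\<^sub>m (c + r)"
  by (simp add: shear_def)


subsection \<open>Invertible matrices\<close>

abbreviation invertible_of :: "nat \<Rightarrow> dquat mat \<Rightarrow> bool" where
  "invertible_of n Z \<equiv> Z \<in> carrier_mat n n \<and> invertible_mat Z"

lemma invertible_ofI: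
  assumes "dim_row Z = n" "dim_col Z = n" "dim_row Z' = n" "Z * Z' = 1\<^sub>m n" "Z' * Z = 1\<^sub>m n"
  shows "invertible_of n Z"
proof
  show "Z \<in> carrier_mat n n"
    using assms by (intro carrier_matI)
  show "invertible_mat Z"
    unfolding invertible_mat_def inverts_mat_def using assms by (intro conjI exI[of _ Z']) simp_all
qed

lemma invertible_ofE:
  assumes "invertible_of n Z"
  obtains Z' where "dim_row Z = n" "dim_col Z = n" "dim_row Z' = n" "dim_col Z' = n"
    "Z * Z' = 1\<^sub>m n" "Z' * Z = 1\<^sub>m n" "mat_inv Z = Z'"
proof -
  obtain Z' where inv: "inverts_mat Z Z'" "inverts_mat Z' Z" and Z: "Z \<in> carrier_mat n n"
    using assms by (auto simp: invertible_mat_def)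
  then have "Z * Z' = 1\<^sub>m n" "Z' * Z = 1\<^sub>m (dim_row Z')"
    by (auto simp: inverts_mat_def)
  moreover from arg_cong[OF this(1), of dim_col] arg_cong[OF this(2), of dim_col]
  have "dim_col Z' = n" "dim_row Z' = n"
    using Z by auto
  ultimately show ?thesis
    using Z mat_inv_eqI[OF Z inv] that by auto
qed

lemma invertible_cancel:
  assumes "Z * Z' = 1\<^sub>m n" "dim_col Z = n" "dim_row Z' = n" "dim_col Z' = n" "dim_row A = n"
  shows "Z * (Z' * A) = (A :: dquat mat)"
  using assms by (simp flip: mult_assoc_dim)

lemma invertible_of_mult:
  assumes "invertible_of n Y" "invertible_of n Z"
  shows "invertible_of n (Y * Z)"
proof -
  obtain Y' where Y: "dim_row Y = n" "dim_col Y = n" "dim_row Y' = n" "dim_col Y' = n"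
    "Y * Y' = 1\<^sub>m n" "Y' * Y = 1\<^sub>m n"
    using assms(1) by (rule invertible_ofE)
  obtain Z' where Z: "dim_row Z = n" "dim_col Z = n" "dim_row Z' = n" "dim_col Z' = n"
    "Z * Z' = 1\<^sub>m n" "Z' * Z = 1\<^sub>m n"
    using assms(2) by (rule invertible_ofE)
  show ?thesis
    by (rule invertible_ofI[of _ _ "Z' * Y'"])
      (simp_all add: mult_assoc_dim Y Z invertible_cancel[of Z Z' n]
        invertible_cancel[of Y' Y n])
qed

lemma unitary_invertible: "unitary_of n U \<Longrightarrow> invertible_of n U"
  by (rule invertible_ofI[of _ _ "U\<^sup>\<dagger>"]) (simp_all add: unitary_ofD)

lemma invertible_one: "invertible_of n (1\<^sub>m n)"
  by (rule unitary_invertible[OF unitary_one])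

lemma invertible_bdiag:
  assumes "invertible_of m Y" "invertible_of n Z"
  shows "invertible_of (m + n) (bdiag Y Z)"
proof -
  obtain Y' where Y: "dim_row Y = m" "dim_col Y = m" "dim_row Y' = m" "dim_col Y' = m"
    "Y * Y' = 1\<^sub>m m" "Y' * Y = 1\<^sub>m m"
    using assms(1) by (rule invertible_ofE)
  obtain Z' where Z: "dim_row Z = n" "dim_col Z = n" "dim_row Z' = n" "dim_col Z' = n"
    "Z * Z' = 1\<^sub>m n" "Z' * Z = 1\<^sub>m n"
    using assms(2) by (rule invertible_ofE)
  show ?thesis
    by (rule invertible_ofI[of _ _ "bdiag Y' Z'"])
      (simp_all add: bdiag_mult bdiag_one Y Z)
qed

lemma invertible_shear:
  assumes K: "K \<in> carrier_mat r c"
  shows "invertible_of (c + r) (shear K)"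
proof -
  have [simp]: "dim_row K = r" "dim_col K = c"
    using K by auto
  have "K + (- K) = 0\<^sub>m r c" "- K + K = 0\<^sub>m r c"
    by (rule eq_matI; simp)+
  then show ?thesis
    by (intro invertible_ofI[of _ _ "shear (- K)"])
      (simp_all add: shear_mult shear_zero)
qed

lemma one_plus_eps_inverse:
  fixes X :: "dquat mat"
  assumes [simp]: "dim_row X = n" "dim_col X = n"
  shows "(1\<^sub>m n + eps \<cdot>\<^sub>m X) * (1\<^sub>m n - eps \<cdot>\<^sub>m X) = 1\<^sub>m n"
    "(1\<^sub>m n - eps \<cdot>\<^sub>m X) * (1\<^sub>m n + eps \<cdot>\<^sub>m X) = 1\<^sub>m n"
  by (simp_all add: mult_minus_dim mult_add_dim smult_mult_left smult_mult_right_eps smult_smult eps_squared)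
    (rule eq_matI; simp add: dual_num_eq_iff)+

lemma invertible_one_plus_eps:
  assumes "dim_row T = n" "dim_col T = n"
  shows "invertible_of n (1\<^sub>m n + eps \<cdot>\<^sub>m T)"
  using one_plus_eps_inverse[OF assms] assms
  by (intro invertible_ofI[of _ _ "1\<^sub>m n - eps \<cdot>\<^sub>m T"]) simp_all

lemma invertible_mat_diag:
  assumes "\<And>i. i < n \<Longrightarrow> std_part (f i) \<noteq> (0 :: quat)"
  shows "invertible_of n (mat_diag n f)"
proof -
  have "\<forall>i. \<exists>y. i < n \<longrightarrow> y * f i = 1 \<and> f i * y = 1"
    using assms dquat_inverse_ex by metis
  then obtain g where g: "\<forall>i. i < n \<longrightarrow> g i * f i = 1 \<and> f i * g i = 1"
    by metis
  have "mat_diag n f * mat_diag n g = 1\<^sub>m n" "mat_diag n g * mat_diag n f = 1\<^sub>m n"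
    using g unfolding mat_diag_diag by (simp_all add: mat_diag_def) (rule eq_matI; simp)+
  then show ?thesis
    by (intro invertible_ofI[of _ _ "mat_diag n g"]) (simp_all add: mat_diag_def)
qed

text \<open>Infinitesimal rotations: the skew-Hermitian matrices are the tangent space of the unitary group
  at the identity.\<close>

lemma unitary_one_plus_eps_skew:
  assumes S: "S \<in> carrier_mat n n" "S\<^sup>\<dagger> = - S"
  shows "unitary_of n (1\<^sub>m n + eps \<cdot>\<^sub>m S)"
proof -
  have [simp]: "dim_row S = n" "dim_col S = n"
    using S by auto
  have adj: "(1\<^sub>m n + eps \<cdot>\<^sub>m S)\<^sup>\<dagger> = 1\<^sub>m n - eps \<cdot>\<^sub>m S"
    by (simp add: adjoint_add adjoint_smult_eps S(2)) (rule eq_matI; simp)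
  have "(1\<^sub>m n + eps \<cdot>\<^sub>m S) * (1\<^sub>m n - eps \<cdot>\<^sub>m S) = 1\<^sub>m n"
    "(1\<^sub>m n - eps \<cdot>\<^sub>m S) * (1\<^sub>m n + eps \<cdot>\<^sub>m S) = 1\<^sub>m n"
    by (rule one_plus_eps_inverse; simp)+
  moreover have "1\<^sub>m n + eps \<cdot>\<^sub>m S \<in> carrier_mat n n"
    using S by simp
  ultimately show ?thesis
    using unitary_mat_iff[of "1\<^sub>m n + eps \<cdot>\<^sub>m S" n] by (simp only: adj simp_thms)
qed


section \<open>Factoring through the singular values\<close>

lemma rect_diag_split:
  assumes "a \<le> length \<mu>s"
  shows "rect_diag (a + m) (a + n) \<mu>s =
    bdiag (mat_diag a (\<lambda>i. dq_of_dual (\<mu>s ! i))) (rect_diag m n (drop a \<mu>s))"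
proof (rule eq_matI)
  fix i j
  assume "i < dim_row (bdiag (mat_diag a (\<lambda>i. dq_of_dual (\<mu>s ! i))) (rect_diag m n (drop a \<mu>s)))"
    "j < dim_col (bdiag (mat_diag a (\<lambda>i. dq_of_dual (\<mu>s ! i))) (rect_diag m n (drop a \<mu>s)))"
  then show "rect_diag (a + m) (a + n) \<mu>s $$ (i,j) =
      bdiag (mat_diag a (\<lambda>i. dq_of_dual (\<mu>s ! i))) (rect_diag m n (drop a \<mu>s)) $$ (i,j)"
    using assms by (auto simp: rect_diag_def bdiag_def mat_diag_def)
qed (simp_all add: mat_diag_def)

lemma rect_diag_mult_mat_diag:
  "rect_diag m n \<mu>s * mat_diag n f =
    mat m n (\<lambda>(i,j). if i = j \<and> i < length \<mu>s then dq_of_dual (\<mu>s ! i) * f i else 0)"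
proof -
  have "rect_diag m n \<mu>s \<in> carrier_mat m n"
    by (simp add: rect_diag_def)
  then show ?thesis
    by (simp add: mat_diag_mult_right) (intro eq_matI; simp add: rect_diag_def)
qed

lemma singular_valuesE:
  assumes A: "A \<in> carrier_mat m n"
  obtains \<mu>s U V where "\<mu>s = singular_values A" "length \<mu>s \<le> min m n" "sorted_wrt (\<ge>) \<mu>s"
    "\<forall>\<mu>\<in>set \<mu>s. \<mu> > 0" "unitary_of m U" "unitary_of n V" "A = U * (rect_diag m n \<mu>s * V\<^sup>\<dagger>)"
    "A * V = U * rect_diag m n \<mu>s"
proof -
  have [simp]: "dim_row A = m" "dim_col A = n"
    using A by auto
  have "is_singular_values A (singular_values A)"
    unfolding singular_values_def by (rule someI_ex[OF svd_exists[OF A]])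
  then obtain U V where *: "length (singular_values A) \<le> min m n" "sorted_wrt (\<ge>) (singular_values A)"
      "\<forall>\<mu>\<in>set (singular_values A). \<mu> > 0"
    and U: "unitary_of m U" and V: "unitary_of n V"
    and d: "U\<^sup>\<dagger> * (A * V) = rect_diag m n (singular_values A)"
    unfolding is_singular_values_iff[OF A] by blast
  note [simp] = unitary_ofD[OF U] unitary_ofD[OF V]
  have AV: "A * V = U * rect_diag m n (singular_values A)"
    unfolding d[symmetric] by (simp add: unitary_cancel[OF U])
  have "A = (A * V) * V\<^sup>\<dagger>"
    by (simp add: mult_assoc_dim)
  also have "\<dots> = U * (rect_diag m n (singular_values A) * V\<^sup>\<dagger>)"
    unfolding AV by (simp add: mult_assoc_dim)
  finally show ?thesis
    using that[OF refl * U V] AV by blast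
qed

text \<open>The column scaling that turns every positive appreciable singular value into \<open>1\<close> and every
  positive infinitesimal one into \<open>eps\<close>.\<close>

lemma rank_factorization:
  assumes A: "A \<in> carrier_mat m n"
  obtains U R where "unitary_of m U" "invertible_of n R"
    "dq_Arank A \<le> dq_rank A" "dq_rank A \<le> min m n"
    "A = U * (rect_diag m n (replicate (dq_Arank A) 1 @ replicate (dq_rank A - dq_Arank A) eps) * R)"
proof -
  obtain \<mu>s U V where \<mu>s: "\<mu>s = singular_values A" and len: "length \<mu>s \<le> min m n"
    and sorted: "sorted_wrt (\<ge>) \<mu>s" and pos: "\<forall>\<mu>\<in>set \<mu>s. \<mu> > 0"
    and U: "unitary_of m U" and V: "unitary_of n V" and AUV: "A = U * (rect_diag m n \<mu>s * V\<^sup>\<dagger>)"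
    by (rule singular_valuesE[OF A])
  note [simp] = unitary_ofD[OF V]
  define r where "r = dq_Arank A"
  have t: "dq_rank A = length \<mu>s"
    by (simp add: dq_rank_def \<mu>s)
  have r_le: "r \<le> length \<mu>s"
    by (simp add: r_def dq_Arank_def \<mu>s)
  have app: "std_part (\<mu>s ! i) \<noteq> 0 \<longleftrightarrow> i < r" if "i < length \<mu>s" for i
    using appreciable_prefix[OF sorted pos that] by (simp add: r_def dq_Arank_def \<mu>s appreciable_def)
  \<comment> \<open>Behind position \<open>r\<close> the singular value is \<open>x * eps\<close> with a real \<open>x > 0\<close>, so \<open>x\<close> is an invertible scale.\<close>
  define f where "f i = (if i < r then dq_of_dual (\<mu>s ! i)
    else if i < length \<mu>s then of_real (inf_part (\<mu>s ! i)) else 1)" for i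
  have "std_part (f i) \<noteq> 0" for i
  proof -
    have "inf_part (\<mu>s ! i) \<noteq> 0" if "\<not> i < r" "i < length \<mu>s"
    proof -
      have "\<mu>s ! i > 0"
        using pos that(2) by simp
      then show ?thesis
        using app[OF that(2)] that(1) by (auto simp: less_dual_num_def)
    qed
    then show ?thesis
      using app[of i] r_le by (auto simp: f_def)
  qed
  then have F: "invertible_of n (mat_diag n f)"
    by (intro invertible_mat_diag)
  have "dq_of_dual ((replicate r 1 @ replicate (length \<mu>s - r) eps) ! i) * f i = dq_of_dual (\<mu>s ! i)"
    if "i < length \<mu>s" for i
    using that app[OF that] r_le by (auto simp: nth_append f_def dual_num_eq_iff)
  then have "rect_diag m n (replicate r 1 @ replicate (length \<mu>s - r) eps) * mat_diag n f = rect_diag m n \<mu>s"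
    unfolding rect_diag_mult_mat_diag using r_le
    by (intro eq_matI) (auto simp: rect_diag_def)
  moreover have "dim_row (mat_diag n f) = n" "dim_col (mat_diag n f) = n"
    by (simp_all add: mat_diag_def)
  ultimately have "A = U * (rect_diag m n (replicate r 1 @ replicate (length \<mu>s - r) eps) * (mat_diag n f * V\<^sup>\<dagger>))"
    unfolding AUV by (simp flip: mult_assoc_dim)
  moreover have "invertible_of n (mat_diag n f * V\<^sup>\<dagger>)"
    by (rule invertible_of_mult[OF F unitary_invertible[OF unitary_adjoint[OF V]]])
  ultimately show ?thesis
    using that[OF U] len r_le unfolding t r_def[symmetric] by blast
qed

text \<open>Modulo \<open>eps\<close> only the appreciable singular values survive.\<close>

lemma rank_factorization_std:
  assumes A: "A \<in> carrier_mat m n"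
  obtains U r R where "unitary_of m U" "invertible_of n R" "r \<le> min m n"
    "eps \<cdot>\<^sub>m A = eps \<cdot>\<^sub>m (U * (rect_diag m n (replicate r 1) * R))"
proof -
  obtain U R where U: "unitary_of m U" and R: "invertible_of n R"
    and r: "dq_Arank A \<le> dq_rank A" "dq_rank A \<le> min m n"
    and f: "A = U * (rect_diag m n (replicate (dq_Arank A) 1 @ replicate (dq_rank A - dq_Arank A) eps) * R)"
    by (rule rank_factorization[OF A])
  note [simp] = unitary_ofD[OF U]
  have [simp]: "dim_row R = n"
    using R by auto
  define D where "D = rect_diag m n (replicate (dq_Arank A) 1 @ replicate (dq_rank A - dq_Arank A) eps)"
  define D' where "D' = rect_diag m n (replicate (dq_Arank A) 1)"
  have [simp]: "dim_row D = m" "dim_col D = n" "dim_row D' = m" "dim_col D' = n"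
    by (simp_all add: D_def D'_def)
  have "eps \<cdot>\<^sub>m D = eps \<cdot>\<^sub>m D'"
    by (rule eq_matI) (auto simp: D_def D'_def rect_diag_def nth_append eps_squared)
  moreover have "eps \<cdot>\<^sub>m (U * (X * R)) = U * ((eps \<cdot>\<^sub>m X) * R)" if "dim_row X = m" "dim_col X = n" for X
    using that by (simp add: smult_mult_left smult_mult_right_eps)
  ultimately have "eps \<cdot>\<^sub>m (U * (D * R)) = eps \<cdot>\<^sub>m (U * (D' * R))"
    by simp
  then have "eps \<cdot>\<^sub>m A = eps \<cdot>\<^sub>m (U * (D' * R))"
    using f by (simp only: D_def)
  then show ?thesis
    using that[OF U R, of "dq_Arank A"] r by (simp add: D'_def)
qed


section \<open>Column operations absorbed by unitary row operations\<close>

text \<open>The equation \<open>A = U D\<^sub>A X\<^sup>-\<^sup>1\<close> leaves freedom in \<open>(U, X)\<close>: an invertible \<open>Z\<close> may be inserted into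
  \<open>X\<close> as soon as \<open>D\<^sub>A Z = P D\<^sub>A\<close> for a unitary \<open>P\<close>, which then goes into \<open>U\<close>. These \<open>Z\<close> are the row
  operations that are available for simplifying \<open>B\<close>.\<close>

definition absorbs :: "dquat mat \<Rightarrow> dquat mat \<Rightarrow> bool" where
  "absorbs D Z \<longleftrightarrow> invertible_of (dim_col D) Z \<and> (\<exists>P. unitary_of (dim_row D) P \<and> D * Z = P * D)"

lemma absorbs_mult:
  assumes "absorbs D Y" "absorbs D Z"
  shows "absorbs D (Y * Z)"
proof -
  obtain P Q where P: "unitary_of (dim_row D) P" "D * Y = P * D"
    and Q: "unitary_of (dim_row D) Q" "D * Z = Q * D"
    using assms by (auto simp: absorbs_def)
  have Y: "invertible_of (dim_col D) Y" and Z: "invertible_of (dim_col D) Z"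
    using assms by (auto simp: absorbs_def)
  then have "dim_row Y = dim_col D" "dim_col Y = dim_col D" "dim_row Z = dim_col D"
    by auto
  then have "D * (Y * Z) = (P * Q) * D"
    using unitary_ofD(1,2)[OF P(1)] unitary_ofD(1,2)[OF Q(1)] P(2) Q(2)
    by (metis mult_assoc_dim)
  then show ?thesis
    using invertible_of_mult[OF Y Z] unitary_mult[OF P(1) Q(1)] by (auto simp: absorbs_def)
qed

lemma absorbs_bdiag_right:
  assumes "absorbs E Z"
  shows "absorbs (bdiag (1\<^sub>m r) E) (bdiag (1\<^sub>m r) Z)"
proof -
  obtain P where P: "unitary_of (dim_row E) P" "E * Z = P * E" and Z: "invertible_of (dim_col E) Z"
    using assms by (auto simp: absorbs_def)
  then have "dim_row Z = dim_col E"
    by auto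
  then have "bdiag (1\<^sub>m r) E * bdiag (1\<^sub>m r) Z = bdiag (1\<^sub>m r) P * bdiag (1\<^sub>m r) E"
    using unitary_ofD(2)[OF P(1)] P(2) by (simp add: bdiag_mult)
  then show ?thesis
    using invertible_bdiag[OF invertible_one Z, of r] unitary_bdiag[OF unitary_one P(1), of r]
    unfolding absorbs_def by auto
qed

lemma absorbs_bdiag_left:
  assumes "unitary_of r P"
  shows "absorbs (bdiag (1\<^sub>m r) E) (bdiag P (1\<^sub>m (dim_col E)))"
proof -
  have "bdiag (1\<^sub>m r) E * bdiag P (1\<^sub>m (dim_col E)) = bdiag P (1\<^sub>m (dim_row E)) * bdiag (1\<^sub>m r) E"
    using unitary_ofD[OF assms] by (simp add: bdiag_mult)
  then show ?thesis
    using invertible_bdiag[OF unitary_invertible[OF assms] invertible_one, of "dim_col E"]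
      unitary_bdiag[OF assms unitary_one, of "dim_row E"]
    unfolding absorbs_def by auto
qed

definition eps_block :: "nat \<Rightarrow> nat \<Rightarrow> nat \<Rightarrow> dquat mat" where
  "eps_block s m t = bdiag (eps \<cdot>\<^sub>m 1\<^sub>m s) (0\<^sub>m m t)"

lemma eps_block_dim [simp]: "dim_row (eps_block s m t) = s + m" "dim_col (eps_block s m t) = s + t"
  by (simp_all add: eps_block_def)

lemma eps_block_smult: "eps_block s m t = eps \<cdot>\<^sub>m bdiag (1\<^sub>m s) (0\<^sub>m m t)"
  by (simp add: eps_block_def bdiag_smult)

lemma absorbs_eps_block_bdiag:
  assumes P: "unitary_of s P" and Q: "invertible_of t Q"
  shows "absorbs (eps_block s m t) (bdiag P Q)"
proof -
  have [simp]: "dim_row Q = t" "dim_col Q = t"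
    using Q by auto
  have "eps_block s m t * bdiag P Q = bdiag P (1\<^sub>m m) * eps_block s m t"
    using unitary_ofD[OF P]
    by (simp add: eps_block_def bdiag_mult smult_mult_left smult_mult_right_eps)
  then show ?thesis
    using invertible_bdiag[OF unitary_invertible[OF P] Q] unitary_bdiag[OF P unitary_one, of m]
    unfolding absorbs_def by auto
qed

lemma absorbs_same:
  assumes "invertible_of (dim_col D) Z" "D * Z = D"
  shows "absorbs D Z"
  using assms unitary_one[of "dim_row D"] mult_one_dim(2)[of D] unfolding absorbs_def by metis

lemma absorbs_eps_block_shear:
  assumes K: "K \<in> carrier_mat t s"
  shows "absorbs (eps_block s m t) (shear K)"
proof (rule absorbs_same)
  have e: "eps \<cdot>\<^sub>m 1\<^sub>m s \<in> carrier_mat s s"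
    by simp
  have [simp]: "dim_row K = t" "dim_col K = s"
    using K by auto
  show "eps_block s m t * shear K = eps_block s m t"
    unfolding eps_block_def bdiag_def shear_def
    by (simp add: mult_four_block_mat[OF e zero_carrier_mat zero_carrier_mat zero_carrier_mat[of m t]
          one_carrier_mat zero_carrier_mat K one_carrier_mat])
qed (use invertible_shear[OF K] in simp)

text \<open>Since \<open>eps * eps = 0\<close>, every transformation that is congruent to the identity modulo \<open>eps\<close> is
  invisible to a block that is itself a multiple of \<open>eps\<close>.\<close>

lemma absorbs_eps_block_one_plus_eps:
  assumes T: "dim_row T = s + t" "dim_col T = s + t"
  shows "absorbs (eps_block s m t) (1\<^sub>m (s + t) + eps \<cdot>\<^sub>m T)"
proof (rule absorbs_same)
  have "eps_block s m t * (eps \<cdot>\<^sub>m T) = 0\<^sub>m (s + m) (s + t)"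
    unfolding eps_block_smult using T
    by (simp add: smult_mult_left smult_mult_right_eps smult_smult eps_squared)
  then show "eps_block s m t * (1\<^sub>m (s + t) + eps \<cdot>\<^sub>m T) = eps_block s m t"
    using T by (simp add: mult_add_dim)
qed (use invertible_one_plus_eps[OF T] in simp)

text \<open>Adding a multiple of the first \<open>r\<close> rows to the later ones is compensated by an infinitesimal
  rotation \<open>I + S\<epsilon>\<close>: its lower left block reproduces the effect on the \<open>eps\<close> rows, and its upper right
  block meets only multiples of \<open>eps\<close> and therefore has no effect.\<close>

lemma absorbs_shear:
  assumes K: "K \<in> carrier_mat (s + t) r"
  shows "absorbs (bdiag (1\<^sub>m r) (eps_block s m t)) (shear K)"
proof -
  have [simp]: "dim_row K = s + t" "dim_col K = r"
    using K by auto
  define E where "E = eps_block s m t"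
  define E0 where "E0 = bdiag (1\<^sub>m s) (0\<^sub>m m t)"
  have [simp]: "dim_row E = s + m" "dim_col E = s + t" "dim_row E0 = s + m" "dim_col E0 = s + t"
    by (simp_all add: E_def E0_def)
  have EE: "E = eps \<cdot>\<^sub>m E0"
    by (simp add: E_def E0_def eps_block_smult)
  have E: "E \<in> carrier_mat (s + m) (s + t)"
    by (intro carrier_matI) simp_all
  define Q where "Q = E0 * K"
  have [simp]: "dim_row Q = s + m" "dim_col Q = r"
    by (simp_all add: Q_def)
  have Q: "Q \<in> carrier_mat (s + m) r" "- Q\<^sup>\<dagger> \<in> carrier_mat r (s + m)"
    by (intro carrier_matI; simp)+
  define S where "S = four_block_mat (0\<^sub>m r r) (- Q\<^sup>\<dagger>) Q (0\<^sub>m (s + m) (s + m))"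
  have S: "S \<in> carrier_mat (r + (s + m)) (r + (s + m))"
    unfolding S_def by (intro four_block_carrier_mat) simp_all
  have "S\<^sup>\<dagger> = - S"
    by (rule eq_matI) (simp_all add: S_def)
  then have P: "unitary_of (r + (s + m)) (1\<^sub>m (r + (s + m)) + eps \<cdot>\<^sub>m S)"
    by (rule unitary_one_plus_eps_skew[OF S])
  have "bdiag (1\<^sub>m r) E * shear K = four_block_mat (1\<^sub>m r) (0\<^sub>m r (s + t)) (eps \<cdot>\<^sub>m Q) E"
    unfolding bdiag_def shear_def
    by (simp add: mult_four_block_mat[OF one_carrier_mat zero_carrier_mat zero_carrier_mat E
          one_carrier_mat zero_carrier_mat K one_carrier_mat])
      (simp add: EE Q_def smult_mult_left)
  moreover have "(1\<^sub>m (r + (s + m)) + eps \<cdot>\<^sub>m S) * bdiag (1\<^sub>m r) E =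
      four_block_mat (1\<^sub>m r) (0\<^sub>m r (s + t)) (eps \<cdot>\<^sub>m Q) E"
  proof -
    have "S * bdiag (1\<^sub>m r) E = four_block_mat (0\<^sub>m r r) (- Q\<^sup>\<dagger> * E) Q (0\<^sub>m (s + m) (s + t))"
      unfolding bdiag_def S_def
      by (simp add: mult_four_block_mat[OF zero_carrier_mat Q(2,1) zero_carrier_mat
            one_carrier_mat zero_carrier_mat zero_carrier_mat E])
    moreover have "eps \<cdot>\<^sub>m (- Q\<^sup>\<dagger> * E) = 0\<^sub>m r (s + t)"
      unfolding EE by (simp add: smult_mult_right_eps smult_smult eps_squared)
    moreover have "- Q\<^sup>\<dagger> * E \<in> carrier_mat r (s + t)"
      by (intro carrier_matI) simp_all
    ultimately have "eps \<cdot>\<^sub>m (S * bdiag (1\<^sub>m r) E) =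
        four_block_mat (0\<^sub>m r r) (0\<^sub>m r (s + t)) (eps \<cdot>\<^sub>m Q) (0\<^sub>m (s + m) (s + t))"
      by (simp add: smult_four_block_mat[OF zero_carrier_mat _ Q(1) zero_carrier_mat])
    moreover have "dim_row S = r + (s + m)" "dim_col S = r + (s + m)"
      using S by auto
    ultimately have "(1\<^sub>m (r + (s + m)) + eps \<cdot>\<^sub>m S) * bdiag (1\<^sub>m r) E =
        bdiag (1\<^sub>m r) E + four_block_mat (0\<^sub>m r r) (0\<^sub>m r (s + t)) (eps \<cdot>\<^sub>m Q) (0\<^sub>m (s + m) (s + t))"
      by (simp add: mult_add_dim smult_mult_left)
    also have "\<dots> = four_block_mat (1\<^sub>m r) (0\<^sub>m r (s + t)) (eps \<cdot>\<^sub>m Q) E"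
      by (rule eq_matI) (simp_all add: bdiag_def)
    finally show ?thesis .
  qed
  ultimately show ?thesis
    using P invertible_shear[OF K] unfolding absorbs_def E_def[symmetric] by auto
qed


section \<open>The normal form of the lower block\<close>

text \<open>In \<open>\<Sigma>\<^sub>2\<close> the identity stands in the last rows, below the zero block.\<close>

definition low_identity :: "nat \<Rightarrow> nat \<Rightarrow> dquat mat" where
  "low_identity t e = mat t e (\<lambda>(i,j). if i = t - e + j then 1 else 0)"

lemma low_identity_dim [simp]: "dim_row (low_identity t e) = t" "dim_col (low_identity t e) = e"
  by (simp_all add: low_identity_def)

lemma low_identity_orthonormal:
  assumes "e \<le> t"
  shows "(low_identity t e)\<^sup>\<dagger> * low_identity t e = 1\<^sub>m e"
proof (rule eq_matI)
  fix i j assume "i < dim_row (1\<^sub>m e :: dquat mat)" "j < dim_col (1\<^sub>m e :: dquat mat)"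
  then show "((low_identity t e)\<^sup>\<dagger> * low_identity t e) $$ (i,j) = 1\<^sub>m e $$ (i,j)"
    using assms
    by (simp add: mat_mult_index low_identity_def if_distrib[of conjugate]
        if_distrib[of "\<lambda>x. x * y" for y] cong: if_cong) arith
qed simp_all

abbreviation top_identity :: "nat \<Rightarrow> nat \<Rightarrow> dquat mat" where
  "top_identity s r \<equiv> rect_diag s r (replicate r 1)"

lemma top_identity_orthonormal:
  assumes "r \<le> s"
  shows "(top_identity s r)\<^sup>\<dagger> * top_identity s r = 1\<^sub>m r"
proof (rule eq_matI)
  fix i j assume "i < dim_row (1\<^sub>m r :: dquat mat)" "j < dim_col (1\<^sub>m r :: dquat mat)"
  then have ij: "i < r" "j < r"
    by simp_all
  then have "((top_identity s r)\<^sup>\<dagger> * top_identity s r) $$ (i,j) =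
      (\<Sum>l<s. conjugate (top_identity s r $$ (l,i)) * top_identity s r $$ (l,j))"
    by (simp add: mat_mult_index)
  also have "\<dots> = (\<Sum>l<s. if l = j then 1\<^sub>m r $$ (i,j) else 0)"
    using ij assms by (intro sum.cong refl) (simp add: rect_diag_def)
  finally show "((top_identity s r)\<^sup>\<dagger> * top_identity s r) $$ (i,j) = 1\<^sub>m r $$ (i,j)"
    using ij assms by simp
qed simp_all

lemma rect_diag_replicate_append_cols:
  "r \<le> n \<Longrightarrow> rect_diag s n (replicate r 1) = top_identity s r @\<^sub>c 0\<^sub>m s (n - r)"
  by (rule eq_matI) (auto simp: rect_diag_def append_cols_index)

lemma top_identity_eq_permuted_low_identity:
  assumes "e \<le> t"
  shows "\<exists>P. unitary_of t P \<and> top_identity t e = P * low_identity t e"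
proof -
  \<comment> \<open>The cyclic shift of the rows that moves the first \<open>e\<close> of them to the end.\<close>
  define f where "f i = (if i < e then t - e + i else if i < t then i - e else i)" for i
  have "inj_on f {..<t}"
    using assms by (auto simp: inj_on_def f_def split: if_splits)
  moreover have "f ` {..<t} \<subseteq> {..<t}"
    using assms by (auto simp: f_def)
  ultimately have "bij_betw f {..<t} {..<t}"
    by (simp add: bij_betw_def endo_inj_surj)
  then have f: "f permutes {..<t}"
    by (rule bij_imp_permutes) (use assms in \<open>auto simp: f_def\<close>)
  have "top_identity t e = (perm_mat t f)\<^sup>\<dagger> * low_identity t e"
  proof (rule eq_matI)
    fix i j assume "i < dim_row ((perm_mat t f)\<^sup>\<dagger> * low_identity t e)"
      "j < dim_col ((perm_mat t f)\<^sup>\<dagger> * low_identity t e)"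
    then have ij: "i < t" "j < e"
      by simp_all
    then have "f i = t - e + j \<longleftrightarrow> i = j"
      using assms by (auto simp: f_def)
    then show "top_identity t e $$ (i,j) = ((perm_mat t f)\<^sup>\<dagger> * low_identity t e) $$ (i,j)"
      using ij permutes_lessThan_less[OF f ij(1)]
      by (simp add: adjoint_perm_mat_mult_index[OF f]) (simp add: rect_diag_def low_identity_def)
  qed simp_all
  then show ?thesis
    using unitary_adjoint[OF unitary_perm_mat[OF f]] by blast
qed

lemma eps_cong_mult:
  fixes A B M :: "dquat mat"
  assumes "eps \<cdot>\<^sub>m A = eps \<cdot>\<^sub>m B"
  shows "dim_col A = dim_row M \<Longrightarrow> dim_col B = dim_row M \<Longrightarrow> eps \<cdot>\<^sub>m (A * M) = eps \<cdot>\<^sub>m (B * M)"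
    "dim_col M = dim_row A \<Longrightarrow> dim_col M = dim_row B \<Longrightarrow> eps \<cdot>\<^sub>m (M * A) = eps \<cdot>\<^sub>m (M * B)"
  using assms by (simp flip: smult_mult_left) (use assms in \<open>simp flip: smult_mult_right_eps\<close>)

text \<open>The normal form modulo \<open>eps\<close>. A unitary transformation and column operations bring the upper
  block to \<open>(I, 0; 0, 0)\<close>; the first \<open>r\<close> columns of the lower block are then cleared by adding
  multiples of the upper rows, and what remains there is reduced by invertible row and column
  operations.\<close>

lemma normal_form_std:
  assumes C: "C \<in> carrier_mat (s + t) b"
  obtains r e G Z where "r \<le> s" "e \<le> t" "r + e \<le> b" "invertible_of b G"
    "\<And>m. absorbs (eps_block s m t) Z"
    "eps \<cdot>\<^sub>m C = eps \<cdot>\<^sub>m (Z *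
      ((bdiag (top_identity s r) (low_identity t e) @\<^sub>c 0\<^sub>m (s + t) (b - r - e)) * G))"
proof -
  obtain Ct Cb where Ct: "Ct \<in> carrier_mat s b" and Cb: "Cb \<in> carrier_mat t b" and CC: "C = Ct @\<^sub>r Cb"
    using split_rows[OF C] by blast
  obtain P r G1 where P: "unitary_of s P" and G1: "invertible_of b G1" and r: "r \<le> min s b"
    and Ct_eq: "eps \<cdot>\<^sub>m Ct = eps \<cdot>\<^sub>m (P * (rect_diag s b (replicate r 1) * G1))"
    by (rule rank_factorization_std[OF Ct])
  obtain G1' where G1': "dim_row G1 = b" "dim_col G1 = b" "dim_row G1' = b" "dim_col G1' = b"
    "G1 * G1' = 1\<^sub>m b" "G1' * G1 = 1\<^sub>m b"
    using G1 by (rule invertible_ofE)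
  note [simp] = unitary_ofD[OF P] G1'
  have [simp]: "dim_row Ct = s" "dim_col Ct = b" "dim_row Cb = t" "dim_col Cb = b"
    using Ct Cb by auto
  have "Cb * G1' \<in> carrier_mat t (r + (b - r))"
    using r by (intro carrier_matI) simp_all
  then obtain Fa Fb where Fa: "Fa \<in> carrier_mat t r" and Fb: "Fb \<in> carrier_mat t (b - r)"
    and F: "Cb * G1' = Fa @\<^sub>c Fb"
    by (rule split_cols)
  obtain Q e G2 where Q: "unitary_of t Q" and G2: "invertible_of (b - r) G2" and e: "e \<le> min t (b - r)"
    and Fb_eq: "eps \<cdot>\<^sub>m Fb = eps \<cdot>\<^sub>m (Q * (rect_diag t (b - r) (replicate e 1) * G2))"
    by (rule rank_factorization_std[OF Fb])
  obtain R where R: "unitary_of t R" and top: "top_identity t e = R * low_identity t e"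
    using top_identity_eq_permuted_low_identity[of e t] e by auto
  note [simp] = unitary_ofD(1,2)[OF Q] unitary_ofD(1,2)[OF R]
  have [simp]: "dim_row G2 = b - r" "dim_col G2 = b - r" "dim_row Fa = t" "dim_col Fa = r"
    "dim_row Fb = t" "dim_col Fb = b - r"
    using G2 Fa Fb by auto
  have re: "r + e \<le> b"
    using r e by auto
  let ?X = "top_identity s r"
  define J where "J = low_identity t e @\<^sub>c 0\<^sub>m t (b - r - e)"
  have [simp]: "dim_row J = t" "dim_col J = b - r"
    using e re by (simp_all add: J_def)
  have "rect_diag t (b - r) (replicate e 1) = R * J"
    using e re by (simp add: rect_diag_replicate_append_cols top J_def mult_append_cols)
  then have Fb_eq': "eps \<cdot>\<^sub>m Fb = eps \<cdot>\<^sub>m (Q * R * (J * G2))"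
    using Fb_eq by (simp add: mult_assoc_dim)
  define W where "W = Q * R * (J * G2)"
  have [simp]: "dim_row W = t" "dim_col W = b - r"
    by (simp_all add: W_def)
  \<comment> \<open>Adding \<open>L\<close> times the upper rows creates \<open>Fa\<close>, since the adjoint is a left inverse of \<open>?X\<close>.\<close>
  define L where "L = Fa * ?X\<^sup>\<dagger>"
  have LX: "L * ?X = Fa"
    using r re by (simp add: L_def mult_assoc_dim top_identity_orthonormal)
  have [simp]: "dim_row L = t" "dim_col L = s"
    by (simp_all add: L_def)
  have L: "L \<in> carrier_mat t s"
    by (intro carrier_matI) simp_all
  define Z where "Z = bdiag P (1\<^sub>m t) * (shear L * bdiag (1\<^sub>m s) (Q * R))"
  define G where "G = bdiag (1\<^sub>m r) G2 * G1"
  have G: "invertible_of b G"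
    using invertible_of_mult[OF _ G1, of "bdiag (1\<^sub>m r) G2"] invertible_bdiag[OF invertible_one[of r] G2] r
    by (simp add: G_def)
  have Z: "absorbs (eps_block s m t) Z" for m
    unfolding Z_def
    by (intro absorbs_mult absorbs_eps_block_bdiag absorbs_eps_block_shear P L invertible_one
        unitary_one unitary_invertible[OF unitary_mult[OF Q R]])
  define S where "S = (?X @\<^sub>c 0\<^sub>m s (b - r)) @\<^sub>r (0\<^sub>m t r @\<^sub>c J)"
  have S: "bdiag ?X (low_identity t e) @\<^sub>c 0\<^sub>m (s + t) (b - r - e) = S"
    using r e re by (intro eq_matI)
      (auto simp: S_def J_def bdiag_def append_cols_index append_rows_index)
  have Sdim [simp]: "dim_row S = s + t" "dim_col S = b"
    using r re by (simp_all add: S_def)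
  have "S * bdiag (1\<^sub>m r) G2 = (?X @\<^sub>c 0\<^sub>m s (b - r)) @\<^sub>r (0\<^sub>m t r @\<^sub>c (J * G2))"
    using r re by (simp add: S_def append_rows_mult append_cols_mult_bdiag)
  then have "Z * (S * bdiag (1\<^sub>m r) G2) = bdiag P (1\<^sub>m t) * (shear L *
      ((?X @\<^sub>c 0\<^sub>m s (b - r)) @\<^sub>r (0\<^sub>m t r @\<^sub>c W)))"
    using r re by (simp add: Z_def mult_assoc_dim bdiag_mult_append_rows mult_append_cols W_def)
  also have "\<dots> = (P * (?X @\<^sub>c 0\<^sub>m s (b - r))) @\<^sub>r (Fa @\<^sub>c W)"
    using r re by (simp add: shear_mult_append_rows bdiag_mult_append_rows mult_append_cols
        append_cols_add LX)
  finally have ZSG: "Z * (S * G) = (P * ((?X @\<^sub>c 0\<^sub>m s (b - r)) * G1)) @\<^sub>r ((Fa @\<^sub>c W) * G1)"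
    using r re by (simp add: G_def Z_def append_rows_mult flip: mult_assoc_dim)
  have "eps \<cdot>\<^sub>m ((Fa @\<^sub>c W) * G1) = eps \<cdot>\<^sub>m ((Cb * G1') * G1)"
    unfolding F using r re Fb_eq'
    by (intro eps_cong_mult(1)) (simp_all add: append_cols_smult flip: W_def)
  also have "(Cb * G1') * G1 = Cb"
    by (simp add: mult_assoc_dim)
  finally have bottom: "eps \<cdot>\<^sub>m ((Fa @\<^sub>c W) * G1) = eps \<cdot>\<^sub>m Cb" .
  have "eps \<cdot>\<^sub>m Ct = eps \<cdot>\<^sub>m (P * ((?X @\<^sub>c 0\<^sub>m s (b - r)) * G1))"
    using Ct_eq rect_diag_replicate_append_cols[of r b s] r by simp
  moreover have "eps \<cdot>\<^sub>m (Z * (S * G)) =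
      (eps \<cdot>\<^sub>m (P * ((?X @\<^sub>c 0\<^sub>m s (b - r)) * G1))) @\<^sub>r (eps \<cdot>\<^sub>m ((Fa @\<^sub>c W) * G1))"
    unfolding ZSG by (rule append_rows_smult) simp
  moreover have "eps \<cdot>\<^sub>m C = (eps \<cdot>\<^sub>m Ct) @\<^sub>r (eps \<cdot>\<^sub>m Cb)"
    unfolding CC by (rule append_rows_smult) simp
  ultimately have "eps \<cdot>\<^sub>m C = eps \<cdot>\<^sub>m (Z * (S * G))"
    by (simp only: bottom)
  then have "eps \<cdot>\<^sub>m C = eps \<cdot>\<^sub>m (Z *
      ((bdiag ?X (low_identity t e) @\<^sub>c 0\<^sub>m (s + t) (b - r - e)) * G))"
    by (simp only: S)
  moreover have "r \<le> s" "e \<le> t"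
    using r e by simp_all
  ultimately show ?thesis
    using that[OF _ _ re G Z] by blast
qed

text \<open>An infinitesimal error in the columns of \<open>(I, 0; 0, I)\<close> is removed by a transformation
  \<open>I + T\<epsilon>\<close>, because these columns have a left inverse. In the remaining columns only
  the standard part of the error matters, and a rank factorization replaces it by orthonormal
  columns.\<close>

lemma normal_form:
  assumes C: "C \<in> carrier_mat (s + t) b"
  obtains r e l G Z N where "r \<le> s" "e \<le> t" "r + e + l \<le> b" "invertible_of b G"
    "\<And>m. absorbs (eps_block s m t) Z" "N \<in> carrier_mat (s + t) l" "N\<^sup>\<dagger> * N = 1\<^sub>m l"
    "C = Z * ((bdiag (top_identity s r) (low_identity t e) @\<^sub>c
      ((eps \<cdot>\<^sub>m N) @\<^sub>c 0\<^sub>m (s + t) (b - r - e - l))) * G)"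
proof -
  obtain r e G0 Z0 where r: "r \<le> s" and e: "e \<le> t" and re: "r + e \<le> b" and G0: "invertible_of b G0"
    and Z0: "\<And>m. absorbs (eps_block s m t) Z0"
    and C_eq: "eps \<cdot>\<^sub>m C = eps \<cdot>\<^sub>m (Z0 *
      ((bdiag (top_identity s r) (low_identity t e) @\<^sub>c 0\<^sub>m (s + t) (b - r - e)) * G0))"
    by (rule normal_form_std[OF C]) (rule that)
  define S where "S = bdiag (top_identity s r) (low_identity t e)"
  have [simp]: "dim_row S = s + t" "dim_col S = r + e"
    by (simp_all add: S_def)
  have SS: "S\<^sup>\<dagger> * S = 1\<^sub>m (r + e)"
    using r e by (simp add: S_def bdiag_adjoint bdiag_mult top_identity_orthonormal
        low_identity_orthonormal bdiag_one)
  have invZ0: "invertible_of (s + t) Z0"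
    using Z0[of 0] by (simp add: absorbs_def)
  obtain Z0' where Z0': "dim_row Z0 = s + t" "dim_col Z0 = s + t" "dim_row Z0' = s + t" "dim_col Z0' = s + t"
    "Z0 * Z0' = 1\<^sub>m (s + t)"
    using invZ0 by (rule invertible_ofE)
  obtain G0' where G0': "dim_row G0 = b" "dim_col G0 = b" "dim_row G0' = b" "dim_col G0' = b"
    "G0' * G0 = 1\<^sub>m b"
    using G0 by (rule invertible_ofE)
  note [simp] = Z0' G0'
  have [simp]: "dim_row C = s + t" "dim_col C = b"
    using C by auto
  obtain Y where CY: "C = Z0 * ((S @\<^sub>c 0\<^sub>m (s + t) (b - r - e)) * G0) + eps \<cdot>\<^sub>m Y"
    and [simp]: "dim_row Y = s + t" "dim_col Y = b"
    using mat_cong_eps[OF C_eq] unfolding S_def[symmetric]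
    by (metis \<open>dim_row C = s + t\<close> \<open>dim_col C = b\<close>)
  have "Z0' * (Y * G0') \<in> carrier_mat (s + t) ((r + e) + (b - r - e))"
    using re by (intro carrier_matI) simp_all
  then obtain Ya Yb where Ya: "Ya \<in> carrier_mat (s + t) (r + e)" and Yb: "Yb \<in> carrier_mat (s + t) (b - r - e)"
    and Y: "Z0' * (Y * G0') = Ya @\<^sub>c Yb"
    by (rule split_cols)
  have [simp]: "dim_row Ya = s + t" "dim_col Ya = r + e" "dim_row Yb = s + t" "dim_col Yb = b - r - e"
    using Ya Yb by auto
  have "Y = Z0 * ((Z0' * (Y * G0')) * G0)"
    using invertible_cancel[OF Z0'(5), of "Y * (G0' * G0)"] by (simp add: mult_assoc_dim)
  then have YY: "Y = Z0 * ((Ya @\<^sub>c Yb) * G0)"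
    unfolding Y .
  \<comment> \<open>The error, now written between the two invertible factors.\<close>
  have C1: "C = Z0 * (((S @\<^sub>c 0\<^sub>m (s + t) (b - r - e)) + eps \<cdot>\<^sub>m (Ya @\<^sub>c Yb)) * G0)"
    using re by (subst CY, subst YY)
      (simp add: mult_add_dim smult_mult_left smult_mult_right_eps)
  obtain U l G1 where U: "unitary_of (s + t) U" and G1: "invertible_of (b - r - e) G1"
    and l: "l \<le> min (s + t) (b - r - e)"
    and Yb_eq: "eps \<cdot>\<^sub>m Yb = eps \<cdot>\<^sub>m (U * (rect_diag (s + t) (b - r - e) (replicate l 1) * G1))"
    by (rule rank_factorization_std[OF Yb])
  note [simp] = unitary_ofD[OF U]
  have [simp]: "dim_row G1 = b - r - e" "dim_col G1 = b - r - e"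
    using G1 by auto
  have rel: "r + e + l \<le> b"
    using l re by auto
  define N where "N = U * top_identity (s + t) l"
  have [simp]: "dim_row N = s + t" "dim_col N = l"
    by (simp_all add: N_def)
  have NN: "N\<^sup>\<dagger> * N = 1\<^sub>m l"
    using l by (simp add: N_def adjoint_mult mult_assoc_dim unitary_cancel[OF U] top_identity_orthonormal)
  have Yb': "eps \<cdot>\<^sub>m Yb = ((eps \<cdot>\<^sub>m N) @\<^sub>c 0\<^sub>m (s + t) (b - r - e - l)) * G1"
  proof -
    have le: "l \<le> b - r - e"
      using l by simp
    have "U * (rect_diag (s + t) (b - r - e) (replicate l 1) * G1) =
        (U * (top_identity (s + t) l @\<^sub>c 0\<^sub>m (s + t) (b - r - e - l))) * G1"
      unfolding rect_diag_replicate_append_cols[OF le] using le by (simp add: mult_assoc_dim)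
    also have "U * (top_identity (s + t) l @\<^sub>c 0\<^sub>m (s + t) (b - r - e - l)) =
        N @\<^sub>c 0\<^sub>m (s + t) (b - r - e - l)"
      by (simp add: mult_append_cols N_def)
    finally show ?thesis
      unfolding Yb_eq using le by (simp add: append_cols_smult flip: smult_mult_left)
  qed
  define T where "T = Ya * S\<^sup>\<dagger>"
  have [simp]: "dim_row T = s + t" "dim_col T = s + t"
    by (simp_all add: T_def)
  have TS: "T * S = Ya"
    by (simp add: T_def mult_assoc_dim SS)
  have "(1\<^sub>m (s + t) + eps \<cdot>\<^sub>m T) * S = S + eps \<cdot>\<^sub>m Ya"
    by (simp add: mult_add_dim smult_mult_left TS)
  moreover have "(1\<^sub>m (s + t) + eps \<cdot>\<^sub>m T) * (eps \<cdot>\<^sub>m Yb) = eps \<cdot>\<^sub>m Yb"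
    by (simp add: mult_add_dim smult_mult_left smult_mult_right_eps)
      (rule eq_matI; simp add: dual_num_eq_iff)
  moreover have "(S @\<^sub>c 0\<^sub>m (s + t) (b - r - e)) + eps \<cdot>\<^sub>m (Ya @\<^sub>c Yb) = (S + eps \<cdot>\<^sub>m Ya) @\<^sub>c (eps \<cdot>\<^sub>m Yb)"
    by (simp add: append_cols_smult append_cols_add)
  ultimately have "(S @\<^sub>c 0\<^sub>m (s + t) (b - r - e)) + eps \<cdot>\<^sub>m (Ya @\<^sub>c Yb) =
      (1\<^sub>m (s + t) + eps \<cdot>\<^sub>m T) * (S @\<^sub>c (eps \<cdot>\<^sub>m Yb))"
    by (subst mult_append_cols) simp_all
  also have "S @\<^sub>c (eps \<cdot>\<^sub>m Yb) =
      (S @\<^sub>c ((eps \<cdot>\<^sub>m N) @\<^sub>c 0\<^sub>m (s + t) (b - r - e - l))) * bdiag (1\<^sub>m (r + e)) G1"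
    using rel by (simp add: append_cols_mult_bdiag Yb')
  finally have C2: "C = (Z0 * (1\<^sub>m (s + t) + eps \<cdot>\<^sub>m T)) *
      ((S @\<^sub>c ((eps \<cdot>\<^sub>m N) @\<^sub>c 0\<^sub>m (s + t) (b - r - e - l))) * (bdiag (1\<^sub>m (r + e)) G1 * G0))"
    using rel by (simp add: C1 mult_assoc_dim)
  have "invertible_of b (bdiag (1\<^sub>m (r + e)) G1 * G0)"
    using invertible_of_mult[OF _ G0] invertible_bdiag[OF invertible_one[of "r + e"] G1] re by simp
  moreover have "absorbs (eps_block s m t) (Z0 * (1\<^sub>m (s + t) + eps \<cdot>\<^sub>m T))" for m
    by (intro absorbs_mult Z0 absorbs_eps_block_one_plus_eps) simp_all
  moreover have "N \<in> carrier_mat (s + t) l"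
    by (intro carrier_matI) simp_all
  ultimately show ?thesis
    using that[OF r e rel _ _ _ NN] C2 unfolding S_def by blast
qed


section \<open>The decomposition of the pair\<close>

lemma mat_diag_dims [simp]: "dim_row (mat_diag n f) = n" "dim_col (mat_diag n f) = n"
  by (simp_all add: mat_diag_def)

lemma D_A_eq:
  assumes "r\<^sub>1 + r\<^sub>2 \<le> min m n"
  shows "D_A m n r\<^sub>1 r\<^sub>2 = bdiag (1\<^sub>m r\<^sub>1) (eps_block r\<^sub>2 (m - r\<^sub>1 - r\<^sub>2) (n - r\<^sub>1 - r\<^sub>2))"
  using assms
  by (intro eq_matI)
    (auto simp: D_A_def Let_def bdiag_def eps_block_def append_rows_index append_cols_index)

lemma rect_diag_one_eps:
  assumes "r\<^sub>1 + r\<^sub>2 \<le> min m n"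
  shows "rect_diag m n (replicate r\<^sub>1 1 @ replicate r\<^sub>2 eps) =
    bdiag (1\<^sub>m r\<^sub>1) (eps_block r\<^sub>2 (m - r\<^sub>1 - r\<^sub>2) (n - r\<^sub>1 - r\<^sub>2))"
  using assms
  by (intro eq_matI) (auto simp: rect_diag_def bdiag_def eps_block_def nth_append)

text \<open>For \<open>rhat = q = t = 0\<close> all diagonal blocks with free entries are empty, and what remains of
  \<open>\<Sigma>\<^sub>1\<close> and \<open>\<Sigma>\<^sub>2\<close> are the two identity blocks of the normal form.\<close>

lemma Sigma_stack:
  assumes "r \<le> s" "e \<le> t"
  shows "Sigma1 s (r + e) r 0 0 c \<xi> @\<^sub>r Sigma2 t (r + e) r 0 0 0 \<sigma> d =
    bdiag (top_identity s r) (low_identity t e)"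
proof (rule eq_matI)
  fix i j
  assume "i < dim_row (bdiag (top_identity s r) (low_identity t e))"
    "j < dim_col (bdiag (top_identity s r) (low_identity t e))"
  then have ij: "i < s + t" "j < r + e"
    by simp_all
  have S1: "Sigma1 s (r + e) r 0 0 c \<xi> $$ (i,j) = (if i < r \<and> i = j then 1 else 0)" if "i < s"
    using that ij assms by (auto simp: Sigma1_def Let_def append_rows_index append_cols_index)
  have S2: "Sigma2 t (r + e) r 0 0 0 \<sigma> d $$ (i - s,j) = (if j \<ge> r \<and> i - s = t - e + (j - r) then 1 else 0)"
    if "\<not> i < s"
    using that ij assms by (auto simp: Sigma2_def Let_def append_rows_index append_cols_index)
  show "(Sigma1 s (r + e) r 0 0 c \<xi> @\<^sub>r Sigma2 t (r + e) r 0 0 0 \<sigma> d) $$ (i,j) =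
      bdiag (top_identity s r) (low_identity t e) $$ (i,j)"
    using ij assms S1 S2
    by (auto simp: Sigma1_def[of _ "r + e"] Sigma2_def[of _ "r + e"] Let_def append_rows_index
        bdiag_def rect_diag_def low_identity_def)
qed (use assms in \<open>simp_all add: Sigma1_def Sigma2_def Let_def\<close>)

lemma Sigma_dims [simp]:
  "r \<le> s \<Longrightarrow> dim_row (Sigma1 s (r + e) r 0 0 c \<xi>) = s" "dim_col (Sigma1 s (r + e) r 0 0 c \<xi>) = r + e"
  "e \<le> t \<Longrightarrow> dim_row (Sigma2 t (r + e) r 0 0 0 \<sigma> d) = t" "dim_col (Sigma2 t (r + e) r 0 0 0 \<sigma> d) = r + e"
  by (simp_all add: Sigma1_def Sigma2_def Let_def)

lemma bdiag_eq_append: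
  "bdiag A B = (A @\<^sub>c 0\<^sub>m (dim_row A) (dim_col B)) @\<^sub>r (0\<^sub>m (dim_row B) (dim_col A) @\<^sub>c B)"
  by (rule eq_matI) (simp_all add: bdiag_def append_rows_index append_cols_index)

lemma append_rows_assoc:
  "dim_col A = dim_col B \<Longrightarrow> dim_col B = dim_col C \<Longrightarrow> (A @\<^sub>r B) @\<^sub>r C = A @\<^sub>r B @\<^sub>r (C :: dquat mat)"
  by (rule eq_matI; (simp; fail)?) (auto simp: append_rows_index)

text \<open>The factor \<open>G\<^sup>-\<^sup>1\<close> in the second block row of \<open>D\<^sub>B\<close> is there to cancel the factor \<open>G\<close> of \<open>Y\<close>. In
  \<open>D\<^sub>B diag (I, G)\<close> the first two block rows together are therefore a singular value
  matrix, cut between the appreciable and the infinitesimal values, and \<open>G\<close> acts on the last block row only.\<close>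

lemma D_B_mult_bdiag:
  assumes len: "length ds = r\<^sub>1\<^sub>1 + r\<^sub>1\<^sub>2" "r\<^sub>1\<^sub>1 + r\<^sub>1\<^sub>2 \<le> min r\<^sub>1 p"
    and inf: "\<And>i. i < r\<^sub>1\<^sub>2 \<Longrightarrow> std_part (ds ! (r\<^sub>1\<^sub>1 + i)) = 0"
    and G: "invertible_of (p - r\<^sub>1\<^sub>1) G"
    and S: "dim_row (S2 @\<^sub>r S3) = n - r\<^sub>1" "dim_col S2 = p - r\<^sub>1\<^sub>1" "dim_col S3 = p - r\<^sub>1\<^sub>1"
  shows "D_B n p r\<^sub>1 r\<^sub>1\<^sub>1 r\<^sub>1\<^sub>2 (\<lambda>i. ds ! i) (\<lambda>i. inf_part (ds ! (r\<^sub>1\<^sub>1 + i))) G S2 S3 * bdiag (1\<^sub>m r\<^sub>1\<^sub>1) G =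
    rect_diag r\<^sub>1 p ds @\<^sub>r (0\<^sub>m (n - r\<^sub>1) r\<^sub>1\<^sub>1 @\<^sub>c ((S2 @\<^sub>r S3) * G))"
    and "dim_row (D_B n p r\<^sub>1 r\<^sub>1\<^sub>1 r\<^sub>1\<^sub>2 (\<lambda>i. ds ! i) (\<lambda>i. inf_part (ds ! (r\<^sub>1\<^sub>1 + i))) G S2 S3) = r\<^sub>1 + (n - r\<^sub>1)"
    and "dim_col (D_B n p r\<^sub>1 r\<^sub>1\<^sub>1 r\<^sub>1\<^sub>2 (\<lambda>i. ds ! i) (\<lambda>i. inf_part (ds ! (r\<^sub>1\<^sub>1 + i))) G S2 S3) = p"
proof -
  obtain G' where G': "dim_row G = p - r\<^sub>1\<^sub>1" "dim_col G = p - r\<^sub>1\<^sub>1" "dim_row G' = p - r\<^sub>1\<^sub>1" "dim_col G' = p - r\<^sub>1\<^sub>1"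
    "G * G' = 1\<^sub>m (p - r\<^sub>1\<^sub>1)" "G' * G = 1\<^sub>m (p - r\<^sub>1\<^sub>1)" "mat_inv G = G'"
    using G by (rule invertible_ofE)
  note [simp] = G'
  define a where "a = r\<^sub>1 - r\<^sub>1\<^sub>1"
  define b where "b = p - r\<^sub>1\<^sub>1"
  have ab: "r\<^sub>1 = r\<^sub>1\<^sub>1 + a" "p = r\<^sub>1\<^sub>1 + b" "r\<^sub>1\<^sub>2 \<le> a" "r\<^sub>1\<^sub>2 \<le> b"
    using len by (auto simp: a_def b_def)
  define \<Delta> where "\<Delta> = mat_diag r\<^sub>1\<^sub>1 (\<lambda>i. dq_of_dual (ds ! i))"
  define M where "M = rect_diag a b (drop r\<^sub>1\<^sub>1 ds)"
  have [simp]: "dim_row \<Delta> = r\<^sub>1\<^sub>1" "dim_col \<Delta> = r\<^sub>1\<^sub>1" "dim_row M = a" "dim_col M = b"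
    by (simp_all add: \<Delta>_def M_def)
  have "four_block_mat (eps \<cdot>\<^sub>m mat_diag r\<^sub>1\<^sub>2 (\<lambda>i. of_real (inf_part (ds ! (r\<^sub>1\<^sub>1 + i))))) (0\<^sub>m r\<^sub>1\<^sub>2 (b - r\<^sub>1\<^sub>2))
      (0\<^sub>m (a - r\<^sub>1\<^sub>2) r\<^sub>1\<^sub>2) (0\<^sub>m (a - r\<^sub>1\<^sub>2) (b - r\<^sub>1\<^sub>2)) = M"
    using ab(3,4) len(1)
    by (intro eq_matI)
      (auto simp: M_def rect_diag_def mat_diag_def dual_num_eq_iff inf)
  then have DB: "D_B n p r\<^sub>1 r\<^sub>1\<^sub>1 r\<^sub>1\<^sub>2 (\<lambda>i. ds ! i) (\<lambda>i. inf_part (ds ! (r\<^sub>1\<^sub>1 + i))) G S2 S3 =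
      (\<Delta> @\<^sub>c 0\<^sub>m r\<^sub>1\<^sub>1 b) @\<^sub>r (0\<^sub>m a r\<^sub>1\<^sub>1 @\<^sub>c (M * G')) @\<^sub>r (0\<^sub>m (n - r\<^sub>1) r\<^sub>1\<^sub>1 @\<^sub>c (S2 @\<^sub>r S3))"
    by (simp add: D_B_def Let_def \<Delta>_def flip: a_def b_def)
  show "dim_row (D_B n p r\<^sub>1 r\<^sub>1\<^sub>1 r\<^sub>1\<^sub>2 (\<lambda>i. ds ! i) (\<lambda>i. inf_part (ds ! (r\<^sub>1\<^sub>1 + i))) G S2 S3) = r\<^sub>1 + (n - r\<^sub>1)"
    "dim_col (D_B n p r\<^sub>1 r\<^sub>1\<^sub>1 r\<^sub>1\<^sub>2 (\<lambda>i. ds ! i) (\<lambda>i. inf_part (ds ! (r\<^sub>1\<^sub>1 + i))) G S2 S3) = p"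
    unfolding DB using ab(1,2) by simp_all
  have [simp]: "dim_row S2 + dim_row S3 = n - r\<^sub>1" "dim_col S2 = b" "dim_col S3 = b"
    "dim_row G = b" "dim_col G = b" "dim_row G' = b" "dim_col G' = b"
    using S by (simp_all add: b_def)
  have GG: "G' * G = 1\<^sub>m b"
    using G'(6) by (simp add: b_def)
  have "rect_diag r\<^sub>1 p ds = bdiag \<Delta> M"
    unfolding ab(1,2) M_def \<Delta>_def by (rule rect_diag_split) (simp add: len)
  then have "rect_diag r\<^sub>1 p ds = (\<Delta> @\<^sub>c 0\<^sub>m r\<^sub>1\<^sub>1 b) @\<^sub>r (0\<^sub>m a r\<^sub>1\<^sub>1 @\<^sub>c M)"
    by (simp add: bdiag_eq_append)
  then show "D_B n p r\<^sub>1 r\<^sub>1\<^sub>1 r\<^sub>1\<^sub>2 (\<lambda>i. ds ! i) (\<lambda>i. inf_part (ds ! (r\<^sub>1\<^sub>1 + i))) G S2 S3 * bdiag (1\<^sub>m r\<^sub>1\<^sub>1) G =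
      rect_diag r\<^sub>1 p ds @\<^sub>r (0\<^sub>m (n - r\<^sub>1) r\<^sub>1\<^sub>1 @\<^sub>c ((S2 @\<^sub>r S3) * G))"
    by (simp add: DB append_rows_mult append_cols_mult_bdiag mult_assoc_dim GG append_rows_assoc
        del: G')
qed

theorem theorem4p3:
  fixes A B :: "dquat mat" and m n p r\<^sub>1 r\<^sub>2 :: nat
  assumes "A \<in> carrier_mat m n" and "B \<in> carrier_mat n p"
    and "r\<^sub>1 = dq_Arank A" and "r\<^sub>1 + r\<^sub>2 = dq_rank A"
  shows "r\<^sub>1 + r\<^sub>2 \<le> min m n \<and>
    (\<exists>U X Y. U \<in> carrier_mat m m \<and> unitary_mat U \<and>
      X \<in> carrier_mat n n \<and> invertible_mat X \<and>
      Y \<in> carrier_mat p p \<and> invertible_mat Y \<and>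
      A = U * D_A m n r\<^sub>1 r\<^sub>2 * mat_inv X \<and>
      (\<exists>(r\<^sub>1\<^sub>1::nat) (r\<^sub>1\<^sub>2::nat) (d :: nat \<Rightarrow> real dual_num) (\<mu> :: nat \<Rightarrow> real) G W
        (k::nat) (l::nat) (r::nat) (rhat::nat) (q::nat) (t::nat)
        (\<sigma> :: nat \<Rightarrow> real) (\<xi> :: nat \<Rightarrow> real)
        (c :: nat \<Rightarrow> real dual_num) (s :: nat \<Rightarrow> real dual_num) N\<^sub>1 N\<^sub>2.
        r\<^sub>1\<^sub>1 + r\<^sub>1\<^sub>2 \<le> min r\<^sub>1 p \<and>
        G \<in> carrier_mat (p - r\<^sub>1\<^sub>1) (p - r\<^sub>1\<^sub>1) \<and> invertible_mat G \<and>
        W \<in> carrier_mat p p \<and> unitary_mat W \<and>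
        Y = four_block_mat (1\<^sub>m r\<^sub>1\<^sub>1) (0\<^sub>m r\<^sub>1\<^sub>1 (p - r\<^sub>1\<^sub>1)) (0\<^sub>m (p - r\<^sub>1\<^sub>1) r\<^sub>1\<^sub>1) G * conj_transpose W \<and>
        decreasing_upto r\<^sub>1\<^sub>1 d \<and> (\<forall>i<r\<^sub>1\<^sub>1. appreciable (d i) \<and> 0 < d i) \<and>
        decreasing_upto r\<^sub>1\<^sub>2 \<mu> \<and> (\<forall>i<r\<^sub>1\<^sub>2. 0 < \<mu> i) \<and>
        k + l \<le> p - r\<^sub>1\<^sub>1 \<and> rhat \<le> r \<and> r + q + t \<le> k \<and> r + q + t \<le> r\<^sub>2 \<and>
        k + rhat \<le> (n - r\<^sub>1 - r\<^sub>2) + r \<and>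
        N\<^sub>1 \<in> carrier_mat r\<^sub>2 l \<and> N\<^sub>2 \<in> carrier_mat (n - r\<^sub>1 - r\<^sub>2) l \<and> orthonormal_cols (N\<^sub>1 @\<^sub>r N\<^sub>2) \<and>
        decreasing_upto rhat \<sigma> \<and> (\<forall>i<rhat. 0 < \<sigma> i) \<and>
        decreasing_upto t \<xi> \<and> (\<forall>i<t. 0 < \<xi> i) \<and>
        increasing_upto q c \<and> (\<forall>i<q. appreciable (c i) \<and> 0 < c i \<and> c i < 1) \<and>
        decreasing_upto q s \<and> (\<forall>i<q. appreciable (s i) \<and> 0 < s i \<and> s i < 1) \<and>
        (\<forall>i<q. (c i)\<^sup>2 + (s i)\<^sup>2 = 1) \<and>
        B = X * D_B n p r\<^sub>1 r\<^sub>1\<^sub>1 r\<^sub>1\<^sub>2 d \<mu> G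
              (Sigma1 r\<^sub>2 k r q t c \<xi> @\<^sub>c (eps \<cdot>\<^sub>m N\<^sub>1) @\<^sub>c 0\<^sub>m r\<^sub>2 (p - r\<^sub>1\<^sub>1 - k - l))
              (Sigma2 (n - r\<^sub>1 - r\<^sub>2) k r rhat q t \<sigma> s @\<^sub>c (eps \<cdot>\<^sub>m N\<^sub>2)
                @\<^sub>c 0\<^sub>m (n - r\<^sub>1 - r\<^sub>2) (p - r\<^sub>1\<^sub>1 - k - l))
            * Y))"
proof -
  note A = assms(1) and B = assms(2)
  have [simp]: "dim_row A = m" "dim_col A = n" "dim_row B = n" "dim_col B = p"
    using A B by auto
  obtain U R where U: "unitary_of m U" and R: "invertible_of n R"
    and "dq_Arank A \<le> dq_rank A" and rank: "dq_rank A \<le> min m n"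
    and AUR: "A = U * (rect_diag m n (replicate (dq_Arank A) 1 @ replicate (dq_rank A - dq_Arank A) eps) * R)"
    by (rule rank_factorization[OF A])
  have r12: "r\<^sub>1 + r\<^sub>2 \<le> min m n" and r2: "dq_rank A - dq_Arank A = r\<^sub>2"
    using rank assms(3,4) by simp_all
  define n' where "n' = n - r\<^sub>1 - r\<^sub>2"
  define E where "E = eps_block r\<^sub>2 (m - r\<^sub>1 - r\<^sub>2) n'"
  define D where "D = bdiag (1\<^sub>m r\<^sub>1) E"
  have n: "n = r\<^sub>1 + (r\<^sub>2 + n')" and m: "m = r\<^sub>1 + (r\<^sub>2 + (m - r\<^sub>1 - r\<^sub>2))"
    using r12 by (auto simp: n'_def)
  have D_A: "D_A m n r\<^sub>1 r\<^sub>2 = D"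
    using D_A_eq[OF r12] by (simp add: D_def E_def n'_def)
  have Edim [simp]: "dim_row E = r\<^sub>2 + (m - r\<^sub>1 - r\<^sub>2)" "dim_col E = r\<^sub>2 + n'"
    by (simp_all add: E_def)
  have Ddim [simp]: "dim_row D = m" "dim_col D = n"
    using n m by (simp_all add: D_def)
  have AUDR: "A = U * (D * R)"
    using AUR unfolding r2 unfolding assms(3)[symmetric] rect_diag_one_eps[OF r12] D_def E_def n'_def .
  obtain R' where R': "dim_row R = n" "dim_col R = n" "dim_row R' = n" "dim_col R' = n"
    "R * R' = 1\<^sub>m n" "R' * R = 1\<^sub>m n"
    using R by (rule invertible_ofE)
  note [simp] = unitary_ofD[OF U] R'
  \<comment> \<open>The rows of \<open>R B\<close> that face the identity block of \<open>D\<close> may be multiplied by unitary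
    matrices only, hence a singular value decomposition there.\<close>
  have "R * B \<in> carrier_mat (r\<^sub>1 + (r\<^sub>2 + n')) p"
    using n by (intro carrier_matI) simp_all
  then obtain B1 B2 where B1: "B1 \<in> carrier_mat r\<^sub>1 p" and B2: "B2 \<in> carrier_mat (r\<^sub>2 + n') p"
    and RB: "R * B = B1 @\<^sub>r B2"
    by (rule split_rows)
  have [simp]: "dim_row B1 = r\<^sub>1" "dim_col B1 = p" "dim_row B2 = r\<^sub>2 + n'" "dim_col B2 = p"
    using B1 B2 by auto
  obtain ds P1 W where ds_len: "length ds \<le> min r\<^sub>1 p" and ds_sorted: "sorted_wrt (\<ge>) ds"
    and ds_pos: "\<forall>\<mu>\<in>set ds. \<mu> > 0" and P1: "unitary_of r\<^sub>1 P1" and W: "unitary_of p W"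
    and B1W: "B1 * W = P1 * rect_diag r\<^sub>1 p ds"
    by (rule singular_valuesE[OF B1])
  note [simp] = unitary_ofD[OF P1] unitary_ofD[OF W]
  define r\<^sub>1\<^sub>1 where "r\<^sub>1\<^sub>1 = length (filter appreciable ds)"
  define r\<^sub>1\<^sub>2 where "r\<^sub>1\<^sub>2 = length ds - r\<^sub>1\<^sub>1"
  have r11_le: "r\<^sub>1\<^sub>1 \<le> length ds"
    by (simp add: r\<^sub>1\<^sub>1_def)
  then have ds_split: "length ds = r\<^sub>1\<^sub>1 + r\<^sub>1\<^sub>2"
    by (simp add: r\<^sub>1\<^sub>2_def)
  have r1112: "r\<^sub>1\<^sub>1 + r\<^sub>1\<^sub>2 \<le> min r\<^sub>1 p"
    using ds_len ds_split by simp
  have app: "appreciable (ds ! i) \<longleftrightarrow> i < r\<^sub>1\<^sub>1" if "i < length ds" for i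
    using appreciable_prefix[OF ds_sorted ds_pos that] by (simp add: r\<^sub>1\<^sub>1_def)
  have ds_nth: "ds ! j \<le> ds ! i" if "i \<le> j" "j < length ds" for i j
    using that ds_sorted by (cases "i = j") (auto simp: sorted_wrt_iff_nth_less)
  have ds_nth_pos: "ds ! i > 0" if "i < length ds" for i
    using that ds_pos by simp
  have inf0: "std_part (ds ! (r\<^sub>1\<^sub>1 + i)) = 0" if "i < r\<^sub>1\<^sub>2" for i
    using app[of "r\<^sub>1\<^sub>1 + i"] that ds_split by (simp add: appreciable_def)
  define b where "b = p - r\<^sub>1\<^sub>1"
  have p: "p = r\<^sub>1\<^sub>1 + b" and r1: "r\<^sub>1 = r\<^sub>1\<^sub>1 + (r\<^sub>1 - r\<^sub>1\<^sub>1)"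
    using r1112 by (simp_all add: b_def)
  define \<Delta> where "\<Delta> = mat_diag r\<^sub>1\<^sub>1 (\<lambda>i. dq_of_dual (ds ! i))"
  define M where "M = rect_diag (r\<^sub>1 - r\<^sub>1\<^sub>1) b (drop r\<^sub>1\<^sub>1 ds)"
  define T where "T = rect_diag r\<^sub>1 p ds"
  have "rect_diag (r\<^sub>1\<^sub>1 + (r\<^sub>1 - r\<^sub>1\<^sub>1)) (r\<^sub>1\<^sub>1 + b) ds = bdiag \<Delta> M"
    unfolding M_def \<Delta>_def by (rule rect_diag_split[OF r11_le])
  then have T: "T = bdiag \<Delta> M"
    using p r1 by (simp add: T_def)
  have \<Delta>: "invertible_of r\<^sub>1\<^sub>1 \<Delta>"
    unfolding \<Delta>_def
  proof (rule invertible_mat_diag)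
    fix i assume "i < r\<^sub>1\<^sub>1"
    then show "std_part (dq_of_dual (ds ! i)) \<noteq> 0"
      using app[of i] r11_le by (simp add: appreciable_def)
  qed
  obtain \<Delta>' where \<Delta>': "dim_row \<Delta> = r\<^sub>1\<^sub>1" "dim_col \<Delta> = r\<^sub>1\<^sub>1" "dim_row \<Delta>' = r\<^sub>1\<^sub>1" "dim_col \<Delta>' = r\<^sub>1\<^sub>1"
    "\<Delta>' * \<Delta> = 1\<^sub>m r\<^sub>1\<^sub>1"
    using \<Delta> by (rule invertible_ofE)
  note [simp] = \<Delta>'
  have [simp]: "dim_row M = r\<^sub>1 - r\<^sub>1\<^sub>1" "dim_col M = b" "dim_row T = r\<^sub>1" "dim_col T = p"
    by (simp_all add: M_def T_def)
  have "B2 * W \<in> carrier_mat (r\<^sub>2 + n') (r\<^sub>1\<^sub>1 + b)"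
    using p by (intro carrier_matI) simp_all
  then obtain C1 C2 where C1: "C1 \<in> carrier_mat (r\<^sub>2 + n') r\<^sub>1\<^sub>1" and C2: "C2 \<in> carrier_mat (r\<^sub>2 + n') b"
    and B2W: "B2 * W = C1 @\<^sub>c C2"
    by (rule split_cols)
  have [simp]: "dim_row C1 = r\<^sub>2 + n'" "dim_col C1 = r\<^sub>1\<^sub>1" "dim_row C2 = r\<^sub>2 + n'" "dim_col C2 = b"
    using C1 C2 by auto
  \<comment> \<open>\<open>- K\<close> clears the columns below the appreciable singular values.\<close>
  define K where "K = (C1 * \<Delta>') @\<^sub>c 0\<^sub>m (r\<^sub>2 + n') (r\<^sub>1 - r\<^sub>1\<^sub>1)"
  have Kdim [simp]: "dim_row K = r\<^sub>2 + n'" "dim_col K = r\<^sub>1"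
    using r1 by (simp_all add: K_def)
  have KT: "K * T = C1 @\<^sub>c 0\<^sub>m (r\<^sub>2 + n') b"
    by (simp add: K_def T append_cols_mult_bdiag mult_assoc_dim)
  \<comment> \<open>The remaining columns of the lower rows are brought to normal form.\<close>
  obtain r e l G Z' N where re: "r \<le> r\<^sub>2" "e \<le> n'" "r + e + l \<le> b" and G: "invertible_of b G"
    and Z': "\<And>m. absorbs (eps_block r\<^sub>2 m n') Z'" and N: "N \<in> carrier_mat (r\<^sub>2 + n') l" "N\<^sup>\<dagger> * N = 1\<^sub>m l"
    and C2_eq: "C2 = Z' * ((bdiag (top_identity r\<^sub>2 r) (low_identity n' e) @\<^sub>c
      ((eps \<cdot>\<^sub>m N) @\<^sub>c 0\<^sub>m (r\<^sub>2 + n') (b - r - e - l))) * G)"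
    by (rule normal_form[OF C2]) (rule that)
  obtain N\<^sub>1 N\<^sub>2 where N1: "N\<^sub>1 \<in> carrier_mat r\<^sub>2 l" and N2: "N\<^sub>2 \<in> carrier_mat n' l" and NN: "N = N\<^sub>1 @\<^sub>r N\<^sub>2"
    using split_rows[OF N(1)] by blast
  have [simp]: "dim_row N\<^sub>1 = r\<^sub>2" "dim_col N\<^sub>1 = l" "dim_row N\<^sub>2 = n'" "dim_col N\<^sub>2 = l"
    using N1 N2 by auto
  define k where "k = r + e"
  define S2 where "S2 = Sigma1 r\<^sub>2 k r 0 0 (\<lambda>_. 0) (\<lambda>_. 0) @\<^sub>c (eps \<cdot>\<^sub>m N\<^sub>1) @\<^sub>c 0\<^sub>m r\<^sub>2 (p - r\<^sub>1\<^sub>1 - k - l)"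
  define S3 where "S3 = Sigma2 n' k r 0 0 0 (\<lambda>_. 0) (\<lambda>_. 0) @\<^sub>c (eps \<cdot>\<^sub>m N\<^sub>2) @\<^sub>c 0\<^sub>m n' (p - r\<^sub>1\<^sub>1 - k - l)"
  have zero: "0\<^sub>m r\<^sub>2 z @\<^sub>r 0\<^sub>m n' z = (0\<^sub>m (r\<^sub>2 + n') z :: dquat mat)" for z
    by (rule eq_matI) (simp_all add: append_rows_index)
  have S23: "S2 @\<^sub>r S3 = bdiag (top_identity r\<^sub>2 r) (low_identity n' e) @\<^sub>c
      ((eps \<cdot>\<^sub>m N) @\<^sub>c 0\<^sub>m (r\<^sub>2 + n') (b - r - e - l))"
    using re by (simp add: S2_def S3_def k_def b_def NN append_rows_smult zero add.assoc
        flip: append_rows_cols Sigma_stack[of r r\<^sub>2 e n' "\<lambda>_. 0" "\<lambda>_. 0" "\<lambda>_. 0" "\<lambda>_. 0"])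
  have [simp]: "dim_row S2 = r\<^sub>2" "dim_row S3 = n'" "dim_col S2 = b" "dim_col S3 = b"
    using re by (simp_all add: S2_def S3_def k_def b_def)
  have C2_eq': "Z' * ((S2 @\<^sub>r S3) * G) = C2"
    unfolding S23 by (rule C2_eq[symmetric])
  define Z where "Z = bdiag P1 (1\<^sub>m (r\<^sub>2 + n')) * (shear K * bdiag (1\<^sub>m r\<^sub>1) Z')"
  have Z'E: "absorbs E Z'"
    unfolding E_def by (rule Z')
  have "absorbs D Z"
    unfolding D_def Z_def
  proof (intro absorbs_mult)
    show "absorbs (bdiag (1\<^sub>m r\<^sub>1) E) (bdiag P1 (1\<^sub>m (r\<^sub>2 + n')))"
      using absorbs_bdiag_left[OF P1, of E] by simp
    show "absorbs (bdiag (1\<^sub>m r\<^sub>1) E) (shear K)"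
      unfolding E_def by (intro absorbs_shear carrier_matI) simp_all
    show "absorbs (bdiag (1\<^sub>m r\<^sub>1) E) (bdiag (1\<^sub>m r\<^sub>1) Z')"
      by (rule absorbs_bdiag_right[OF Z'E])
  qed
  then obtain P where P: "unitary_of m P" and DZ: "D * Z = P * D" and Z: "invertible_of n Z"
    unfolding absorbs_def by auto
  obtain Zi where Zi: "dim_row Z = n" "dim_col Z = n" "dim_row Zi = n" "dim_col Zi = n"
    "Z * Zi = 1\<^sub>m n" "Zi * Z = 1\<^sub>m n"
    using Z by (rule invertible_ofE)
  note [simp] = unitary_ofD[OF P] Zi
  have Z'dim: "dim_row Z' = r\<^sub>2 + n'" "dim_col Z' = r\<^sub>2 + n'"
    using Z'E by (auto simp: absorbs_def)
  define DB where "DB = D_B n p r\<^sub>1 r\<^sub>1\<^sub>1 r\<^sub>1\<^sub>2 (\<lambda>i. ds ! i) (\<lambda>i. inf_part (ds ! (r\<^sub>1\<^sub>1 + i))) G S2 S3"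
  have Gp: "invertible_of (p - r\<^sub>1\<^sub>1) G"
    using G by (simp add: b_def)
  have Gdim [simp]: "dim_row G = b" "dim_col G = b"
    using G by auto
  have S_dims: "dim_row (S2 @\<^sub>r S3) = n - r\<^sub>1" "dim_col S2 = p - r\<^sub>1\<^sub>1" "dim_col S3 = p - r\<^sub>1\<^sub>1"
    using n by (simp_all add: b_def)
  note DB_facts = D_B_mult_bdiag[OF ds_split r1112 inf0 Gp S_dims, folded DB_def]
  have nr: "n - r\<^sub>1 = r\<^sub>2 + n'"
    using n by simp
  have DBG: "DB * bdiag (1\<^sub>m r\<^sub>1\<^sub>1) G = T @\<^sub>r (0\<^sub>m (r\<^sub>2 + n') r\<^sub>1\<^sub>1 @\<^sub>c ((S2 @\<^sub>r S3) * G))"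
    using DB_facts(1) by (simp add: T_def nr)
  have [simp]: "dim_row DB = n" "dim_col DB = p"
    using DB_facts(2,3) n by simp_all
  \<comment> \<open>The row operations, undone one after the other, lead from the normal form back to \<open>R B W\<close>.\<close>
  have "Z * (DB * bdiag (1\<^sub>m r\<^sub>1\<^sub>1) G) =
      bdiag P1 (1\<^sub>m (r\<^sub>2 + n')) * (shear K * (T @\<^sub>r (0\<^sub>m (r\<^sub>2 + n') r\<^sub>1\<^sub>1 @\<^sub>c C2)))"
    using p by (simp add: Z_def DBG mult_assoc_dim Z'dim bdiag_mult_append_rows mult_append_cols C2_eq')
  also have "\<dots> = (P1 * T) @\<^sub>r (C1 @\<^sub>c C2)"
    using p by (simp add: shear_mult_append_rows bdiag_mult_append_rows KT append_cols_add)
  also have "\<dots> = (R * B) * W"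
    by (simp add: RB append_rows_mult B2W B1W T_def)
  finally have ZDB: "Z * (DB * bdiag (1\<^sub>m r\<^sub>1\<^sub>1) G) = R * (B * W)"
    by (simp add: mult_assoc_dim)
  define X where "X = R' * Z"
  define Y where "Y = four_block_mat (1\<^sub>m r\<^sub>1\<^sub>1) (0\<^sub>m r\<^sub>1\<^sub>1 (p - r\<^sub>1\<^sub>1)) (0\<^sub>m (p - r\<^sub>1\<^sub>1) r\<^sub>1\<^sub>1) G * W\<^sup>\<dagger>"
  have Y: "Y = bdiag (1\<^sub>m r\<^sub>1\<^sub>1) G * W\<^sup>\<dagger>"
    by (simp add: Y_def bdiag_def b_def)
  have R'_inv: "invertible_of n R'"
    by (rule invertible_ofI[of _ _ R]) simp_all
  have X_inv: "invertible_of n X"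
    unfolding X_def by (rule invertible_of_mult[OF R'_inv Z])
  have Y_inv: "invertible_of p Y"
    unfolding Y using invertible_of_mult[OF _ unitary_invertible[OF unitary_adjoint[OF W]]]
      invertible_bdiag[OF invertible_one[of r\<^sub>1\<^sub>1] G] p by simp
  have "mat_inv X = Zi * R"
  proof (rule mat_inv_eqI)
    show "X \<in> carrier_mat n n"
      using X_inv by blast
    show "inverts_mat X (Zi * R)" "inverts_mat (Zi * R) X"
      by (simp_all add: inverts_mat_def X_def mult_assoc_dim invertible_cancel[of Z Zi n]
          invertible_cancel[of R R' n])
  qed
  moreover have "A = (U * P) * D * (Zi * R)"
  proof -
    have "D * R = (D * Z) * (Zi * R)"
      by (simp add: mult_assoc_dim invertible_cancel[of Z Zi n])
    then show ?thesis
      unfolding AUDR DZ by (simp add: mult_assoc_dim)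
  qed
  ultimately have A_eq: "A = (U * P) * D_A m n r\<^sub>1 r\<^sub>2 * mat_inv X"
    by (simp add: D_A)
  have "X * DB * Y = R' * ((Z * (DB * bdiag (1\<^sub>m r\<^sub>1\<^sub>1) G)) * W\<^sup>\<dagger>)"
    using p by (simp add: X_def Y mult_assoc_dim)
  also have "\<dots> = B"
    by (simp add: ZDB mult_assoc_dim invertible_cancel[of R' R n])
  finally have B_eq: "B = X * DB * Y" ..
  have UP: "U * P \<in> carrier_mat m m" "unitary_mat (U * P)"
    using unitary_mult[OF U P] by blast+
  have XY: "X \<in> carrier_mat n n" "invertible_mat X" "Y \<in> carrier_mat p p" "invertible_mat Y"
    using X_inv Y_inv by blast+
  have G': "G \<in> carrier_mat (p - r\<^sub>1\<^sub>1) (p - r\<^sub>1\<^sub>1)" "invertible_mat G"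
    using Gp by blast+
  have W': "W \<in> carrier_mat p p" "unitary_mat W"
    using W by blast+
  have d: "decreasing_upto r\<^sub>1\<^sub>1 (\<lambda>i. ds ! i)" "\<forall>i<r\<^sub>1\<^sub>1. appreciable (ds ! i) \<and> 0 < ds ! i"
    using ds_nth app ds_nth_pos r11_le by (simp_all add: decreasing_upto_def)
  have \<mu>: "decreasing_upto r\<^sub>1\<^sub>2 (\<lambda>i. inf_part (ds ! (r\<^sub>1\<^sub>1 + i)))" "\<forall>i<r\<^sub>1\<^sub>2. 0 < inf_part (ds ! (r\<^sub>1\<^sub>1 + i))"
  proof -
    have "inf_part (ds ! (r\<^sub>1\<^sub>1 + j)) \<le> inf_part (ds ! (r\<^sub>1\<^sub>1 + i))" if "i \<le> j" "j < r\<^sub>1\<^sub>2" for i j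
      using ds_nth[of "r\<^sub>1\<^sub>1 + i" "r\<^sub>1\<^sub>1 + j"] inf0[of i] inf0[of j] that ds_split
      by (auto simp: less_eq_dual_num_def less_dual_num_def)
    then show "decreasing_upto r\<^sub>1\<^sub>2 (\<lambda>i. inf_part (ds ! (r\<^sub>1\<^sub>1 + i)))"
      by (simp add: decreasing_upto_def)
    show "\<forall>i<r\<^sub>1\<^sub>2. 0 < inf_part (ds ! (r\<^sub>1\<^sub>1 + i))"
    proof (intro allI impI)
      fix i assume "i < r\<^sub>1\<^sub>2"
      then show "0 < inf_part (ds ! (r\<^sub>1\<^sub>1 + i))"
        using ds_nth_pos[of "r\<^sub>1\<^sub>1 + i"] inf0[of i] ds_split by (simp add: less_dual_num_def)
    qed
  qed
  have sizes: "k + l \<le> p - r\<^sub>1\<^sub>1" "0 \<le> r" "r + 0 + 0 \<le> k" "r + 0 + 0 \<le> r\<^sub>2" "k + 0 \<le> n' + r"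
    using re by (simp_all add: k_def b_def)
  have orth: "orthonormal_cols (N\<^sub>1 @\<^sub>r N\<^sub>2)"
    using N(2) by (simp add: orthonormal_cols_def flip: NN) (simp add: NN)
  have triv: "decreasing_upto 0 (\<lambda>_. 0 :: real)"
    "increasing_upto 0 (\<lambda>_. 0 :: real dual_num)" "decreasing_upto 0 (\<lambda>_. 0 :: real dual_num)"
    by (simp_all add: decreasing_upto_def increasing_upto_def)
  show ?thesis
    unfolding n'_def[symmetric]
    by (rule conjI[OF r12], rule exI[of _ "U * P"], rule exI[of _ X], rule exI[of _ Y],
        intro conjI UP XY A_eq,
        rule exI[of _ "r\<^sub>1\<^sub>1"], rule exI[of _ "r\<^sub>1\<^sub>2"], rule exI[of _ "\<lambda>i. ds ! i"],
        rule exI[of _ "\<lambda>i. inf_part (ds ! (r\<^sub>1\<^sub>1 + i))"], rule exI[of _ G], rule exI[of _ W],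
        rule exI[of _ k], rule exI[of _ l], rule exI[of _ r], rule exI[of _ 0], rule exI[of _ 0],
        rule exI[of _ 0], rule exI[of _ "\<lambda>_. 0"], rule exI[of _ "\<lambda>_. 0"], rule exI[of _ "\<lambda>_. 0"],
        rule exI[of _ "\<lambda>_. 0"], rule exI[of _ "N\<^sub>1"], rule exI[of _ "N\<^sub>2"],
        intro conjI r1112 G' W' Y_def d \<mu> sizes N1 N2 orth triv B_eq[unfolded DB_def S2_def S3_def])
      simp_all
qed

end
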